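(* Let $\omega\in\mathfrak{M}_{m,n}(\mathbb{R})$ be a partial permutation. If $\omega\in\widetilde{\mathfrak{Gr}}_2$, then $X_{\omega}\subset\mathfrak{M}_{m,n}(\mathbb{R})$ is a minimal submanifold.
   Context: $\mathfrak{M}_{m,n}(\mathbb{R})$ is the space of real $m\times n$ matrices with the inner product $\langle A,B\rangle=\mathrm{tr}(A^TB)$. A matrix $\omega\in\mathfrak{M}_{m,n}(\mathbb{R})$ is a partial permutation if each row and each column contains at most one entry equal to $1$ and all other entries are $0$. Extension: put $a_i=j$ if $\omega_{ij}=1$ for some $j$, and $a_i=\infty$ otherwise ($1\le i\le m$). The extension $\tilde\omega\in\mathfrak{S}_{m+n}$ is defined inductively by $\tilde\omega(i)=a_i$ if $i\le m$ and $a_i\le n$; $\tilde\omega(i)=\min([n+1,m+n]\setminus\{\tilde\omega(1),\dots,\tilde\omega(i-1)\})$ if $i\le m$ and $a_i=\infty$; $\tilde\omega(i)=\min([1,m+n]\setminus\{\tilde\omega(1),\dots,\tilde\omega(i-1)\})$ if $i>m$. The Rothe diagram of $\omega$ is $\mathcal{D}(\omega)=\{(i,j)\in[1,m+n]^2 : \tilde\omega(i)>j,\ \tilde\omega^{-1}(j)>i\}$; it is contained in $[1,m]\times[1,n]$ (it consists of the positions remaining after deleting each $1$ of $\omega$ together with all entries to its right and below). $\omega$ is vexillary if there are no $i_1<i_2<i_3<i_4$ with $\tilde\omega(i_2)<\tilde\omega(i_1)<\tilde\omega(i_4)<\tilde\omega(i_3)$. $\mathfrak{Gr}_2$ is the set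 of vexillary partial permutations (of any size) of one of the block forms $$\begin{pmatrix} I_r & O\\ O & O\end{pmatrix},\quad \begin{pmatrix} I_{r_1} & O & O & O\\ O & O & I_{r_2} & O\\ O & O & O & O\end{pmatrix},\quad \begin{pmatrix} I_{r_1} & O & O\\ O & O & O\\ O & I_{r_2} & O\\ O & O & O\end{pmatrix},$$ where $I_r$ is the $r\times r$ identity matrix and each $O$ is a zero matrix of appropriate size (block sizes are arbitrary). $\widetilde{\mathfrak{Gr}}_2$ is the set of partial permutations $\mu$ (of any size) such that $\mathcal{D}(\mu)=\mathcal{D}(\omega)$ for some $\omega\in\mathfrak{Gr}_2$. $A_{[p,q]}$ denotes the upper-left $p\times q$ submatrix of $A$, and $X_\omega=\{A\in\mathfrak{M}_{m,n}(\mathbb{R}) : \mathrm{rk}(A_{[p,q]})=\mathrm{rk}(\omega_{[p,q]})\text{ for all }1\le p\le m,\ 1\le q\le n\}$, which is a smooth submanifold of $\mathfrak{M}_{m,n}(\mathbb{R})$. A submanifold is minimal if its mean curvature vector vanishes at every point. *)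

theory Defs
  imports "HOL-Analysis.Analysis" "Jordan_Normal_Form.DL_Rank" "Jordan_Normal_Form.DL_Submatrix"
begin

section \<open>Partial permutations and the class \<open>Gr2_tilde\<close>\<close>

text \<open>
  The combinatorial notions range over matrices of all sizes, so they are defined on
  \<open>real mat\<close>. Rows, columns and the points permuted by the extension are numbered from 0:
  an \<open>m \<times> n\<close> matrix has rows \<open>{..<m}\<close>, columns \<open>{..<n}\<close>, and its extension permutes
  \<open>{..<m + n}\<close>. In particular the value \<open>n + k\<close> below stands for \<open>n + k + 1\<close> in 1-based numbering.
\<close>

definition partial_permutation :: "real mat \<Rightarrow> bool" where
  "partial_permutation \<omega> \<longleftrightarrow>
     (\<forall>i<dim_row \<omega>. \<forall>j<dim_col \<omega>. \<omega> $$ (i, j) = 0 \<or> \<omega> $$ (i, j) = 1) \<and>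
     (\<forall>i<dim_row \<omega>. \<exists>\<^sub>\<le>\<^sub>1 j. j < dim_col \<omega> \<and> \<omega> $$ (i, j) = 1) \<and>
     (\<forall>j<dim_col \<omega>. \<exists>\<^sub>\<le>\<^sub>1 i. i < dim_row \<omega> \<and> \<omega> $$ (i, j) = 1)"

text \<open>Only the values at \<open>i < dim_row \<omega> + dim_col \<omega>\<close> are meaningful.\<close>

fun extension :: "real mat \<Rightarrow> nat \<Rightarrow> nat" where
  "extension \<omega> i =
     (if i < dim_row \<omega> then
        if \<exists>j<dim_col \<omega>. \<omega> $$ (i, j) = 1
        then (THE j. j < dim_col \<omega> \<and> \<omega> $$ (i, j) = 1)
        else Min ({dim_col \<omega>..<dim_row \<omega> + dim_col \<omega>} - extension \<omega> ` {..<i})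
      else Min ({..<dim_row \<omega> + dim_col \<omega>} - extension \<omega> ` {..<i}))"

declare extension.simps [simp del]

definition rothe_diagram :: "real mat \<Rightarrow> (nat \<times> nat) set" where
  "rothe_diagram \<omega> =
     (let N = dim_row \<omega> + dim_col \<omega> in
      {(i, j). i < N \<and> j < N \<and> j < extension \<omega> i \<and> i < inv_into {..<N} (extension \<omega>) j})"

definition vexillary :: "real mat \<Rightarrow> bool" where
  "vexillary \<omega> \<longleftrightarrow>
     \<not> (\<exists>i1 i2 i3 i4. i1 < i2 \<and> i2 < i3 \<and> i3 < i4 \<and> i4 < dim_row \<omega> + dim_col \<omega> \<and>
          extension \<omega> i2 < extension \<omega> i1 \<and>
          extension \<omega> i1 < extension \<omega> i4 \<and>
          extension \<omega> i4 < extension \<omega> i3)"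

text \<open>
  A diagonal block \<open>0\<^sub>m 0 c\<close> inserts \<open>c\<close> zero columns and no rows, and \<open>0\<^sub>m c 0\<close> inserts
  \<open>c\<close> zero rows and no columns. So the last two disjuncts are the block forms
  \<open>(I O O O; O O I O; O O O O)\<close> and \<open>(I O O; O O O; O I O; O O O)\<close>.
\<close>

definition Gr2 :: "real mat set" where
  "Gr2 = {\<omega>. partial_permutation \<omega> \<and> vexillary \<omega> \<and>
     ((\<exists>r a b. \<omega> = diag_block_mat [1\<^sub>m r, 0\<^sub>m a b]) \<or>
      (\<exists>r1 r2 c a b. \<omega> = diag_block_mat [1\<^sub>m r1, 0\<^sub>m 0 c, 1\<^sub>m r2, 0\<^sub>m a b]) \<or>
      (\<exists>r1 r2 c a b. \<omega> = diag_block_mat [1\<^sub>m r1, 0\<^sub>m c 0, 1\<^sub>m r2, 0\<^sub>m a b]))}"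

definition Gr2_tilde :: "real mat set" where
  "Gr2_tilde = {\<mu>. partial_permutation \<mu> \<and> (\<exists>\<omega>\<in>Gr2. rothe_diagram \<mu> = rothe_diagram \<omega>)}"


section \<open>The matrix space and the sets \<open>X\<^sub>\<omega>\<close>\<close>

text \<open>
  The space of \<open>m \<times> n\<close> matrices is \<open>real^'n^'m\<close> with \<open>m = CARD('m)\<close> and \<open>n = CARD('n)\<close>; its
  library inner product is \<open>\<Sum>i. \<Sum>j. A $ i $ j * B $ i $ j\<close>, the trace of the product of the
  transpose of \<open>A\<close> with \<open>B\<close>. The linear orders on the index types determine which row or
  column is the first, the second, and so on.
\<close>

definition nth_index :: "nat \<Rightarrow> 'i::{finite,linorder}" where
  "nth_index k = sorted_list_of_set UNIV ! k"

definition to_mat :: "real^'n::{finite,linorder}^'m::{finite,linorder} \<Rightarrow> real mat" where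
  "to_mat A = Matrix.mat CARD('m) CARD('n)
     (\<lambda>(i, j). vec_nth (vec_nth A (nth_index i)) (nth_index j))"

definition corner_rank :: "nat \<Rightarrow> nat \<Rightarrow> real^'n::{finite,linorder}^'m::{finite,linorder} \<Rightarrow> nat" where
  "corner_rank p q A = vec_space.rank p (submatrix (to_mat A) {..<p} {..<q})"

definition X_set :: "real^'n::{finite,linorder}^'m::{finite,linorder} \<Rightarrow>
    (real^'n::{finite,linorder}^'m::{finite,linorder}) set" where
  "X_set \<omega> = {A. \<forall>p\<in>{1..CARD('m)}. \<forall>q\<in>{1..CARD('n)}. corner_rank p q A = corner_rank p q \<omega>}"


section \<open>Minimal submanifolds of a Euclidean space\<close>

text \<open>For open \<open>S\<close>, \<open>Ck_on k f S\<close> says that \<open>f\<close> is \<open>k\<close> times continuously differentiable on \<open>S\<close>.\<close>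

fun Ck_on :: "nat \<Rightarrow> ('a::euclidean_space \<Rightarrow> 'b::euclidean_space) \<Rightarrow> 'a set \<Rightarrow> bool" where
  "Ck_on 0 f S \<longleftrightarrow> continuous_on S f"
| "Ck_on (Suc k) f S \<longleftrightarrow>
     (\<forall>x\<in>S. f differentiable (at x)) \<and>
     (\<forall>v. Ck_on k (\<lambda>x. frechet_derivative f (at x) v) S)"

definition smooth_on :: "('a::euclidean_space \<Rightarrow> 'b::euclidean_space) \<Rightarrow> 'a set \<Rightarrow> bool" where
  "smooth_on f S \<longleftrightarrow> (\<forall>k. Ck_on k f S)"

text \<open>Embedded submanifolds of dimension \<open>d\<close>, by slice charts \<open>F : U \<rightarrow> V\<close> with inverse \<open>G\<close>.\<close>

definition smooth_submanifold :: "nat \<Rightarrow> 'a::euclidean_space set \<Rightarrow> bool" where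
  "smooth_submanifold d M \<longleftrightarrow>
     (\<forall>p\<in>M. \<exists>U (V :: 'a set) F G E.
        open U \<and> p \<in> U \<and> open V \<and> homeomorphism U V F G \<and>
        smooth_on F U \<and> smooth_on G V \<and>
        Real_Vector_Spaces.subspace E \<and> Real_Vector_Spaces.dim E = d \<and> F ` (M \<inter> U) = E \<inter> V)"

definition tangent_space :: "'a::euclidean_space set \<Rightarrow> 'a \<Rightarrow> 'a set" where
  "tangent_space M p =
     {v. \<exists>\<gamma> e. e > 0 \<and> smooth_on \<gamma> {-e<..<e} \<and> \<gamma> ` {-e<..<e} \<subseteq> M \<and> \<gamma> 0 = p \<and>
               (\<gamma> has_vector_derivative v) (at (0::real))}"

definition normal_part :: "'a::euclidean_space set \<Rightarrow> 'a \<Rightarrow> 'a \<Rightarrow> 'a" where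
  "normal_part M p w =
     (THE \<nu>. \<nu> \<in> orthogonal_comp (tangent_space M p) \<and> w - \<nu> \<in> tangent_space M p)"

definition tangent_extension :: "'a::euclidean_space set \<Rightarrow> 'a \<Rightarrow> 'a \<Rightarrow> ('a \<Rightarrow> 'a) \<Rightarrow> bool" where
  "tangent_extension M p v Y \<longleftrightarrow>
     Y p = v \<and>
     (\<exists>U. open U \<and> p \<in> U \<and> smooth_on Y U \<and> (\<forall>x\<in>M \<inter> U. Y x \<in> tangent_space M x))"

text \<open>
  \<open>II(u, v) = (D\<^sub>u Y)\<^sup>\<bottom>\<close>, the normal part of the derivative in direction \<open>u\<close> of any local vector
  field \<open>Y\<close> that is tangent to \<open>M\<close> along \<open>M\<close> and has \<open>Y p = v\<close>. On a submanifold such \<open>Y\<close> exist and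
  the normal part does not depend on the one chosen.
\<close>

definition second_fundamental_form :: "'a::euclidean_space set \<Rightarrow> 'a \<Rightarrow> 'a \<Rightarrow> 'a \<Rightarrow> 'a" where
  "second_fundamental_form M p u v =
     (let Y = (SOME Y. tangent_extension M p v Y)
      in normal_part M p (frechet_derivative Y (at p) u))"

definition orthonormal_basis_of :: "'a::euclidean_space set \<Rightarrow> 'a set \<Rightarrow> bool" where
  "orthonormal_basis_of T B \<longleftrightarrow>
     pairwise real_inner_class.orthogonal B \<and> (\<forall>b\<in>B. norm b = 1) \<and> Real_Vector_Spaces.span B = T"

text \<open>
  The mean curvature vector is the trace of the second fundamental form, which is independent of
  the orthonormal basis; dividing it by the dimension would not change where it vanishes.
\<close>

definition mean_curvature :: "'a::euclidean_space set \<Rightarrow> 'a \<Rightarrow> 'a" where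
  "mean_curvature M p =
     (let B = (SOME B. orthonormal_basis_of (tangent_space M p) B)
      in \<Sum>b\<in>B. second_fundamental_form M p b b)"

definition minimal_submanifold :: "'a::euclidean_space set \<Rightarrow> bool" where
  "minimal_submanifold M \<longleftrightarrow>
     (\<exists>d. smooth_submanifold d M) \<and> (\<forall>p\<in>M. mean_curvature M p = 0)"

end

(*
  The cells outside the diagram D of \<omega> are coordinates on X_\<omega>: near X_\<omega> the rank conditions say that each entry
  in a cell (p, q) of D is a rational function (Cramer's rule) of the entries outside D. So X_\<omega> is a graph, of
  dimension mn - card D.

  For \<omega> in the class Gr2_tilde, D is a union of at most two rectangles that share their last row (or, after
  transposing, their last column), so X_\<omega> is cut out near each of its points by upper bounds on the ranks
  of two nested blocks. Through every A in X_\<omega> there are then mn - card D pairwise orthogonal lines, in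
  directions of rank one, along which both rank bounds persist. The second fundamental form vanishes on
  the direction of a line contained in the submanifold. As these directions form an orthonormal basis of the tangent
  space, its trace, the mean curvature, is zero.
*)

theory Submission
  imports Defs
begin

text \<open>\<open>mean_curvature\<close> and \<open>second_fundamental_form\<close> rest on
  SOME-choices of a basis and of tangent fields. Comparing an arbitrary choice with a slice chart
  shows the form to be minus the normal part of the pulled-back Hessian of the chart: bilinear and
  free of choices. Only then can its trace be moved to the basis given by the lines.

  Lines control upper bounds of ranks, whereas X asks for equalities. The lower bounds come from
  openness: on X the minors at the 1s do not vanish, so they do not vanish nearby
  (\<open>generic\<close>), and there upper bounds at the cells of D suffice.

  A matrix in the class need not have block form itself, so everything is read off D: the rank
  prescribed at a cell of D is the number of cells outside D above it, or to its left.

  The number of lines comes from linear algebra. In orthonormal bases adapted to the row and column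
  spaces of the two nested blocks, of ranks k1 and k2, the products \<open>tensor u v\<close> not
  known to keep both bounds number (k2 - k1)(|J1| - k1) + (|I| - k2)(|J2| - k2), and this is exactly
  card D.\<close>

no_notation Matrix.scalar_prod (infix \<open>\<bullet>\<close> 70)
no_notation Matrix.vec_index (infixl \<open>$\<close> 100)
hide_const (open) Determinant.det Matrix.row Matrix.mat Matrix.orthogonal Matrix.rows VectorSpace.subspace
hide_fact (open) Determinant.det_def Matrix.vec_eq_iff Matrix.row_def Matrix.orthogonal_def Matrix.rows_def

section \<open>Smooth maps\<close>

lemma frechet_derivative_eqI:
  "(f has_derivative f') (at x) \<Longrightarrow> frechet_derivative f (at x) = f'"
  by (metis frechet_derivative_at)

lemma has_frechet_derivative:
  "f differentiable (at x) \<Longrightarrow> (f has_derivative frechet_derivative f (at x)) (at x)"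
  by (simp add: frechet_derivative_works)

lemma frechet_derivative_cong_open:
  assumes "open S" "x \<in> S" "\<And>y. y \<in> S \<Longrightarrow> f y = g y"
  shows "(f has_derivative D) (at x) \<longleftrightarrow> (g has_derivative D) (at x)"
    and "frechet_derivative f (at x) = frechet_derivative g (at x)"
    and "f differentiable (at x) \<longleftrightarrow> g differentiable (at x)"
proof -
  have *: "(f has_derivative D) (at x) \<longleftrightarrow> (g has_derivative D) (at x)" for D
    using assms has_derivative_transform_within_open[of f D x UNIV S g]
      has_derivative_transform_within_open[of g D x UNIV S f] by auto
  show "(f has_derivative D) (at x) \<longleftrightarrow> (g has_derivative D) (at x)"
    "frechet_derivative f (at x) = frechet_derivative g (at x)"
    "f differentiable (at x) \<longleftrightarrow> g differentiable (at x)"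
    unfolding frechet_derivative_def differentiable_def * by auto
qed

lemma Ck_on_cong:
  assumes "open S" "\<And>x. x \<in> S \<Longrightarrow> f x = g x"
  shows "Ck_on k f S \<longleftrightarrow> Ck_on k g S"
  using assms(2)
proof (induction k arbitrary: f g)
  case 0 then show ?case using continuous_on_cong[of S S f g] by simp
next
  case (Suc k)
  have "Ck_on k (\<lambda>x. frechet_derivative f (at x) v) S \<longleftrightarrow> Ck_on k (\<lambda>x. frechet_derivative g (at x) v) S" for v
    by (rule Suc.IH) (simp add: frechet_derivative_cong_open(2)[OF assms(1) _ Suc.prems])
  then show ?case
    using frechet_derivative_cong_open(3)[OF assms(1) _ Suc.prems] by simp
qed

lemma Ck_on_SucI:
  assumes "open S" "\<And>x. x \<in> S \<Longrightarrow> (f has_derivative f' x) (at x)"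
    "\<And>v. Ck_on k (\<lambda>x. f' x v) S"
  shows "Ck_on (Suc k) f S"
proof -
  have "frechet_derivative f (at x) = f' x" if "x \<in> S" for x
    using assms(2)[OF that] by (rule frechet_derivative_eqI)
  then have "Ck_on k (\<lambda>x. frechet_derivative f (at x) v) S" for v
    using assms(3)[of v] Ck_on_cong[OF assms(1), of "\<lambda>x. frechet_derivative f (at x) v" "\<lambda>x. f' x v" k]
    by auto
  then show ?thesis using assms(2) by (auto simp: differentiable_def)
qed

lemma Ck_on_SucD: "Ck_on (Suc k) f S \<Longrightarrow> Ck_on k f S"
proof (induction k arbitrary: f)
  case 0 then show ?case
    by (auto intro!: differentiable_imp_continuous_on simp: differentiable_on_def differentiable_at_withinI)
next
  case (Suc k) then show ?case by (metis Ck_on.simps(2))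
qed

lemma Ck_on_subset: "Ck_on k f S \<Longrightarrow> T \<subseteq> S \<Longrightarrow> Ck_on k f T"
  by (induction k arbitrary: f) (auto intro: continuous_on_subset)

lemma Ck_on_const: "open S \<Longrightarrow> Ck_on k (\<lambda>x. c) S"
proof (induction k arbitrary: c)
  case (Suc k) then show ?case by (intro Ck_on_SucI[where f' = "\<lambda>_ _. 0"]) auto
qed simp

lemma Ck_on_bounded_linear: "open S \<Longrightarrow> bounded_linear f \<Longrightarrow> Ck_on k f S"
proof (cases k)
  case 0 assume "open S" "bounded_linear f" then show ?thesis using 0 by (simp add: linear_continuous_on)
next
  case (Suc l) assume "open S" "bounded_linear f" then show ?thesis
    by (simp only: Suc, intro Ck_on_SucI[where f' = "\<lambda>_. f"])
      (auto intro: Ck_on_const bounded_linear_imp_has_derivative)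
qed

lemma Ck_on_add:
  assumes "open S"
  shows "Ck_on k f S \<Longrightarrow> Ck_on k g S \<Longrightarrow> Ck_on k (\<lambda>x. f x + g x) S"
proof (induction k arbitrary: f g)
  case 0 then show ?case by (simp add: continuous_on_add)
next
  case (Suc k)
  then show ?case
    by (intro Ck_on_SucI[OF assms, where f' = "\<lambda>x v. frechet_derivative f (at x) v + frechet_derivative g (at x) v"])
      (auto intro!: has_derivative_add has_frechet_derivative)
qed

lemma Ck_on_sum:
  assumes "open S" "finite I" "\<And>i. i \<in> I \<Longrightarrow> Ck_on k (f i) S"
  shows "Ck_on k (\<lambda>x. \<Sum>i\<in>I. f i x) S"
  using assms(2,3) by (induction I) (auto intro!: Ck_on_add Ck_on_const assms(1))

lemma Ck_on_bilinear:
  assumes "open S" "bounded_bilinear B"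
  shows "Ck_on k f S \<Longrightarrow> Ck_on k g S \<Longrightarrow> Ck_on k (\<lambda>x. B (f x) (g x)) S"
proof (induction k arbitrary: f g)
  case 0 then show ?case using bounded_bilinear.continuous_on[OF assms(2)] by auto
next
  case (Suc k)
  show ?case
  proof (rule Ck_on_SucI[OF assms(1), where f' = "\<lambda>x v. B (f x) (frechet_derivative g (at x) v) + B (frechet_derivative f (at x) v) (g x)"])
    fix x assume "x \<in> S"
    then show "((\<lambda>x. B (f x) (g x)) has_derivative (\<lambda>v. B (f x) (frechet_derivative g (at x) v) + B (frechet_derivative f (at x) v) (g x))) (at x)"
      using Suc.prems by (auto intro!: bounded_bilinear.FDERIV[OF assms(2)] has_frechet_derivative)
  next
    fix v
    show "Ck_on k (\<lambda>x. B (f x) (frechet_derivative g (at x) v) + B (frechet_derivative f (at x) v) (g x)) S"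
      using Suc.prems by (intro Ck_on_add assms(1) Suc.IH) (auto intro: Ck_on_SucD simp del: Ck_on.simps, auto)
  qed
qed

lemma Ck_on_compose:
  assumes "open S" "open T" "f ` S \<subseteq> T"
  shows "Ck_on k g T \<Longrightarrow> Ck_on k f S \<Longrightarrow> Ck_on k (\<lambda>x. g (f x)) S"
proof (induction k arbitrary: g)
  case 0 then show ?case using continuous_on_compose2[OF _ _ assms(3)] by auto
next
  case (Suc k)
  show ?case
  \<comment> \<open>\<open>Ck_on\<close> controls the derivative of \<open>g\<close> only in fixed
    directions, while the chain rule applies it to a vector that varies with \<open>x\<close>.
    Expanding that vector in \<open>Basis\<close> resolves this.\<close>
  proof (rule Ck_on_SucI[OF assms(1), where f' = "\<lambda>x v. \<Sum>b\<in>Basis. (frechet_derivative f (at x) v \<bullet> b) *\<^sub>R frechet_derivative g (at (f x)) b"])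
    fix x assume x: "x \<in> S"
    then have g: "(g has_derivative frechet_derivative g (at (f x))) (at (f x))"
      using Suc.prems assms(3) by (intro has_frechet_derivative) auto
    have f: "(f has_derivative frechet_derivative f (at x)) (at x)"
      using Suc.prems x by (intro has_frechet_derivative) auto
    interpret linear "frechet_derivative g (at (f x))" using g by (rule has_derivative_linear)
    have "frechet_derivative g (at (f x)) w = (\<Sum>b\<in>Basis. (w \<bullet> b) *\<^sub>R frechet_derivative g (at (f x)) b)" for w
      by (subst euclidean_representation[of w, symmetric]) (simp add: sum scale)
    then have "frechet_derivative g (at (f x)) \<circ> frechet_derivative f (at x) =
        (\<lambda>v. \<Sum>b\<in>Basis. (frechet_derivative f (at x) v \<bullet> b) *\<^sub>R frechet_derivative g (at (f x)) b)"
      unfolding o_def by (intro ext)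
    then show "((\<lambda>x. g (f x)) has_derivative (\<lambda>v. \<Sum>b\<in>Basis. (frechet_derivative f (at x) v \<bullet> b) *\<^sub>R frechet_derivative g (at (f x)) b)) (at x)"
      using diff_chain_at[OF f g] unfolding o_def by argo
  next
    fix v
    have "Ck_on k (\<lambda>x. frechet_derivative g (at (f x)) b) S" for b
      using Suc.prems(1) by (intro Suc.IH Ck_on_SucD[OF Suc.prems(2)]) auto
    moreover have "Ck_on k (\<lambda>x. frechet_derivative f (at x) v \<bullet> b) S" for b
      using Suc.prems(2)
      by (intro Ck_on_bilinear[OF assms(1) bounded_bilinear_inner] Ck_on_const assms(1)) auto
    ultimately show "Ck_on k (\<lambda>x. \<Sum>b\<in>Basis. (frechet_derivative f (at x) v \<bullet> b) *\<^sub>R frechet_derivative g (at (f x)) b) S"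
      by (intro Ck_on_sum assms(1) Ck_on_bilinear[OF assms(1) bounded_bilinear_scaleR]) auto
  qed
qed

text \<open>The derivative is again built from products of \<open>inverse\<close>, so the induction
  hypothesis applies to it.\<close>

lemma Ck_on_inverse: "Ck_on k (inverse :: real \<Rightarrow> real) (- {0})"
proof (induction k)
  case 0 then show ?case by (auto intro!: continuous_intros)
next
  case (Suc k)
  have o: "open (- {0::real})" by auto
  show ?case
  proof (rule Ck_on_SucI[OF o, where f' = "\<lambda>x v. (inverse x * inverse x) * (- v)"])
    fix x :: real assume "x \<in> - {0}"
    then have "(inverse has_derivative (\<lambda>v. - (inverse x * v * inverse x))) (at x)"
      by (intro has_derivative_inverse') auto
    then show "(inverse has_derivative (\<lambda>v. inverse x * inverse x * (- v))) (at x)"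
      by (simp add: mult.commute mult.left_commute)
  qed (intro Ck_on_bilinear[OF o bounded_bilinear_mult] Suc.IH Ck_on_const o)
qed

lemma smooth_on_cong:
  "open S \<Longrightarrow> (\<And>x. x \<in> S \<Longrightarrow> f x = g x) \<Longrightarrow> smooth_on f S \<longleftrightarrow> smooth_on g S"
  unfolding smooth_on_def using Ck_on_cong by blast

lemma smooth_on_subset: "smooth_on f S \<Longrightarrow> T \<subseteq> S \<Longrightarrow> smooth_on f T"
  unfolding smooth_on_def using Ck_on_subset by blast

lemma smooth_on_const: "open S \<Longrightarrow> smooth_on (\<lambda>x. c) S"
  by (simp add: smooth_on_def Ck_on_const)

lemma smooth_on_bounded_linear: "open S \<Longrightarrow> bounded_linear f \<Longrightarrow> smooth_on f S"
  by (simp add: smooth_on_def Ck_on_bounded_linear)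

lemma smooth_on_add:
  "open S \<Longrightarrow> smooth_on f S \<Longrightarrow> smooth_on g S \<Longrightarrow> smooth_on (\<lambda>x. f x + g x) S"
  by (simp add: smooth_on_def Ck_on_add)

lemma smooth_on_sum:
  "open S \<Longrightarrow> finite I \<Longrightarrow> (\<And>i. i \<in> I \<Longrightarrow> smooth_on (f i) S) \<Longrightarrow> smooth_on (\<lambda>x. \<Sum>i\<in>I. f i x) S"
  by (simp add: smooth_on_def Ck_on_sum)

lemma smooth_on_bilinear:
  "open S \<Longrightarrow> bounded_bilinear B \<Longrightarrow> smooth_on f S \<Longrightarrow> smooth_on g S \<Longrightarrow> smooth_on (\<lambda>x. B (f x) (g x)) S"
  by (simp add: smooth_on_def Ck_on_bilinear)

lemma smooth_on_compose:
  "open S \<Longrightarrow> open T \<Longrightarrow> f ` S \<subseteq> T \<Longrightarrow> smooth_on g T \<Longrightarrow> smooth_on f S \<Longrightarrow> smooth_on (\<lambda>x. g (f x)) S"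
  unfolding smooth_on_def using Ck_on_compose by blast

lemma smooth_on_scaleR:
  "open S \<Longrightarrow> smooth_on f S \<Longrightarrow> smooth_on g S \<Longrightarrow> smooth_on (\<lambda>x. f x *\<^sub>R g x) S"
  by (rule smooth_on_bilinear[OF _ bounded_bilinear_scaleR])

lemma smooth_on_mult:
  fixes f g :: "'a::euclidean_space \<Rightarrow> real"
  shows "open S \<Longrightarrow> smooth_on f S \<Longrightarrow> smooth_on g S \<Longrightarrow> smooth_on (\<lambda>x. f x * g x) S"
  by (rule smooth_on_bilinear[OF _ bounded_bilinear_mult])

lemma smooth_on_diff:
  fixes f g :: "'a::euclidean_space \<Rightarrow> 'b::euclidean_space"
  assumes "open S" "smooth_on f S" "smooth_on g S"
  shows "smooth_on (\<lambda>x. f x - g x) S"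
proof -
  have "smooth_on (\<lambda>x. f x + (-1) *\<^sub>R g x) S"
    by (intro smooth_on_add smooth_on_scaleR smooth_on_const assms)
  then show ?thesis by simp
qed

lemma smooth_on_prod:
  fixes f :: "'i \<Rightarrow> 'a::euclidean_space \<Rightarrow> real"
  assumes "open S" "finite I" "\<And>i. i \<in> I \<Longrightarrow> smooth_on (f i) S"
  shows "smooth_on (\<lambda>x. \<Prod>i\<in>I. f i x) S"
  using assms(2,3) by (induction I) (auto intro!: smooth_on_mult smooth_on_const assms(1))

lemma smooth_on_divide:
  fixes f g :: "'a::euclidean_space \<Rightarrow> real"
  assumes "open S" "smooth_on f S" "smooth_on g S" "\<And>x. x \<in> S \<Longrightarrow> g x \<noteq> 0"
  shows "smooth_on (\<lambda>x. f x / g x) S"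
proof -
  have "smooth_on (\<lambda>x. inverse (g x)) S"
    by (rule smooth_on_compose[OF assms(1) _ _ _ assms(3), of "- {0}"])
      (use assms(4) in \<open>auto simp: smooth_on_def Ck_on_inverse\<close>)
  then show ?thesis unfolding divide_inverse by (intro smooth_on_mult assms)
qed

lemma smooth_on_det:
  fixes f :: "'a::euclidean_space \<Rightarrow> real^'n^'n"
  assumes "open S" "\<And>i j. smooth_on (\<lambda>x. f x $ i $ j) S"
  shows "smooth_on (\<lambda>x. det (f x)) S"
  unfolding det_def
  by (intro smooth_on_sum smooth_on_mult smooth_on_prod smooth_on_const assms finite)

lemma smooth_on_matrixI:
  fixes f :: "'a::euclidean_space \<Rightarrow> real^'n^'m"
  assumes S: "open S" "\<And>i j. smooth_on (\<lambda>x. f x $ i $ j) S"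
  shows "smooth_on f S"
proof -
  have *: "(\<Sum>j\<in>UNIV. f x $ i $ j * (axis i (axis j 1) :: real^'n^'m) $ a $ b) = (if a = i then f x $ a $ b else 0)" for x i a b
    by (cases "a = i") (simp_all add: axis_def mult_delta_right)
  have f: "f x = (\<Sum>i\<in>UNIV. \<Sum>j\<in>UNIV. (f x $ i $ j) *\<^sub>R axis i (axis j 1))" for x
    unfolding vec_eq_iff by (simp add: *)
  have "smooth_on (\<lambda>x. \<Sum>i\<in>UNIV. \<Sum>j\<in>UNIV. (f x $ i $ j) *\<^sub>R axis i (axis j 1)) S"
    by (intro smooth_on_sum smooth_on_scaleR smooth_on_const S finite)
  then show ?thesis by (subst smooth_on_cong[OF S(1) f])
qed

lemma smooth_on_imp_continuous_on: "smooth_on f S \<Longrightarrow> continuous_on S f"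
  by (metis smooth_on_def Ck_on.simps(1))

lemma smooth_on_imp_has_derivative:
  "smooth_on f S \<Longrightarrow> x \<in> S \<Longrightarrow> (f has_derivative frechet_derivative f (at x)) (at x)"
  by (metis smooth_on_def Ck_on.simps(2) has_frechet_derivative)

lemma smooth_on_frechet_derivative:
  "smooth_on f S \<Longrightarrow> smooth_on (\<lambda>x. frechet_derivative f (at x) v) S"
  by (metis smooth_on_def Ck_on.simps(2))

section \<open>Submanifolds ruled by orthonormal lines\<close>

text \<open>Write \<open>w = y + z\<close> with \<open>y\<close> in \<open>E\<close> and
  \<open>z\<close> orthogonal to \<open>E\<close>. Then \<open>c t \<bullet> z\<close> vanishes near
  0, so its derivative \<open>w \<bullet> z\<close>, the squared norm of \<open>z\<close>, is
  0.\<close>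

lemma vector_derivative_in_subspace:
  fixes c :: "real \<Rightarrow> 'a::euclidean_space"
  assumes "subspace E" "(c has_vector_derivative w) (at 0)" "e > 0"
    and E: "\<And>t. \<bar>t\<bar> < e \<Longrightarrow> c t \<in> E"
  shows "w \<in> E"
proof -
  obtain y z where yz: "y \<in> span E" "\<And>v. v \<in> span E \<Longrightarrow> orthogonal z v" "w = y + z"
    using orthogonal_subspace_decomp_exists[of E w] by metis
  have "((\<lambda>t. c t \<bullet> z) has_vector_derivative w \<bullet> z) (at 0)"
    using bounded_linear.has_vector_derivative[OF bounded_linear_inner_left assms(2)] .
  moreover have cz: "c t \<bullet> z = 0" if "\<bar>t\<bar> < e" for t
    using yz(2)[of "c t"] E[OF that] by (auto simp: orthogonal_def inner_commute span_base)
  have "((\<lambda>t. c t \<bullet> z) has_vector_derivative 0) (at 0)"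
  proof (rule has_vector_derivative_transform_within_open[of "\<lambda>_. 0" 0 0 "ball 0 e"])
    show "0 = c t \<bullet> z" if "t \<in> ball 0 e" for t using cz[of t] that by simp
  qed (use \<open>e > 0\<close> in simp_all)
  ultimately have "w \<bullet> z = 0"
    using vector_derivative_unique_at by blast
  moreover have "y \<bullet> z = 0" using yz(1,2) by (auto simp: orthogonal_def inner_commute)
  ultimately have "z = 0" using yz(3) by (simp add: inner_add_left)
  then show ?thesis using yz span_eq_iff[THEN iffD2, OF assms(1)] by simp
qed

lemma has_vector_derivative_chain:
  assumes "(c has_vector_derivative u) (at t)" "(f has_derivative f') (at (c t))"
  shows "((\<lambda>t. f (c t)) has_vector_derivative f' u) (at t)"
  using vector_derivative_diff_chain_within[of c u t UNIV f f'] assms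
  by (simp add: o_def has_derivative_at_withinI)

text \<open>The slice chart \<open>F\<close> of \<open>smooth_submanifold\<close>, with inverse \<open>G\<close>.\<close>

locale slice_chart =
  fixes M U V :: "'a::euclidean_space set" and F G :: "'a \<Rightarrow> 'a" and E :: "'a set"
  assumes open_U: "open U" and open_V: "open V" and hom: "homeomorphism U V F G"
    and smooth_F: "smooth_on F U" and smooth_G: "smooth_on G V"
    and subspace_E: "subspace E" and image_eq: "F ` (M \<inter> U) = E \<inter> V"
begin

abbreviation "DF x \<equiv> frechet_derivative F (at x)"
abbreviation "DG y \<equiv> frechet_derivative G (at y)"

lemma G_F: "x \<in> U \<Longrightarrow> G (F x) = x" and F_G: "y \<in> V \<Longrightarrow> F (G y) = y"
  and F_in: "x \<in> U \<Longrightarrow> F x \<in> V" and G_in: "y \<in> V \<Longrightarrow> G y \<in> U"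
  using hom by (auto simp: homeomorphism_def)

lemma F_in_E: "x \<in> U \<Longrightarrow> x \<in> M \<Longrightarrow> F x \<in> E"
  using image_eq by auto

lemma G_in_M: "y \<in> V \<Longrightarrow> y \<in> E \<Longrightarrow> G y \<in> M"
proof -
  assume "y \<in> V" "y \<in> E"
  then obtain x where "x \<in> M" "x \<in> U" "y = F x" using image_eq by auto
  then show ?thesis by (simp add: G_F)
qed

lemma has_DF: "x \<in> U \<Longrightarrow> (F has_derivative DF x) (at x)"
  and has_DG: "y \<in> V \<Longrightarrow> (G has_derivative DG y) (at y)"
  using smooth_F smooth_G by (auto intro: smooth_on_imp_has_derivative)

lemma linear_DF: "x \<in> U \<Longrightarrow> linear (DF x)" and linear_DG: "y \<in> V \<Longrightarrow> linear (DG y)"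
  using has_DF has_DG has_derivative_linear by blast+

lemma DG_DF: assumes x: "x \<in> U" shows "DG (F x) (DF x v) = v"
proof -
  have "((\<lambda>x. G (F x)) has_derivative (\<lambda>v. DG (F x) (DF x v))) (at x)"
    using diff_chain_at[OF has_DF has_DG] x F_in by (auto simp: o_def)
  moreover have "((\<lambda>x. G (F x)) has_derivative (\<lambda>v. v)) (at x)"
    using frechet_derivative_cong_open(1)[OF open_U x, of "\<lambda>x. G (F x)" "\<lambda>x. x"] G_F by auto
  ultimately show ?thesis using has_derivative_unique by metis
qed

lemma DF_DG: assumes x: "x \<in> U" shows "DF x (DG (F x) v) = v"
proof -
  have y: "F x \<in> V" using x F_in by simp
  have "((\<lambda>y. F (G y)) has_derivative (\<lambda>v. DF x (DG (F x) v))) (at (F x))"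
    using diff_chain_at[OF has_DG, of "F x" F "DF x"] x y has_DF by (auto simp: o_def G_F)
  moreover have "((\<lambda>y. F (G y)) has_derivative (\<lambda>v. v)) (at (F x))"
    using frechet_derivative_cong_open(1)[OF open_V y, of "\<lambda>x. F (G x)" "\<lambda>x. x"] F_G by auto
  ultimately show ?thesis using has_derivative_unique by metis
qed

lemma curve_near:
  fixes c :: "real \<Rightarrow> 'a"
  assumes "e > 0" "c ` {-e<..<e} \<subseteq> M" "(c has_vector_derivative v) (at 0)" "open W" "c 0 \<in> W"
  obtains d where "d > 0" "\<And>t. \<bar>t\<bar> < d \<Longrightarrow> c t \<in> M \<inter> W"
proof -
  have "isCont c 0" using assms(3) has_derivative_continuous has_vector_derivative_def by blast
  then obtain d where d: "d > 0" "\<And>t. dist t 0 < d \<Longrightarrow> c t \<in> W"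
    using assms(4,5) unfolding continuous_at_open by (metis openE dist_commute mem_ball subset_eq)
  then show ?thesis
    using assms(1,2) by (intro that[of "min d e"]) (auto simp: image_subset_iff abs_less_iff)
qed

text \<open>In the chart, curves in \<open>M\<close> become curves in the subspace \<open>E\<close>,
  whose velocities stay in \<open>E\<close>. Conversely a direction in \<open>E\<close> is realised
  by a straight segment in \<open>E\<close>, pulled back by \<open>G\<close>.\<close>

lemma tangent_space_eq:
  assumes x: "x \<in> M" "x \<in> U"
  shows "tangent_space M x = {v. DF x v \<in> E}"
proof (intro subset_antisym subsetI)
  fix v assume "v \<in> tangent_space M x"
  then obtain c e where c: "e > 0" "c ` {-e<..<e} \<subseteq> M" "c 0 = x"
    "(c has_vector_derivative v) (at (0::real))"
    by (auto simp: tangent_space_def)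
  obtain d where d: "d > 0" "\<And>t. \<bar>t\<bar> < d \<Longrightarrow> c t \<in> M \<inter> U"
    using curve_near[OF c(1,2,4) open_U] c x by auto
  have "((\<lambda>t. F (c t)) has_vector_derivative DF x v) (at 0)"
    using vector_derivative_diff_chain_within[of c v 0 UNIV F "DF x"] c(3,4) has_DF[OF x(2)]
    by (simp add: o_def has_derivative_at_withinI)
  then have "DF x v \<in> E"
    by (rule vector_derivative_in_subspace[OF subspace_E _ d(1)]) (use d(2) F_in_E in auto)
  then show "v \<in> {v. DF x v \<in> E}" by simp
next
  fix v assume "v \<in> {v. DF x v \<in> E}"
  then have w: "DF x v \<in> E" by simp
  define c where "c t = F x + t *\<^sub>R DF x v" for t
  have "continuous_on UNIV c" unfolding c_def by (intro continuous_intros)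
  then have "open (c -` V)" using open_V open_vimage by blast
  moreover have "0 \<in> c -` V" using F_in x by (simp add: c_def)
  ultimately obtain e where e: "e > 0" "ball 0 e \<subseteq> c -` V" by (meson open_contains_ball)
  have ball: "ball 0 e = {-e<..<e}" by (auto simp: dist_real_def)
  have c_V: "c t \<in> V" if "t \<in> {-e<..<e}" for t using e(2) that unfolding ball by auto
  have c_E: "c t \<in> E" for t
    unfolding c_def using F_in_E x w subspace_E by (intro subspace_add subspace_scale) auto
  have c': "(c has_vector_derivative DF x v) (at 0)"
    unfolding c_def by (auto intro!: derivative_eq_intros)
  have "smooth_on c {-e<..<e}"
    unfolding c_def
    by (intro smooth_on_add smooth_on_const smooth_on_scaleR smooth_on_bounded_linear[of _ "\<lambda>t. t"]) auto
  then have 1: "smooth_on (\<lambda>t. G (c t)) {-e<..<e}"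
    by (rule smooth_on_compose[OF _ open_V _ smooth_G, rotated 2]) (use c_V in auto)
  have "((\<lambda>t. G (c t)) has_vector_derivative DG (F x) (DF x v)) (at 0)"
    using vector_derivative_diff_chain_within[of c "DF x v" 0 UNIV G "DG (F x)"] c' has_DG[of "F x"] F_in[OF x(2)]
    by (simp add: o_def has_derivative_at_withinI c_def)
  then have 2: "((\<lambda>t. G (c t)) has_vector_derivative v) (at 0)"
    using DG_DF x by simp
  show "v \<in> tangent_space M x"
    unfolding tangent_space_def
  proof (rule CollectI, intro exI conjI)
    show "(\<lambda>t. G (c t)) ` {-e<..<e} \<subseteq> M" using c_V c_E G_in_M by blast
    show "G (c 0) = x" by (simp add: c_def G_F[OF x(2)])
  qed (use e(1) 1 2 in simp_all)
qed

lemma subspace_tangent_space: "x \<in> M \<Longrightarrow> x \<in> U \<Longrightarrow> subspace (tangent_space M x)"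
  using linear_subspace_vimage[OF linear_DF subspace_E, of x] by (simp add: vimage_def tangent_space_eq)

lemma dim_tangent_space:
  assumes x: "x \<in> M" "x \<in> U" shows "dim (tangent_space M x) = dim E"
proof -
  have "tangent_space M x = DG (F x) ` E"
    unfolding tangent_space_eq[OF x]
    by (auto simp: image_iff DF_DG[OF x(2)]) (metis DG_DF x(2))
  moreover have "inj (DG (F x))" by (metis DF_DG x(2) injI)
  ultimately show ?thesis
    using dim_image_eq[OF linear_DG[OF F_in[OF x(2)]], of E] by (metis inj_on_subset subset_UNIV)
qed

text \<open>\<open>hess u v\<close> is the second derivative \<open>D\<^sup>2F(p)(u, v)\<close>.\<close>

definition hess :: "'a \<Rightarrow> 'a \<Rightarrow> 'a \<Rightarrow> 'a" where
  "hess p u v = (\<Sum>b\<in>Basis. (v \<bullet> b) *\<^sub>R frechet_derivative (\<lambda>x. DF x b) (at p) u)"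

text \<open>Product rule for the varying linear map \<open>DF x\<close> applied to the varying
  vector \<open>Y x\<close>. Smoothness of \<open>F\<close> speaks of \<open>DF x b\<close> for
  fixed \<open>b\<close>, hence the detour through \<open>Basis\<close>.\<close>

lemma has_derivative_DF:
  assumes p: "p \<in> U" and Y: "(Y has_derivative Y') (at p)"
  shows "((\<lambda>x. DF x (Y x)) has_derivative (\<lambda>u. DF p (Y' u) + hess p u (Y p))) (at p)"
proof -
  have D: "DF x w = (\<Sum>b\<in>Basis. (w \<bullet> b) *\<^sub>R DF x b)" if "x \<in> U" for x w
  proof -
    interpret linear "DF x" using linear_DF that .
    show ?thesis by (subst euclidean_representation[of w, symmetric]) (simp only: sum scale)
  qed
  have "((\<lambda>x. DF x b) has_derivative frechet_derivative (\<lambda>x. DF x b) (at p)) (at p)" for b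
    by (rule smooth_on_imp_has_derivative[OF smooth_on_frechet_derivative[OF smooth_F] p])
  then have "((\<lambda>x. \<Sum>b\<in>Basis. (Y x \<bullet> b) *\<^sub>R DF x b) has_derivative
      (\<lambda>u. \<Sum>b\<in>Basis. (Y p \<bullet> b) *\<^sub>R frechet_derivative (\<lambda>x. DF x b) (at p) u + (Y' u \<bullet> b) *\<^sub>R DF p b)) (at p)"
    using Y by (intro has_derivative_sum has_derivative_scaleR has_derivative_inner_left)
  also have "(\<lambda>u. \<Sum>b\<in>Basis. (Y p \<bullet> b) *\<^sub>R frechet_derivative (\<lambda>x. DF x b) (at p) u + (Y' u \<bullet> b) *\<^sub>R DF p b) =
      (\<lambda>u. DF p (Y' u) + hess p u (Y p))"
    by (rule ext, subst D[OF p]) (simp add: hess_def sum.distrib add.commute)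
  finally have S: "((\<lambda>x. \<Sum>b\<in>Basis. (Y x \<bullet> b) *\<^sub>R DF x b) has_derivative (\<lambda>u. DF p (Y' u) + hess p u (Y p))) (at p)" .
  have eq: "(\<Sum>b\<in>Basis. (Y x \<bullet> b) *\<^sub>R DF x b) = DF x (Y x)" if "x \<in> U" for x
    by (rule D[OF that, symmetric])
  show ?thesis
    by (rule frechet_derivative_cong_open(1)[OF open_U p, THEN iffD1, OF eq S])
qed

text \<open>Tangency of \<open>Y\<close> means that \<open>DF x (Y x)\<close> lies in
  \<open>E\<close> along \<open>M\<close>. Differentiating this along a curve with velocity
  \<open>u\<close> gives the claim. So the normal part of the derivative of \<open>Y\<close> is
  determined by \<open>hess\<close> and does not depend on \<open>Y\<close>.\<close>

lemma tangent_extension_derivative: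
  assumes p: "p \<in> M" "p \<in> U" and Y: "tangent_extension M p v Y" and u: "u \<in> tangent_space M p"
  shows "frechet_derivative Y (at p) u + DG (F p) (hess p u v) \<in> tangent_space M p"
proof -
  obtain c e where c: "e > 0" "c ` {-e<..<e} \<subseteq> M" "c 0 = p"
    "(c has_vector_derivative u) (at (0::real))"
    using u by (auto simp: tangent_space_def)
  obtain W where W: "open W" "p \<in> W" "smooth_on Y W" "\<And>x. x \<in> M \<inter> W \<Longrightarrow> Y x \<in> tangent_space M x"
    and Yp: "Y p = v"
    using Y by (auto simp: tangent_extension_def)
  obtain d where d: "d > 0" "\<And>t. \<bar>t\<bar> < d \<Longrightarrow> c t \<in> M \<inter> (W \<inter> U)"
    using curve_near[OF c(1,2,4), of "W \<inter> U"] c(3) W(1,2) p open_U by blast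
  let ?Y' = "frechet_derivative Y (at p)"
  have "((\<lambda>x. DF x (Y x)) has_derivative (\<lambda>u. DF p (?Y' u) + hess p u (Y p))) (at p)"
    by (rule has_derivative_DF[OF p(2) smooth_on_imp_has_derivative[OF W(3,2)]])
  from has_vector_derivative_chain[OF c(4), unfolded c(3), OF this]
  have "((\<lambda>t. DF (c t) (Y (c t))) has_vector_derivative (DF p (?Y' u) + hess p u v)) (at 0)"
    unfolding Yp .
  then have "DF p (?Y' u) + hess p u v \<in> E"
  proof (rule vector_derivative_in_subspace[OF subspace_E _ d(1)])
    fix t :: real assume "\<bar>t\<bar> < d"
    then show "DF (c t) (Y (c t)) \<in> E"
      using d(2)[of t] W(4)[of "c t"] tangent_space_eq[of "c t"] by auto
  qed
  moreover have "DF p (?Y' u + DG (F p) (hess p u v)) = DF p (?Y' u) + hess p u v"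
    using linear_add[OF linear_DF[OF p(2)]] DF_DG[OF p(2)] by simp
  ultimately show ?thesis by (simp add: tangent_space_eq[OF p])
qed

text \<open>The field chosen is constant in the chart, with value \<open>DF p v\<close> in
  \<open>E\<close>.\<close>

lemma tangent_extension_exists:
  assumes p: "p \<in> M" "p \<in> U" and v: "v \<in> tangent_space M p"
  shows "\<exists>Y. tangent_extension M p v Y"
proof -
  let ?Y = "\<lambda>x. DG (F x) (DF p v)"
  have "smooth_on ?Y U"
    by (rule smooth_on_compose[OF open_U open_V _ smooth_on_frechet_derivative[OF smooth_G] smooth_F])
      (use F_in in blast)
  moreover have "?Y x \<in> tangent_space M x" if "x \<in> M \<inter> U" for x
    using that v p by (simp add: tangent_space_eq DF_DG)
  ultimately show ?thesis
    unfolding tangent_extension_def using p open_U DG_DF[OF p(2)]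
    by (intro exI[of _ ?Y] conjI exI[of _ U]) auto
qed

text \<open>\<open>F\<close> maps the line into \<open>E\<close>, hence its first and second
  derivatives along the line are in \<open>E\<close>. The velocity \<open>b\<close> is constant, so
  the second derivative is \<open>hess p b b\<close> with no further term.\<close>

lemma hess_line:
  assumes p: "p \<in> M" "p \<in> U" and "e > 0" and line: "\<And>t. \<bar>t\<bar> < e \<Longrightarrow> p + t *\<^sub>R b \<in> M"
  shows "b \<in> tangent_space M p" "DG (F p) (hess p b b) \<in> tangent_space M p"
proof -
  define c where "c t = p + t *\<^sub>R b" for t
  have sub: "c ` {-e<..<e} \<subseteq> M" using line by (auto simp: c_def)
  have der: "(c has_vector_derivative b) (at t)" for t
    unfolding c_def by (auto intro!: derivative_eq_intros)
  have c0: "c 0 = p" by (simp add: c_def)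
  have "smooth_on c {-e<..<e}"
    unfolding c_def
    by (intro smooth_on_add smooth_on_const smooth_on_scaleR smooth_on_bounded_linear[of _ "\<lambda>t. t"]) auto
  then show b: "b \<in> tangent_space M p"
    unfolding tangent_space_def using sub der c0 \<open>e > 0\<close> by blast
  obtain d where d: "d > 0" "\<And>t. \<bar>t\<bar> < d \<Longrightarrow> c t \<in> M \<inter> U"
    using curve_near[OF \<open>e > 0\<close> sub der open_U] c0 p(2) by blast
  have F': "((\<lambda>t. F (c t)) has_vector_derivative DF (c t) b) (at t)" if "\<bar>t\<bar> < d" for t
    by (rule has_vector_derivative_chain[OF der has_DF]) (use d(2)[OF that] in blast)
  have E1: "DF (c t) b \<in> E" if t: "\<bar>t\<bar> < d" for t
  proof (rule vector_derivative_in_subspace[OF subspace_E])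
    \<comment> \<open>Parameter shift: the subspace lemma speaks of the derivative at 0, but the
      first derivative is needed in \<open>E\<close> at all nearby \<open>t\<close> in order to be
      differentiated again.\<close>
    have "((\<lambda>s. F (c (t + s))) has_vector_derivative DF (c t) b) (at 0)"
    proof -
      have "((\<lambda>s. t + s) has_vector_derivative 1) (at 0)"
        by (auto intro!: derivative_eq_intros)
      then show ?thesis
        using has_vector_derivative_chain[of "\<lambda>s. t + s" 1 0 "\<lambda>t. F (c t)" "\<lambda>h. h *\<^sub>R DF (c t) b"] F'[OF t]
        by (simp add: has_vector_derivative_def)
    qed
    then show "((\<lambda>s. F (c (t + s))) has_vector_derivative DF (c t) b) (at 0)" .
    show "F (c (t + s)) \<in> E" if "\<bar>s\<bar> < d - \<bar>t\<bar>" for s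
      using d(2)[of "t + s"] F_in_E that by auto
  qed (use t in auto)
  have "((\<lambda>x. DF x b) has_derivative (\<lambda>u. DF p 0 + hess p u b)) (at p)"
    using has_derivative_DF[OF p(2), of "\<lambda>_. b" "\<lambda>_. 0"] by simp
  then have "((\<lambda>t. DF (c t) b) has_vector_derivative hess p b b) (at 0)"
    using has_vector_derivative_chain[OF der[of 0], of "\<lambda>x. DF x b"] linear_0[OF linear_DF[OF p(2)]]
    unfolding c0 by auto
  then have "hess p b b \<in> E"
    by (rule vector_derivative_in_subspace[OF subspace_E _ d(1)]) (rule E1)
  then show "DG (F p) (hess p b b) \<in> tangent_space M p"
    by (simp add: tangent_space_eq[OF p] DF_DG[OF p(2)])
qed

lemma bilinear_DG_hess:
  assumes p: "p \<in> U"
  shows "bilinear (\<lambda>u v. DG (F p) (hess p u v))"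
proof -
  have DG: "linear (DG (F p))" using linear_DG F_in p by blast
  have "linear (frechet_derivative (\<lambda>x. DF x b) (at p))" for b
    by (rule has_derivative_linear[OF smooth_on_imp_has_derivative[OF smooth_on_frechet_derivative[OF smooth_F] p]])
  then have l: "frechet_derivative (\<lambda>x. DF x b) (at p) (u + u') =
      frechet_derivative (\<lambda>x. DF x b) (at p) u + frechet_derivative (\<lambda>x. DF x b) (at p) u'"
    "frechet_derivative (\<lambda>x. DF x b) (at p) (c *\<^sub>R u) = c *\<^sub>R frechet_derivative (\<lambda>x. DF x b) (at p) u" for b u u' c
    by (auto simp: linear_iff)
  show ?thesis
    unfolding bilinear_def linear_iff hess_def
    by (simp add: l linear_add[OF DG] linear_cmul[OF DG] linear_sum[OF DG] inner_add_left scaleR_left_distrib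
        scaleR_right_distrib sum.distrib scaleR_sum_right mult.commute)
qed

end


section \<open>Normal parts and the trace of the second fundamental form\<close>

lemma normal_part_eqI:
  assumes T: "subspace (tangent_space M p)" and "n \<in> orthogonal_comp (tangent_space M p)" "w - n \<in> tangent_space M p"
  shows "normal_part M p w = n"
  unfolding normal_part_def
proof (rule the_equality)
  fix n' assume n': "n' \<in> orthogonal_comp (tangent_space M p) \<and> w - n' \<in> tangent_space M p"
  have "n - n' \<in> orthogonal_comp (tangent_space M p)"
    using n' assms(2) subspace_orthogonal_comp by (auto intro: subspace_diff)
  moreover have "n - n' \<in> tangent_space M p"
    using subspace_diff[OF T, of "w - n'" "w - n"] n' assms(3) by simp
  ultimately have "orthogonal (n - n') (n - n')" unfolding orthogonal_comp_def by blast
  then show "n' = n" by (simp add: orthogonal_self)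
qed (use assms in auto)

lemma normal_part_works:
  assumes T: "subspace (tangent_space M p)"
  shows "normal_part M p w \<in> orthogonal_comp (tangent_space M p)" "w - normal_part M p w \<in> tangent_space M p"
proof -
  obtain y z where yz: "y \<in> tangent_space M p" "\<And>v. v \<in> tangent_space M p \<Longrightarrow> orthogonal z v" "w = y + z"
    using orthogonal_subspace_decomp_exists[of "tangent_space M p" w] span_eq_iff[THEN iffD2, OF T] by metis
  then have "z \<in> orthogonal_comp (tangent_space M p)" "w - z \<in> tangent_space M p"
    by (auto simp: orthogonal_comp_def orthogonal_commute)
  moreover from normal_part_eqI[OF T this] have "normal_part M p w = z" .
  ultimately show "normal_part M p w \<in> orthogonal_comp (tangent_space M p)" "w - normal_part M p w \<in> tangent_space M p"
    by auto
qed

lemma linear_normal_part: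
  assumes T: "subspace (tangent_space M p)"
  shows "linear (normal_part M p)"
proof (rule linearI)
  note C = subspace_orthogonal_comp[of "tangent_space M p"]
  fix v w c
  have "v + w - (normal_part M p v + normal_part M p w) = (v - normal_part M p v) + (w - normal_part M p w)"
    by simp
  then show "normal_part M p (v + w) = normal_part M p v + normal_part M p w"
    by (intro normal_part_eqI T subspace_add[OF C] normal_part_works)
      (simp only:, intro subspace_add T normal_part_works)
  have "c *\<^sub>R v - c *\<^sub>R normal_part M p v = c *\<^sub>R (v - normal_part M p v)"
    by (simp add: scaleR_right_diff_distrib)
  then show "normal_part M p (c *\<^sub>R v) = c *\<^sub>R normal_part M p v"
    by (intro normal_part_eqI T subspace_scale[OF C] normal_part_works)
      (simp add: T subspace_scale normal_part_works)
qed

lemma normal_part_tangent: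
  assumes "subspace (tangent_space M p)" "w \<in> tangent_space M p"
  shows "normal_part M p w = 0"
  using assms subspace_orthogonal_comp by (intro normal_part_eqI) (auto intro: subspace_0)

text \<open>Expand each \<open>c\<close> in the basis \<open>B\<close>. The coefficients satisfy
  Parseval: the sum over \<open>c\<close> of \<open>(c \<bullet> b) * (c \<bullet> b')\<close> is
  \<open>b \<bullet> b'\<close>, because \<open>C\<close> is an orthonormal basis of the same
  span.\<close>

lemma trace_orthonormal_eq:
  fixes B C :: "'a::euclidean_space set"
  assumes h: "bilinear h"
    and B: "pairwise orthogonal B" "\<And>b. b \<in> B \<Longrightarrow> norm b = 1" "finite B"
    and C: "pairwise orthogonal C" "\<And>b. b \<in> C \<Longrightarrow> norm b = 1" "finite C"
    and span: "span B = span C"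
  shows "(\<Sum>c\<in>C. h c c) = (\<Sum>b\<in>B. h b b)"
proof -
  have l: "linear (h x)" "linear (\<lambda>y. h y x)" for x using h by (auto simp: bilinear_def)
  have h_expand: "h c c = (\<Sum>b\<in>B. \<Sum>b'\<in>B. ((c \<bullet> b) * (c \<bullet> b')) *\<^sub>R h b b')" if "c \<in> C" for c
  proof -
    have c: "c = (\<Sum>b\<in>B. (c \<bullet> b) *\<^sub>R b)"
      using orthonormal_basis_expand[OF B(1,2) _ B(3), of c] that span by (auto simp: span_base)
    have "h c c = h (\<Sum>b\<in>B. (c \<bullet> b) *\<^sub>R b) (\<Sum>b\<in>B. (c \<bullet> b) *\<^sub>R b)" using c by simp
    also have "\<dots> = (\<Sum>b\<in>B. (c \<bullet> b) *\<^sub>R h b (\<Sum>b\<in>B. (c \<bullet> b) *\<^sub>R b))"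
      by (simp add: linear_sum[OF l(2)] linear_cmul[OF l(2)])
    also have "\<dots> = (\<Sum>b\<in>B. \<Sum>b'\<in>B. ((c \<bullet> b) * (c \<bullet> b')) *\<^sub>R h b b')"
      by (simp add: linear_sum[OF l(1)] linear_cmul[OF l(1)] scaleR_sum_right)
    finally show ?thesis .
  qed
  have ip: "(\<Sum>c\<in>C. (c \<bullet> b) * (c \<bullet> b')) = (if b = b' then 1 else 0)" if "b \<in> B" "b' \<in> B" for b b'
  proof -
    have "b = (\<Sum>c\<in>C. (b \<bullet> c) *\<^sub>R c)"
      using orthonormal_basis_expand[OF C(1,2) _ C(3), of b] that span by (metis span_base)
    then have "b \<bullet> b' = (\<Sum>c\<in>C. (b \<bullet> c) *\<^sub>R c) \<bullet> b'" by simp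
    also have "\<dots> = (\<Sum>c\<in>C. (c \<bullet> b) * (c \<bullet> b'))" by (simp add: inner_sum_left inner_commute[of b])
    finally show ?thesis
      using B(1) B(2)[OF that(1)] that by (auto simp: pairwise_def orthogonal_def norm_eq_1)
  qed
  have "(\<Sum>c\<in>C. h c c) = (\<Sum>c\<in>C. \<Sum>b\<in>B. \<Sum>b'\<in>B. ((c \<bullet> b) * (c \<bullet> b')) *\<^sub>R h b b')"
    using h_expand by simp
  also have "\<dots> = (\<Sum>b\<in>B. \<Sum>b'\<in>B. \<Sum>c\<in>C. ((c \<bullet> b) * (c \<bullet> b')) *\<^sub>R h b b')"
    by (subst sum.swap, rule sum.cong[OF refl], subst sum.swap) simp
  also have "\<dots> = (\<Sum>b\<in>B. \<Sum>b'\<in>B. (if b = b' then 1 else 0) *\<^sub>R h b b')"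
    by (intro sum.cong refl) (simp flip: scaleR_sum_left add: ip)
  also have "\<dots> = (\<Sum>b\<in>B. h b b)"
  proof (rule sum.cong[OF refl])
    fix b assume "b \<in> B"
    have "(\<Sum>b'\<in>B. (if b = b' then 1 else 0) *\<^sub>R h b b') = (\<Sum>b'\<in>B. if b = b' then h b b' else 0)"
      by (rule sum.cong) auto
    then show "(\<Sum>b'\<in>B. (if b = b' then 1 else 0) *\<^sub>R h b b') = h b b"
      using B(3) \<open>b \<in> B\<close> by simp
  qed
  finally show ?thesis .
qed

text \<open>The lines need not fit together into any family: a basis of line directions at each
  single point is enough, since the trace at a point needs only the values of the form
  there.\<close>

theorem minimal_submanifoldI:
  fixes M :: "'a::euclidean_space set"
  assumes M: "smooth_submanifold d M"
    and lines: "\<And>p. p \<in> M \<Longrightarrow> \<exists>B. pairwise orthogonal B \<and> (\<forall>b\<in>B. norm b = 1) \<and> card B = d \<and> finite B \<and>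
        (\<forall>b\<in>B. \<exists>e>0. \<forall>t. \<bar>t\<bar> < e \<longrightarrow> p + t *\<^sub>R b \<in> M)"
  shows "minimal_submanifold M"
  unfolding minimal_submanifold_def
proof (intro conjI ballI)
  show "\<exists>d. smooth_submanifold d M" using M by blast
  fix p assume p: "p \<in> M"
  obtain U and V :: "'a set" and F G E where chart: "open U" "p \<in> U" "open V" "homeomorphism U V F G" "smooth_on F U" "smooth_on G V"
      "subspace E" "dim E = d" "F ` (M \<inter> U) = E \<inter> V"
    using bspec[OF M[unfolded smooth_submanifold_def] p] by (elim exE conjE) (rule that; assumption)
  interpret slice_chart M U V F G E
    using chart by unfold_locales
  let ?T = "tangent_space M p"
  note T = subspace_tangent_space[OF p chart(2)]
  \<comment> \<open>The formula for the second fundamental form in the fixed chart. It is bilinear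
    on the whole space, as the trace argument requires.\<close>
  define h where "h u v = - normal_part M p (DG (F p) (hess p u v))" for u v
  have sff: "second_fundamental_form M p u v = h u v" if "u \<in> ?T" "v \<in> ?T" for u v
  proof -
    define Y where "Y = (SOME Y. tangent_extension M p v Y)"
    have "tangent_extension M p v Y"
      unfolding Y_def using tangent_extension_exists[OF p chart(2) that(2)] by (rule someI_ex)
    from tangent_extension_derivative[OF p chart(2) this that(1)]
    have "normal_part M p (frechet_derivative Y (at p) u + DG (F p) (hess p u v)) = 0"
      by (rule normal_part_tangent[OF T])
    then show ?thesis
      unfolding second_fundamental_form_def Let_def h_def Y_def[symmetric]
      by (simp add: linear_add[OF linear_normal_part[OF T]] eq_neg_iff_add_eq_0)
  qed
  obtain B where B: "pairwise orthogonal B" "\<And>b. b \<in> B \<Longrightarrow> norm b = 1" "card B = d" "finite B"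
    and line: "\<And>b. b \<in> B \<Longrightarrow> \<exists>e>0. \<forall>t. \<bar>t\<bar> < e \<longrightarrow> p + t *\<^sub>R b \<in> M"
    using lines[OF p] by metis
  have "B \<subseteq> ?T" using hess_line(1)[OF p chart(2)] line by blast
  moreover have "independent B"
    using B(1) B(2)[of 0] by (intro pairwise_orthogonal_independent) auto
  \<comment> \<open>Orthonormal vectors are independent, and there are as many as the tangent space
    has dimensions.\<close>
  ultimately have span_B: "span B = ?T"
    using dim_tangent_space[OF p chart(2)] chart(8) B(3,4) T
    by (metis card_eq_dim span_eq_iff span_minimal subset_antisym)
  define C where "C = (SOME B. orthonormal_basis_of ?T B)"
  have "orthonormal_basis_of ?T B"
    using B span_B by (simp add: orthonormal_basis_of_def)
  then have "orthonormal_basis_of ?T C" unfolding C_def by (rule someI)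
  then have C: "pairwise orthogonal C" "\<And>b. b \<in> C \<Longrightarrow> norm b = 1" "span C = ?T"
    by (auto simp: orthonormal_basis_of_def)
  have "independent C" using C(1) C(2)[of 0] by (intro pairwise_orthogonal_independent) auto
  then have fin: "finite C" using independent_bound by blast
  have "bilinear h"
    using bilinear_DG_hess[OF chart(2)] linear_normal_part[OF T]
    unfolding bilinear_def h_def by (auto simp: linear_iff)
  have "mean_curvature M p = (\<Sum>c\<in>C. second_fundamental_form M p c c)"
    by (simp add: mean_curvature_def C_def)
  also have "\<dots> = (\<Sum>c\<in>C. h c c)"
    using sff span_base[of _ C] unfolding C(3) by (intro sum.cong) auto
  also have "\<dots> = (\<Sum>b\<in>B. h b b)"
    using trace_orthonormal_eq[OF \<open>bilinear h\<close> B(1,2,4) C(1,2) fin] span_B C(3) by simp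
  also have "\<dots> = 0"
  proof (intro sum.neutral ballI)
    fix b assume "b \<in> B"
    then obtain e where "e > 0" "\<And>t. \<bar>t\<bar> < e \<Longrightarrow> p + t *\<^sub>R b \<in> M" using line by blast
    from hess_line(2)[OF p chart(2) this] show "h b b = 0"
      by (simp add: h_def normal_part_tangent[OF T])
  qed
  finally show "mean_curvature M p = 0" .
qed

section \<open>Diagrams of partial permutations\<close>

definition one_at :: "real mat \<Rightarrow> nat \<Rightarrow> nat \<Rightarrow> bool" where
  "one_at \<omega> i j \<longleftrightarrow> i < dim_row \<omega> \<and> j < dim_col \<omega> \<and> \<omega> $$ (i, j) = 1"

text \<open>The description by deletion: it refers to the 1s only and not to the extension, and it
  is symmetric in rows and columns.\<close>

definition partial_perm_diagram :: "real mat \<Rightarrow> (nat \<times> nat) set" where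
  "partial_perm_diagram \<omega> =
     {(i, j). i < dim_row \<omega> \<and> j < dim_col \<omega> \<and> (\<forall>j'\<le>j. \<not> one_at \<omega> i j') \<and> (\<forall>i'\<le>i. \<not> one_at \<omega> i' j)}"

lemma one_at_row_unique: "partial_permutation \<omega> \<Longrightarrow> one_at \<omega> i j \<Longrightarrow> one_at \<omega> i j' \<Longrightarrow> j = j'"
  unfolding partial_permutation_def one_at_def Uniq_def by blast

lemma one_at_col_unique: "partial_permutation \<omega> \<Longrightarrow> one_at \<omega> i j \<Longrightarrow> one_at \<omega> i' j \<Longrightarrow> i = i'"
  unfolding partial_permutation_def one_at_def Uniq_def by blast

text \<open>In rows without a 1, and in the rows from \<open>m\<close> on, the extension takes the
  least value still free in its range, so every smaller value of that range already occurs in an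
  earlier row. This rules out cells with \<open>i \<ge> m\<close> or \<open>j \<ge> n\<close>. In
  the remaining region a row without a 1 has a value of at least \<open>n\<close>, which exceeds
  \<open>j\<close>.\<close>

theorem rothe_diagram_eq:
  assumes pp: "partial_permutation \<omega>"
  shows "rothe_diagram \<omega> = partial_perm_diagram \<omega>"
proof -
  define m n N where "m = dim_row \<omega>" and "n = dim_col \<omega>" and "N = m + n"
  define e where "e = extension \<omega>"
  note u1 = one_at_row_unique[OF pp] and u2 = one_at_col_unique[OF pp]
  have one: "one_at \<omega> i j \<Longrightarrow> i < m \<and> j < n" for i j by (simp add: one_at_def m_def n_def)
  have e1: "e i = j" if "one_at \<omega> i j" for i j
  proof -
    have "(THE j. j < dim_col \<omega> \<and> \<omega> $$ (i, j) = 1) = j"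
      using that u1[of i] by (intro the_equality) (auto simp: one_at_def)
    then show ?thesis using that unfolding e_def by (subst extension.simps) (auto simp: one_at_def)
  qed
  have e2: "e i = Min ({n..<N} - e ` {..<i})" if "i < m" "\<And>j. \<not> one_at \<omega> i j" for i
    unfolding e_def using that by (subst extension.simps) (auto simp: one_at_def m_def n_def N_def)
  have e3: "e i = Min ({..<N} - e ` {..<i})" if "i \<ge> m" for i
    unfolding e_def using that by (subst extension.simps) (auto simp: m_def n_def N_def)
  \<comment> \<open>Pigeonhole: the \<open>i\<close> earlier values cannot exhaust a set of more
    than \<open>i\<close> elements, so each \<open>Min\<close> is taken over a nonempty set.\<close>
  have ne: "X - e ` {..<i} \<noteq> {}" if "finite X" "card X > i" for X i
  proof
    assume "X - e ` {..<i} = {}"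
    then have "card X \<le> card (e ` {..<i})" by (intro card_mono) auto
    also have "\<dots> \<le> i" using card_image_le[of "{..<i}" e] by simp
    finally show False using that by simp
  qed
  have e2_in: "e i \<in> {n..<N} - e ` {..<i}" if "i < m" "\<And>j. \<not> one_at \<omega> i j" for i
    unfolding e2[OF that] by (intro Min_in ne) (use that in \<open>auto simp: N_def\<close>)
  have e3_in: "e i \<in> {..<N} - e ` {..<i}" if "i \<ge> m" "i < N" for i
    unfolding e3[OF that(1)] by (intro Min_in ne) (use that in \<open>auto\<close>)
  have new: "e i \<noteq> e k" if "i < N" "k < i" for i k
  proof (cases "i < m \<and> (\<exists>j. one_at \<omega> i j)")
    case True
    then obtain j where j: "one_at \<omega> i j" by blast
    show ?thesis
    proof (cases "\<exists>j'. one_at \<omega> k j'")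
      case True
      then show ?thesis using e1 j u2 that by (metis less_irrefl)
    next
      case False
      then have "e k \<ge> n" using e2_in[of k] that one[OF j] by auto
      then show ?thesis using e1[OF j] one[OF j] by simp
    qed
  next
    case False
    then have "e i \<notin> e ` {..<i}" using e2_in[of i] e3_in[of i] that by (cases "i < m") auto
    then show ?thesis using that by auto
  qed
  have into: "e i < N" if "i < N" for i
  proof (cases "i < m")
    case True then show ?thesis
      using e1 one e2_in[of i] by (cases "\<exists>j. one_at \<omega> i j") (force simp: N_def)+
  qed (use that e3_in[of i] in auto)
  have inj: "inj_on e {..<N}"
    by (rule linorder_inj_onI') (use new in \<open>auto dest: not_sym\<close>)
  then have "e ` {..<N} = {..<N}" using into by (intro endo_inj_surj) auto
  then have inv: "i < inv_into {..<N} e j \<longleftrightarrow> (\<forall>k\<le>i. e k \<noteq> j)" if "j < N" "i < N" for i j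
  proof -
    obtain k where k: "k < N" "e k = j" using \<open>e ` {..<N} = {..<N}\<close> \<open>j < N\<close> by (metis imageE lessThan_iff)
    then have "inv_into {..<N} e j = k" using inv_into_f_f[OF inj] by auto
    moreover have "k' = k" if "k' \<le> i" "e k' = j" for k'
      using inj_onD[OF inj, of k' k] k that \<open>i < N\<close> by auto
    ultimately show ?thesis using k(2) by (metis linorder_not_le)
  qed
  have main: "i < N \<and> j < N \<and> j < e i \<and> (\<forall>k\<le>i. e k \<noteq> j) \<longleftrightarrow>
      i < m \<and> j < n \<and> (\<forall>j'\<le>j. \<not> one_at \<omega> i j') \<and> (\<forall>i'\<le>i. \<not> one_at \<omega> i' j)" for i j
  proof (intro iffI conjI; (elim conjE)?)
    assume *: "i < N" "j < N" "j < e i" "\<forall>k\<le>i. e k \<noteq> j"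
    have nin: "j \<notin> e ` {..<i}" using *(4) by (metis imageE lessThan_iff less_imp_le)
    show "i < m"
    proof (rule ccontr)
      assume "\<not> i < m"
      then have "e i \<le> j"
        using nin *(2) unfolding e3[OF leI[OF \<open>\<not> i < m\<close>]] by (intro Min_le) blast+
      then show False using * by simp
    qed
    show "j < n"
    proof (rule ccontr)
      assume j: "\<not> j < n"
      then have "\<not> one_at \<omega> i j'" for j' using e1[of i j'] one[of i j'] *(3) by auto
      from e2[OF \<open>i < m\<close> this] have "e i \<le> j"
        using nin *(2) j by (simp add: Min_le)
      then show False using * by simp
    qed
    show "\<forall>j'\<le>j. \<not> one_at \<omega> i j'" using e1 *(3) by (metis linorder_not_le)
    show "\<forall>i'\<le>i. \<not> one_at \<omega> i' j" using e1 *(4) by blast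
  next
    assume *: "i < m" "j < n" "\<forall>j'\<le>j. \<not> one_at \<omega> i j'" "\<forall>i'\<le>i. \<not> one_at \<omega> i' j"
    show "i < N" "j < N" using * by (auto simp: N_def)
    show "j < e i"
      using * e1 e2_in[of i] by (cases "\<exists>j. one_at \<omega> i j") (auto simp: not_le[symmetric])
    show "\<forall>k\<le>i. e k \<noteq> j"
    proof (intro allI impI)
      fix k assume "k \<le> i"
      then show "e k \<noteq> j"
        using * e1 e2_in[of k] by (cases "\<exists>j. one_at \<omega> k j") auto
    qed
  qed
  have "i < N \<and> j < N \<and> j < e i \<and> i < inv_into {..<N} e j \<longleftrightarrow>
      i < m \<and> j < n \<and> (\<forall>j'\<le>j. \<not> one_at \<omega> i j') \<and> (\<forall>i'\<le>i. \<not> one_at \<omega> i' j)" for i j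
    using main[of i j] inv[of j i] by argo
  then show ?thesis
    unfolding rothe_diagram_def partial_perm_diagram_def Let_def N_def m_def n_def e_def by simp
qed

text \<open>
  Two rectangles with common bottom row \<open>P - 1\<close>: the normal form of the diagrams of the first two
  block forms. The parameters are chosen such that \<open>k1\<close> and \<open>k2\<close> are the ranks of
  the first \<open>P\<close> rows restricted to the first \<open>J1\<close> and \<open>J2\<close> columns.
\<close>

definition stair :: "nat \<Rightarrow> nat \<Rightarrow> nat \<Rightarrow> nat \<Rightarrow> nat \<Rightarrow> (nat \<times> nat) set" where
  "stair k1 k2 P J1 J2 =
     {(i, j). i < P \<and> (k1 \<le> i \<and> k1 \<le> j \<and> j < J1 \<or> k2 \<le> i \<and> J1 + (k2 - k1) \<le> j \<and> j < J2)}"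

text \<open>The strict inequalities make the first rectangle nonempty, and the second one either
  nonempty or collapsed into \<open>J1 = J2\<close>, \<open>k1 = k2\<close>. Then the cells
  \<open>(P - 1, J1 - 1)\<close> and \<open>(P - 1, J2 - 1)\<close> lie in the diagram, and the
  ranks of both blocks can be read off there. The empty diagram gets all parameters 0, so that these
  ranks are right for empty blocks too.\<close>

definition stair_params :: "nat \<Rightarrow> nat \<Rightarrow> nat \<Rightarrow> nat \<Rightarrow> nat \<Rightarrow> bool" where
  "stair_params k1 k2 P J1 J2 \<longleftrightarrow> k1 \<le> k2 \<and> J1 \<le> J2 \<and>
     (k2 < P \<and> k1 < J1 \<and> (J1 = J2 \<and> k1 = k2 \<or> J1 + (k2 - k1) < J2) \<or>
      P = 0 \<and> J1 = 0 \<and> J2 = 0 \<and> k1 = 0 \<and> k2 = 0)"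

definition is_stair :: "(nat \<times> nat) set \<Rightarrow> bool" where
  "is_stair D \<longleftrightarrow> (\<exists>k1 k2 P J1 J2. stair_params k1 k2 P J1 J2 \<and> D = stair k1 k2 P J1 J2)"

lemma is_stairI: "stair_params k1 k2 P J1 J2 \<Longrightarrow> D = stair k1 k2 P J1 J2 \<Longrightarrow> is_stair D"
  unfolding is_stair_def by blast

text \<open>The cases record which rectangle is empty. If only one is left, it becomes the first
  rectangle of the normal form; if it was the second one, its corner \<open>k1 + r\<close> takes the
  place of \<open>k1\<close>.\<close>

lemma is_stair_two_rectangles:
  "is_stair {(i, j). i < k1 + r + a \<and> (k1 \<le> i \<and> k1 \<le> j \<and> j < k1 + c \<or>
     k1 + r \<le> i \<and> k1 + c + r \<le> j \<and> j < k1 + c + r + b)}"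
proof -
  consider "a = 0" "r > 0" "c > 0" | "a = 0" "r = 0 \<or> c = 0" | "a > 0" "b = 0" "c > 0" | "a > 0" "b = 0" "c = 0"
    | "a > 0" "b > 0" "c = 0" | "a > 0" "b > 0" "c > 0" by auto
  then show ?thesis
  proof cases
    case 1 then show ?thesis
      by (intro is_stairI[of k1 k1 "k1 + r" "k1 + c" "k1 + c"]) (auto simp: stair_def stair_params_def)
  next
    case 2 then show ?thesis
      by (intro is_stairI[of 0 0 0 0 0]) (auto simp: stair_def stair_params_def)
  next
    case 3 then show ?thesis
      by (intro is_stairI[of k1 k1 "k1 + r + a" "k1 + c" "k1 + c"]) (auto simp: stair_def stair_params_def)
  next
    case 4 then show ?thesis
      by (intro is_stairI[of 0 0 0 0 0]) (auto simp: stair_def stair_params_def)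
  next
    case 5 then show ?thesis
      by (intro is_stairI[of "k1 + r" "k1 + r" "k1 + r + a" "k1 + r + b" "k1 + r + b"])
        (auto simp: stair_def stair_params_def)
  next
    case 6 then show ?thesis
      by (intro is_stairI[of k1 "k1 + r" "k1 + r + a" "k1 + c" "k1 + c + r + b"])
        (auto simp: stair_def stair_params_def)
  qed
qed

lemma row_blocks:
  defines "w r1 c r2 a b \<equiv> diag_block_mat [1\<^sub>m r1, 0\<^sub>m 0 c, 1\<^sub>m r2, 0\<^sub>m a b]"
  shows "dim_row (w r1 c r2 a b) = r1 + r2 + a" "dim_col (w r1 c r2 a b) = r1 + c + r2 + b"
    "one_at (w r1 c r2 a b) i j \<longleftrightarrow> i < r1 \<and> j = i \<or> r1 \<le> i \<and> i < r1 + r2 \<and> j = i + c"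
proof -
  show d: "dim_row (w r1 c r2 a b) = r1 + r2 + a" "dim_col (w r1 c r2 a b) = r1 + c + r2 + b"
    by (auto simp: w_def Let_def)
  show "one_at (w r1 c r2 a b) i j \<longleftrightarrow> i < r1 \<and> j = i \<or> r1 \<le> i \<and> i < r1 + r2 \<and> j = i + c"
    unfolding one_at_def d by (auto simp: w_def Let_def split: if_splits)
qed

lemma diagram_row_blocks:
  "partial_perm_diagram (diag_block_mat [1\<^sub>m r1, 0\<^sub>m 0 c, 1\<^sub>m r2, 0\<^sub>m a b]) =
    {(i, j). i < r1 + r2 + a \<and> (r1 \<le> i \<and> r1 \<le> j \<and> j < r1 + c \<or>
     r1 + r2 \<le> i \<and> r1 + c + r2 \<le> j \<and> j < r1 + c + r2 + b)}" (is "partial_perm_diagram ?w = _")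
proof -
  have row: "(\<forall>j'\<le>j. \<not> one_at ?w i j') \<longleftrightarrow> \<not> (i < r1 \<and> i \<le> j \<or> r1 \<le> i \<and> i < r1 + r2 \<and> i + c \<le> j)" for i j
    unfolding row_blocks by auto
  \<comment> \<open>A 1 in column \<open>j\<close> can only be in row \<open>j\<close> (first
    identity block) or row \<open>j - c\<close> (second one); these are the two instances supplied
    below.\<close>
  have col: "(\<forall>i'\<le>i. \<not> one_at ?w i' j) \<longleftrightarrow>
      \<not> (j < r1 \<and> j \<le> i \<or> r1 + c \<le> j \<and> j < r1 + c + r2 \<and> j \<le> i + c)" for i j
    unfolding row_blocks by (auto dest: spec[of _ j] spec[of _ "j - c"])
  have "i < r1 + r2 + a \<and> j < r1 + c + r2 + b \<and> \<not> (i < r1 \<and> i \<le> j \<or> r1 \<le> i \<and> i < r1 + r2 \<and> i + c \<le> j) \<and>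
      \<not> (j < r1 \<and> j \<le> i \<or> r1 + c \<le> j \<and> j < r1 + c + r2 \<and> j \<le> i + c) \<longleftrightarrow>
    i < r1 + r2 + a \<and> (r1 \<le> i \<and> r1 \<le> j \<and> j < r1 + c \<or>
      r1 + r2 \<le> i \<and> r1 + c + r2 \<le> j \<and> j < r1 + c + r2 + b)" for i j
    by (cases "i < r1"; cases "j < r1"; cases "i \<le> j"; cases "j < r1 + c"; cases "i < r1 + r2"; cases "j < r1 + c + r2";
        cases "i + c \<le> j"; simp)
  then show ?thesis unfolding partial_perm_diagram_def row_blocks(1,2) row col by simp
qed

text \<open>The two block matrices are transposes of each other, which also exchanges the sizes
  \<open>a\<close> and \<open>b\<close> of the last zero block.\<close>

lemma diagram_column_blocks:
  "partial_perm_diagram (diag_block_mat [1\<^sub>m r1, 0\<^sub>m c 0, 1\<^sub>m r2, 0\<^sub>m a b]) =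
     (partial_perm_diagram (diag_block_mat [1\<^sub>m r1, 0\<^sub>m 0 c, 1\<^sub>m r2, 0\<^sub>m b a]))\<inverse>"
    (is "partial_perm_diagram ?w = (partial_perm_diagram ?v)\<inverse>")
proof -
  have d: "dim_row ?w = dim_col ?v" "dim_col ?w = dim_row ?v"
    unfolding row_blocks by (auto simp: Let_def)
  have one: "one_at ?w i j \<longleftrightarrow> one_at ?v j i" for i j
  proof -
    have dims: "dim_row ?w = r1 + c + r2 + a" "dim_col ?w = r1 + r2 + b" by (simp_all add: Let_def)
    have "one_at ?w i j \<longleftrightarrow> j < r1 \<and> i = j \<or> r1 \<le> j \<and> j < r1 + r2 \<and> i = j + c"
    proof (cases "i < r1 + c")
      case True
      then show ?thesis
        unfolding one_at_def dims
        by (cases "i < r1"; cases "j < r1") (simp_all add: Let_def cong: conj_cong)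
    next
      case False
      then obtain k where k: "i = r1 + c + k" by (metis le_Suc_ex linorder_not_less)
      show ?thesis
      proof (cases "j < r1")
        case True
        then show ?thesis unfolding one_at_def dims k by (simp add: Let_def cong: conj_cong)
      next
        case False
        then obtain l where l: "j = r1 + l" by (metis le_Suc_ex linorder_not_less)
        show ?thesis
          unfolding one_at_def dims k l by (cases "k < r2"; cases "l < r2"; simp add: Let_def cong: conj_cong)
      qed
    qed
    then show ?thesis unfolding row_blocks .
  qed
  have "(i, j) \<in> partial_perm_diagram ?w \<longleftrightarrow> (j, i) \<in> partial_perm_diagram ?v" for i j
    unfolding partial_perm_diagram_def one d mem_Collect_eq prod.case by argo
  then show ?thesis by auto
qed

lemma diagram_single_block:
  "partial_perm_diagram (diag_block_mat [1\<^sub>m r, 0\<^sub>m a b]) =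
     partial_perm_diagram (diag_block_mat [1\<^sub>m r, 0\<^sub>m 0 0, 1\<^sub>m 0, 0\<^sub>m a b])"
    (is "partial_perm_diagram ?w = partial_perm_diagram ?v")
proof -
  have d: "dim_row ?w = dim_row ?v" "dim_col ?w = dim_col ?v"
    unfolding row_blocks by (auto simp: Let_def)
  have one: "one_at ?w i j \<longleftrightarrow> one_at ?v i j" for i j
  proof -
    have "one_at ?w i j \<longleftrightarrow> i < r \<and> j = i"
      unfolding one_at_def d row_blocks by (auto simp: Let_def split: if_splits)
    then show ?thesis unfolding row_blocks by auto
  qed
  show ?thesis unfolding partial_perm_diagram_def one d ..
qed

text \<open>The block form of \<omega> enters the proof only here: \<mu> inherits the shape of the
  diagram, while its 1s may be elsewhere.\<close>

theorem Gr2_tilde_diagram: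
  assumes "\<mu> \<in> Gr2_tilde"
  shows "is_stair (partial_perm_diagram \<mu>) \<or> is_stair ((partial_perm_diagram \<mu>)\<inverse>)"
proof -
  obtain \<omega> where \<omega>: "\<omega> \<in> Gr2" "rothe_diagram \<mu> = rothe_diagram \<omega>" and pp: "partial_permutation \<mu>"
    using assms by (auto simp: Gr2_tilde_def)
  have "partial_permutation \<omega>" using \<omega> by (simp add: Gr2_def)
  then have eq: "partial_perm_diagram \<mu> = partial_perm_diagram \<omega>"
    using \<omega>(2) pp by (simp add: rothe_diagram_eq)
  have row: "is_stair (partial_perm_diagram (diag_block_mat [1\<^sub>m r1, 0\<^sub>m 0 c, 1\<^sub>m r2, 0\<^sub>m a b]))" for r1 c r2 a b
    unfolding diagram_row_blocks by (rule is_stair_two_rectangles)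
  consider r a b where "\<omega> = diag_block_mat [1\<^sub>m r, 0\<^sub>m a b]"
    | r1 r2 c a b where "\<omega> = diag_block_mat [1\<^sub>m r1, 0\<^sub>m 0 c, 1\<^sub>m r2, 0\<^sub>m a b]"
    | r1 r2 c a b where "\<omega> = diag_block_mat [1\<^sub>m r1, 0\<^sub>m c 0, 1\<^sub>m r2, 0\<^sub>m a b]"
    using \<omega>(1) unfolding Gr2_def by blast
  then show ?thesis
    unfolding eq
  proof cases
    case 1 then show "is_stair (partial_perm_diagram \<omega>) \<or> is_stair ((partial_perm_diagram \<omega>)\<inverse>)"
      using row by (simp only: diagram_single_block simp_thms)
  next
    case 2 then show "is_stair (partial_perm_diagram \<omega>) \<or> is_stair ((partial_perm_diagram \<omega>)\<inverse>)"
      using row by simp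
  next
    case (3 r1 r2 c a b) then show "is_stair (partial_perm_diagram \<omega>) \<or> is_stair ((partial_perm_diagram \<omega>)\<inverse>)"
      using row[of r1 c r2 b a] by (simp only: diagram_column_blocks converse_converse simp_thms)
  qed
qed

section \<open>Ranks of upper left submatrices\<close>

lemma bij_nth_index: "bij_betw (nth_index :: nat \<Rightarrow> 'i) {..<CARD('i::{finite,linorder})} UNIV"
proof -
  have "(nth_index :: nat \<Rightarrow> 'i) = (!) (sorted_list_of_set UNIV)" by (simp add: nth_index_def fun_eq_iff)
  then show ?thesis using bij_betw_nth[of "sorted_list_of_set (UNIV :: 'i set)"] by simp
qed

definition idx :: "'i::{finite,linorder} \<Rightarrow> nat" where
  "idx = inv_into {..<CARD('i)} nth_index"

lemma idx_less [simp]: "idx (i::'i::{finite,linorder}) < CARD('i)"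
  and nth_index_idx [simp]: "nth_index (idx i) = i"
proof -
  have i: "i \<in> nth_index ` {..<CARD('i)}" using bij_nth_index by (auto simp: bij_betw_def)
  show "idx i < CARD('i)" using inv_into_into[OF i] by (simp add: idx_def)
  show "nth_index (idx i) = i" unfolding idx_def by (rule f_inv_into_f[OF i])
qed

lemma idx_nth_index [simp]: "k < CARD('i) \<Longrightarrow> idx (nth_index k :: 'i::{finite,linorder}) = k"
  unfolding idx_def by (rule inv_into_f_f) (use bij_nth_index in \<open>auto simp: bij_betw_def\<close>)

lemma idx_inject [simp]: "idx i = idx j \<longleftrightarrow> i = j"
  by (metis nth_index_idx)

definition below :: "nat \<Rightarrow> 'i::{finite,linorder} set" where
  "below p = {i. idx i < p}"

text \<open>Entries are zeroed instead of deleted, so that submatrices of all sizes stay in one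
  type. The rank does not notice the difference.\<close>

definition restr :: "'m set \<Rightarrow> 'n set \<Rightarrow> real^'n^'m \<Rightarrow> real^'n^'m" where
  "restr I J A = (\<chi> i j. if i \<in> I \<and> j \<in> J then A $ i $ j else 0)"

lemma restr_nth [simp]: "restr I J A $ i $ j = (if i \<in> I \<and> j \<in> J then A $ i $ j else 0)"
  by (simp add: restr_def)

lemma card_below: "p \<le> CARD('i) \<Longrightarrow> card (below p :: 'i::{finite,linorder} set) = p"
proof -
  assume "p \<le> CARD('i)"
  then have "idx ` (below p :: 'i set) = {..<p}"
  proof (intro subset_antisym subsetI)
    fix k assume "k \<in> {..<p}"
    then show "k \<in> idx ` (below p :: 'i set)"
      using \<open>p \<le> CARD('i)\<close> by (intro image_eqI[of _ _ "nth_index k"]) (auto simp: below_def)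
  qed (auto simp: below_def)
  moreover have "inj_on idx (below p :: 'i set)" by (auto intro: inj_onI)
  ultimately show ?thesis using card_image[of idx "below p :: 'i set"] by simp
qed

section \<open>Agreement of the ranks of variable-size and of zero-padded matrices\<close>

definition pad :: "real Matrix.vec \<Rightarrow> real^'m::{finite,linorder}" where
  "pad v = (\<chi> i. if idx i < dim_vec v then vec_index v (idx i) else 0)"

context
  fixes p :: nat and mt :: "'m::{finite,linorder} itself"
  assumes p: "p \<le> CARD('m)"
begin

interpretation V: vec_space "TYPE(real)" p .

lemma inj_on_pad: "inj_on (pad :: _ \<Rightarrow> real^'m::{finite,linorder}) (carrier_vec p)"
proof (rule inj_onI)
  fix v w assume v: "v \<in> carrier_vec p" "w \<in> carrier_vec p" and eq: "(pad v :: real^'m::{finite,linorder}) = pad w"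
  show "v = w"
  proof (rule eq_vecI)
    show "dim_vec v = dim_vec w" using v by simp
    fix k assume k: "k < dim_vec w"
    have "(pad v :: real^'m::{finite,linorder}) $ nth_index k = (pad w :: real^'m::{finite,linorder}) $ nth_index k"
      using eq by simp
    then show "vec_index v k = vec_index w k" using k v p by (simp add: pad_def)
  qed
qed

lemma pad_lincomb:
  assumes "T \<subseteq> carrier_vec p"
  shows "(pad (V.lincomb a T) :: real^'m::{finite,linorder}) = (\<Sum>x\<in>T. a x *\<^sub>R pad x)"
proof -
  have d: "dim_vec (V.lincomb a T) = p" using V.lincomb_dim[OF _ assms] by (cases "finite T") (auto simp: V.lincomb_def)
  have "dim_vec x = p" if "x \<in> T" for x using assms that by auto
  then show ?thesis
    by (simp add: vec_eq_iff pad_def d V.lincomb_index[OF _ assms])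
qed

lemma lin_dep_iff_dependent:
  assumes T: "finite T" "T \<subseteq> carrier_vec p"
  shows "V.lin_dep T \<longleftrightarrow> dependent (pad ` T :: (real^'m::{finite,linorder}) set)"
proof
  have inj: "inj_on (pad :: _ \<Rightarrow> real^'m::{finite,linorder}) T" using inj_on_pad T(2) inj_on_subset by blast
  have pad0: "(pad (0\<^sub>v p) :: real^'m::{finite,linorder}) = 0" using p by (simp add: pad_def vec_eq_iff)
  {
    assume "V.lin_dep T"
    then obtain a v where a: "V.lincomb a T = 0\<^sub>v p" "v \<in> T" "a v \<noteq> 0"
      using V.finite_lin_dep[OF T(1) _ ] T(2) by auto
    let ?u = "\<lambda>y. a (inv_into T pad (y :: real^'m::{finite,linorder}))"
    have "(\<Sum>y\<in>pad ` T. ?u y *\<^sub>R y) = (\<Sum>x\<in>T. a x *\<^sub>R (pad x :: real^'m::{finite,linorder}))"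
      by (simp add: sum.reindex[OF inj] inv_into_f_f[OF inj])
    then have "(\<Sum>y\<in>pad ` T. ?u y *\<^sub>R y) = 0"
      using pad_lincomb[OF T(2), of a] a(1) pad0 by simp
    moreover have "?u (pad v) \<noteq> 0" using a by (simp add: inv_into_f_f[OF inj])
    ultimately show "dependent (pad ` T :: (real^'m::{finite,linorder}) set)"
      using a(2) unfolding dependent_finite[OF finite_imageI[OF T(1)]]
      by (intro exI[of _ ?u] conjI bexI[of _ "pad v"]) auto
  next
    assume "dependent (pad ` T :: (real^'m::{finite,linorder}) set)"
    then obtain u v where u: "v \<in> T" "u (pad v :: real^'m::{finite,linorder}) \<noteq> 0" "(\<Sum>y\<in>pad ` T. u y *\<^sub>R y) = 0"
      using T(1) unfolding dependent_finite[OF finite_imageI[OF T(1)]] by auto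
    have "(pad (V.lincomb (u \<circ> pad) T) :: real^'m::{finite,linorder}) = pad (0\<^sub>v p)"
      using u(3) pad0 by (simp add: pad_lincomb[OF T(2)] sum.reindex[OF inj])
    moreover have "V.lincomb (u \<circ> pad) T \<in> carrier_vec p"
      using V.lincomb_dim[OF T] by (metis carrier_vec_dim_vec)
    ultimately have "V.lincomb (u \<circ> pad) T = 0\<^sub>v p"
      using inj_on_pad by (auto dest: inj_onD)
    then show "V.lin_dep T"
      using u by (intro V.lin_dep_crit[where A = T and a = "u \<circ> pad" and v = v]) (auto simp: T(1))
  }
qed

text \<open>\<open>vec_space.rank\<close> is the size of a maximal independent set \<open>S\<close>
  of columns. As \<open>pad\<close> is injective and preserves dependence both ways, the padded
  \<open>S\<close> is a basis of the span of all padded columns.\<close>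

lemma rank_eq_dim_pad:
  assumes B: "B \<in> carrier_mat p q"
  shows "vec_space.rank p B = dim (pad ` set (cols B) :: (real^'m::{finite,linorder}) set)"
proof -
  let ?C = "set (cols B)"
  have C: "finite ?C" "?C \<subseteq> carrier_vec p" using B cols_dim[of B] by auto
  have ind: "V.lin_indpt T \<longleftrightarrow> independent (pad ` T :: (real^'m::{finite,linorder}) set)" if "T \<subseteq> ?C" for T
    using lin_dep_iff_dependent[of T] that C finite_subset by blast
  obtain S where S: "maximal S (\<lambda>T. T \<subseteq> ?C \<and> V.lin_indpt T)"
    using maximal_exists_superset[of ?C "\<lambda>T. T \<subseteq> ?C \<and> V.lin_indpt T" "{}"] C(1) ind[of "{}"] independent_empty by auto
  then have S1: "S \<subseteq> ?C" "independent (pad ` S :: (real^'m::{finite,linorder}) set)"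
    using ind by (auto simp: maximal_def)
  have "pad c \<in> span (pad ` S :: (real^'m::{finite,linorder}) set)" if c: "c \<in> ?C" for c
  proof (rule ccontr)
    assume n: "pad c \<notin> span (pad ` S :: (real^'m::{finite,linorder}) set)"
    then have "independent (pad ` (insert c S) :: (real^'m::{finite,linorder}) set)"
      using S1(2) by (simp add: independent_insertI)
    then have "insert c S \<subseteq> ?C \<and> V.lin_indpt (insert c S)" using ind[of "insert c S"] c S1 by auto
    then have "c \<in> S" using S unfolding maximal_def by blast
    then have "pad c \<in> span (pad ` S :: (real^'m::{finite,linorder}) set)" by (intro span_base imageI)
    then show False using n by blast
  qed
  then have "pad ` ?C \<subseteq> span (pad ` S :: (real^'m::{finite,linorder}) set)" by blast
  moreover have "(pad ` S :: (real^'m::{finite,linorder}) set) \<subseteq> pad ` ?C" using S1 by blast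
  ultimately have "dim (pad ` ?C :: (real^'m::{finite,linorder}) set) = card (pad ` S :: (real^'m::{finite,linorder}) set)"
    using S1(2) by (metis basis_card_eq_dim)
  also have "\<dots> = card S"
    using inj_on_pad S1(1) C(2) by (meson card_image inj_on_subset subset_trans)
  finally show ?thesis using V.rank_card_indpt[OF B S] by simp
qed

end

text \<open>The columns of the restricted matrix are the padded columns of the corner and possibly
  0, so both have the same span.\<close>

lemma corner_rank_eq_rank_restr:
  fixes A :: "real^'n::{finite,linorder}^'m::{finite,linorder}"
  assumes p: "p \<le> CARD('m)" and q: "q \<le> CARD('n)"
  shows "corner_rank p q A = rank (restr (below p) (below q) A)"
proof -
  define B where "B = submatrix (to_mat A) {..<p} {..<q}"
  have d: "dim_row (to_mat A) = CARD('m)" "dim_col (to_mat A) = CARD('n)"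
    by (simp_all add: to_mat_def)
  have rows: "{i. i < CARD('m) \<and> i \<in> {..<p}} = {..<p}" and cols: "{j. j < CARD('n) \<and> j \<in> {..<q}} = {..<q}"
    using p q by auto
  have pick: "pick {..<k} i = i" if "i < k" for i k
  proof -
    have "{a \<in> {..<k}. a < i} = {..<i}" using that by auto
    then show ?thesis using pick_card_in_set[of i "{..<k}"] that by simp
  qed
  have B: "B \<in> carrier_mat p q"
    unfolding B_def by (rule carrier_matI) (simp_all only: dim_submatrix d rows cols card_lessThan)
  have Bij: "B $$ (i, j) = A $ nth_index i $ nth_index j" if "i < p" "j < q" for i j
  proof -
    have "B $$ (i, j) = to_mat A $$ (pick {..<p} i, pick {..<q} j)"
      unfolding B_def by (rule submatrix_index) (simp_all only: d rows cols card_lessThan that)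
    then show ?thesis using that p q by (simp add: pick to_mat_def)
  qed
  let ?M = "restr (below p) (below q) A"
  have col: "column j ?M = (if idx j < q then pad (col B (idx j)) else 0)" for j
    using B Bij p by (auto simp: vec_eq_iff column_def pad_def below_def)
  have C: "set (cols B) = (\<lambda>k. col B k) ` {..<q}"
    using B by (auto simp: cols_def)
  have "pad ` set (cols B) \<subseteq> columns ?M"
  proof (clarsimp simp: C)
    fix k assume "k < q"
    then have "column (nth_index k) ?M = pad (col B k)" using q by (simp add: col)
    then show "pad (col B k) \<in> columns ?M" unfolding columns_def by (intro CollectI exI[of _ "nth_index k"]) simp
  qed
  moreover have "columns ?M \<subseteq> insert 0 (pad ` set (cols B))"
    by (auto simp: columns_def col C)
  ultimately have "span (columns ?M) = span (pad ` set (cols B))"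
    by (metis span_insert_0 span_mono subset_antisym)
  then have "dim (columns ?M) = dim (pad ` set (cols B) :: (real^'m::{finite,linorder}) set)"
    by (metis dim_span)
  then show ?thesis
    using rank_eq_dim_pad[OF p B] by (simp add: corner_rank_def column_rank_def B_def)
qed



section \<open>Row spaces of restricted matrices\<close>

lemma restr_restr: "restr I J (restr I' J' A) = restr (I \<inter> I') (J \<inter> J') A"
  by (simp add: vec_eq_iff)

lemma transpose_restr: "transpose (restr I J A) = restr J I (transpose A)"
  by (auto simp: vec_eq_iff transpose_def)

text \<open>Restriction is multiplication from both sides by diagonal 0-1 matrices.\<close>

lemma rank_restr_le:
  fixes A :: "real^'n^'m"
  shows "rank (restr I J A) \<le> rank A"
proof -
  define L :: "real^'m^'m" where "L = (\<chi> i k. if i = k then (if i \<in> I then 1 else 0) else 0)"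
  define R :: "real^'n^'n" where "R = (\<chi> j k. if j = k then (if k \<in> J then 1 else 0) else 0)"
  have "(\<Sum>k\<in>UNIV. (if i = k then if i \<in> I then 1 else 0 else 0) * f k) = (if i \<in> I then f i else 0)"
    for i :: 'm and f :: "'m \<Rightarrow> real"
  proof -
    have "(\<Sum>k\<in>UNIV. (if i = k then if i \<in> I then 1 else 0 else 0) * f k) = (\<Sum>k\<in>UNIV. if i = k then (if i \<in> I then f k else 0) else 0)"
      by (rule sum.cong) auto
    then show ?thesis by simp
  qed
  moreover have "(\<Sum>k\<in>UNIV. f k * (if k = j then if j \<in> J then 1 else 0 else 0)) = (if j \<in> J then f j else 0)"
    for j :: 'n and f :: "'n \<Rightarrow> real"
  proof -
    have "(\<Sum>k\<in>UNIV. f k * (if k = j then if j \<in> J then 1 else 0 else 0)) = (\<Sum>k\<in>UNIV. if k = j then (if j \<in> J then f k else 0) else 0)"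
      by (rule sum.cong) auto
    then show ?thesis by simp
  qed
  ultimately have "restr I J A = L ** (A ** R)"
    by (simp add: vec_eq_iff matrix_matrix_mult_def L_def R_def)
  then show ?thesis
    by (metis order_trans rank_mul_le_left rank_mul_le_right)
qed

lemma rank_restr_mono:
  "I \<subseteq> I' \<Longrightarrow> J \<subseteq> J' \<Longrightarrow> rank (restr I J A) \<le> rank (restr I' J' (A :: real^'n^'m))"
  using rank_restr_le[of I J "restr I' J' A"] by (simp add: restr_restr Int_absorb2)

definition rowr :: "'n set \<Rightarrow> real^'n^'m \<Rightarrow> 'm \<Rightarrow> real^'n" where
  "rowr J A i = (\<chi> j. if j \<in> J then A $ i $ j else 0)"

lemma rowr_nth [simp]: "rowr J A i $ j = (if j \<in> J then A $ i $ j else 0)"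
  by (simp add: rowr_def)

lemma span_rows_restr: "span (rows (restr I J A)) = span (rowr J A ` I)"
proof -
  have r: "row i (restr I J A) = (if i \<in> I then rowr J A i else 0)" for i
    by (simp add: vec_eq_iff row_def)
  have "rows (restr I J A) \<subseteq> insert 0 (rowr J A ` I)"
    by (auto simp: rows_def r)
  moreover have "rowr J A ` I \<subseteq> rows (restr I J A)"
  proof
    fix x assume "x \<in> rowr J A ` I"
    then obtain i where "i \<in> I" "x = row i (restr I J A)" using r by auto
    then show "x \<in> rows (restr I J A)" unfolding rows_def by blast
  qed
  ultimately show ?thesis by (metis span_insert_0 span_mono subset_antisym)
qed

lemma rank_restr_eq_dim_rows: "rank (restr I J A) = dim (rowr J A ` I)"
  for A :: "real^'n^'m"
  using span_rows_restr[of I J A] by (metis row_rank_def dim_span)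

lemma rank_restr_insert_row: "rank (restr (insert i I) J A) \<le> rank (restr I J A) + 1"
  for A :: "real^'n^'m"
  by (simp add: rank_restr_eq_dim_rows dim_insert)

lemma rank_restr_insert_col: "rank (restr I (insert j J) A) \<le> rank (restr I J A) + 1"
  for A :: "real^'n^'m"
  using rank_restr_insert_row[of j J I "transpose A"] by (metis transpose_restr rank_transpose)

lemma rowr_in_span:
  fixes A :: "real^'n^'m"
  assumes "rank (restr (insert i I) J A) \<le> rank (restr I J A)"
  shows "rowr J A i \<in> span (rowr J A ` I)"
  using assms by (simp add: rank_restr_eq_dim_rows dim_insert split: if_splits)

lemma below_Suc: "below (Suc (idx p)) = insert p (below (idx p))"
  by (auto simp: below_def less_Suc_eq)

lemma below_0 [simp]: "below 0 = {}" by (simp add: below_def)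

text \<open>A row at which the rank does not grow depends on the rows above it. By strong induction
  these lie in the span of the rows in \<open>I\<close>, where all jumps of the rank occur.\<close>

lemma rowr_in_span_chain:
  fixes A :: "real^'n^'m::{finite,linorder}"
  assumes "\<And>p. idx p < P \<Longrightarrow> p \<notin> I \<Longrightarrow> rank (restr (below (Suc (idx p))) J A) \<le> rank (restr (below (idx p)) J A)"
  shows "idx p < P \<Longrightarrow> rowr J A p \<in> span (rowr J A ` I)"
proof (induction "idx p" arbitrary: p rule: less_induct)
  case less
  show ?case
  proof (cases "p \<in> I")
    case True then show ?thesis by (simp add: span_base)
  next
    case False
    have "rowr J A p \<in> span (rowr J A ` below (idx p))"
      using assms[OF less.prems False] by (intro rowr_in_span) (simp add: below_Suc)
    moreover have "rowr J A ` below (idx p) \<subseteq> span (rowr J A ` I)"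
      using less by (auto simp: below_def)
    ultimately show ?thesis by (metis span_mono span_span subsetD)
  qed
qed

text \<open>Stated for families, where repeated vectors matter: if the dimension reaches the number
  of indices, \<open>f\<close> is injective and its image independent.\<close>

lemma independent_family_of_dim:
  fixes f :: "'i \<Rightarrow> 'a::euclidean_space"
  assumes "finite I" "card I \<le> dim (f ` I)" "(\<Sum>i\<in>I. c i *\<^sub>R f i) = 0" "i \<in> I"
  shows "c i = 0"
proof -
  have le: "dim (f ` I) \<le> card (f ` I)" using assms(1) by (intro dim_le_card') auto
  moreover have "card (f ` I) \<le> card I" using assms(1) by (rule card_image_le)
  ultimately have eq: "card (f ` I) = card I" "dim (f ` I) = card (f ` I)" using assms(2) by auto
  then have inj: "inj_on f I" using assms(1) by (simp add: eq_card_imp_inj_on)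
  have ind: "independent (f ` I)" using eq(2) assms(1) 
    by (intro card_le_dim_spanning[of "f ` I" "f ` I"]) (auto simp: span_superset)
  have "(\<Sum>y\<in>f ` I. c (inv_into I f y) *\<^sub>R y) = 0"
    using assms(3) by (simp add: sum.reindex[OF inj] inv_into_f_f[OF inj])
  moreover have "c (inv_into I f (f i)) = 0"
  proof -
    have "dependent (f ` I)" if "c (inv_into I f (f i)) \<noteq> 0"
      unfolding dependent_finite[OF finite_imageI[OF assms(1)]]
      using \<open>(\<Sum>y\<in>f ` I. c (inv_into I f y) *\<^sub>R y) = 0\<close> that assms(4)
      by (intro exI[of _ "\<lambda>y. c (inv_into I f y)"] conjI bexI[of _ "f i"]) auto
    then show ?thesis using ind by blast
  qed
  ultimately show ?thesis by (simp add: inv_into_f_f[OF inj assms(4)])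
qed

lemma dim_of_independent_family:
  fixes f :: "'i \<Rightarrow> 'a::euclidean_space"
  assumes "finite I" and ind: "\<And>c. (\<Sum>i\<in>I. c i *\<^sub>R f i) = 0 \<Longrightarrow> \<forall>i\<in>I. c i = 0"
  shows "inj_on f I" "independent (f ` I)" "dim (f ` I) = card I"
proof -
  show inj: "inj_on f I"
  proof (rule inj_onI, rule ccontr)
    fix x y assume xy: "x \<in> I" "y \<in> I" "f x = f y" "x \<noteq> y"
    \<comment> \<open>A repeated vector would give the nontrivial relation
      \<open>f x - f y = 0\<close>.\<close>
    let ?c = "\<lambda>i. if i = x then 1 else if i = y then - 1 else (0::real)"
    have "(\<Sum>i\<in>I. ?c i *\<^sub>R f i) = (\<Sum>i\<in>{x, y}. ?c i *\<^sub>R f i)"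
      using xy assms(1) by (intro sum.mono_neutral_right) auto
    also have "\<dots> = 0" using xy by simp
    finally show False using ind[of ?c] xy by auto
  qed
  show indep: "independent (f ` I)"
  proof
    assume "dependent (f ` I)"
    then obtain u v where u: "v \<in> I" "u (f v) \<noteq> 0" "(\<Sum>y\<in>f ` I. u y *\<^sub>R y) = 0"
      using assms(1) unfolding dependent_finite[OF finite_imageI[OF assms(1)]] by auto
    then have "(\<Sum>i\<in>I. u (f i) *\<^sub>R f i) = 0" by (simp add: sum.reindex[OF inj])
    from ind[OF this] u show False by auto
  qed
  show "dim (f ` I) = card I" using dim_eq_card_independent[OF indep] card_image[OF inj] by simp
qed

section \<open>Determinantal equations for \<open>X\<^sub>\<omega>\<close>\<close>

text \<open>
  \<open>w k\<close> is meaningful only for rows \<open>k\<close> that contain a 1. The matrix \<open>minor P Q A\<close> has, up to sign, the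
  determinant of the submatrix of \<open>A\<close> in the rows and columns of the 1s in the upper left \<open>P \<times> Q\<close> corner:
  it is padded by an identity block, so that all sizes live in one type.
\<close>

locale partial_perm =
  fixes \<mu> :: "real^'n::{finite,linorder}^'m::{finite,linorder}"
  assumes row_unique: "\<mu> $ i $ j = 1 \<Longrightarrow> \<mu> $ i $ j' = 1 \<Longrightarrow> j = j'"
    and col_unique: "\<mu> $ i $ j = 1 \<Longrightarrow> \<mu> $ i' $ j = 1 \<Longrightarrow> i = i'"
    and zero_or_one: "\<mu> $ i $ j = 0 \<or> \<mu> $ i $ j = 1"
begin

text \<open>The size of this set will turn out to be the rank of the upper left
  \<open>P \<times> Q\<close> corner of \<mu>.\<close>

definition ones :: "nat \<Rightarrow> nat \<Rightarrow> 'm set" where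
  "ones P Q = {i \<in> below P. \<exists>j\<in>below Q. \<mu> $ i $ j = 1}"

definition w :: "'m \<Rightarrow> 'n" where
  "w k = (THE j. \<mu> $ k $ j = 1)"

definition D :: "('m \<times> 'n) set" where
  "D = {(p, q). (\<forall>j. idx j \<le> idx q \<longrightarrow> \<mu> $ p $ j \<noteq> 1) \<and> (\<forall>i. idx i \<le> idx p \<longrightarrow> \<mu> $ i $ q \<noteq> 1)}"

abbreviation rk :: "real^'n::{finite,linorder}^'m::{finite,linorder} \<Rightarrow> nat \<Rightarrow> nat \<Rightarrow> nat" where
  "rk A P Q \<equiv> rank (restr (below P) (below Q) A)"

definition minor :: "nat \<Rightarrow> nat \<Rightarrow> real^'n::{finite,linorder}^'m::{finite,linorder} \<Rightarrow> real^'m::{finite,linorder}^'m::{finite,linorder}" where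
  "minor P Q A = (\<chi> i k. if i \<in> ones P Q \<and> k \<in> ones P Q then A $ i $ w k else if i = k then 1 else 0)"

lemma w_eq: "\<mu> $ i $ j = 1 \<Longrightarrow> w i = j"
  unfolding w_def using row_unique by blast

lemma onesD: "k \<in> ones P Q \<Longrightarrow> k \<in> below P \<and> w k \<in> below Q \<and> \<mu> $ k $ w k = 1"
  unfolding ones_def using w_eq by blast

lemma inj_on_w: "inj_on w (ones P Q)"
  using onesD col_unique by (metis inj_onI)

lemma sum_minor_row:
  assumes "i \<in> ones P Q"
  shows "(\<Sum>k\<in>UNIV. minor P Q A $ i $ k * x $ k) = (\<Sum>k\<in>ones P Q. A $ i $ w k * x $ k)"
proof -
  have "(\<Sum>k\<in>UNIV. minor P Q A $ i $ k * x $ k) = (\<Sum>k\<in>ones P Q. minor P Q A $ i $ k * x $ k)"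
    using assms by (intro sum.mono_neutral_right) (auto simp: minor_def)
  then show ?thesis using assms by (simp add: minor_def)
qed

lemma sum_minor_other:
  assumes "i \<notin> ones P Q"
  shows "(\<Sum>k\<in>UNIV. minor P Q A $ i $ k * x $ k) = x $ i"
proof -
  have "(\<Sum>k\<in>UNIV. minor P Q A $ i $ k * x $ k) = (\<Sum>k\<in>UNIV. if i = k then x $ k else 0)"
    using assms by (intro sum.cong) (auto simp: minor_def)
  then show ?thesis by simp
qed

text \<open>The padding identity block forces every kernel vector to vanish outside
  \<open>ones P Q\<close>, so the kernel is that of the unpadded submatrix.\<close>

lemma det_minor_nonzero_iff:
  "det (minor P Q A) \<noteq> 0 \<longleftrightarrow>
     (\<forall>x. (\<forall>i\<in>ones P Q. (\<Sum>k\<in>ones P Q. A $ i $ w k * x k) = 0) \<longrightarrow> (\<forall>k\<in>ones P Q. x k = 0))"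
proof -
  have "det (minor P Q A) \<noteq> 0 \<longleftrightarrow> (\<forall>x. minor P Q A *v x = 0 \<longrightarrow> x = 0)"
    using invertible_det_nz[of "minor P Q A"] matrix_left_invertible_ker[of "minor P Q A"]
    by (metis invertible_left_inverse)
  also have "\<dots> \<longleftrightarrow> (\<forall>x. (\<forall>i\<in>ones P Q. (\<Sum>k\<in>ones P Q. A $ i $ w k * x k) = 0) \<longrightarrow> (\<forall>k\<in>ones P Q. x k = 0))"
  proof (intro iffI allI impI)
    fix x assume *: "\<forall>x. minor P Q A *v x = 0 \<longrightarrow> x = 0" "\<forall>i\<in>ones P Q. (\<Sum>k\<in>ones P Q. A $ i $ w k * x k) = 0"
    define y where "y = (\<chi> k. if k \<in> ones P Q then x k else 0)"
    have "(minor P Q A *v y) $ i = 0" for i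
    proof (cases "i \<in> ones P Q")
      case True
      then have "(minor P Q A *v y) $ i = (\<Sum>k\<in>ones P Q. A $ i $ w k * y $ k)"
        by (simp add: matrix_vector_mult_def sum_minor_row)
      also have "\<dots> = (\<Sum>k\<in>ones P Q. A $ i $ w k * x k)" by (rule sum.cong) (auto simp: y_def)
      finally show ?thesis using *(2) True by simp
    next
      case False
      then have "(minor P Q A *v y) $ i = y $ i" by (simp add: matrix_vector_mult_def sum_minor_other)
      then show ?thesis using False by (simp add: y_def)
    qed
    then have "y = 0" using *(1) by (simp add: vec_eq_iff)
    then have "y $ k = 0" for k by simp
    then show "\<forall>k\<in>ones P Q. x k = 0" unfolding y_def vec_lambda_beta by metis
  next
    fix x :: "real^'m::{finite,linorder}"
    assume *: "\<forall>x. (\<forall>i\<in>ones P Q. (\<Sum>k\<in>ones P Q. A $ i $ w k * x k) = 0) \<longrightarrow> (\<forall>k\<in>ones P Q. x k = 0)"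
      "minor P Q A *v x = 0"
    have M: "(\<Sum>k\<in>UNIV. minor P Q A $ i $ k * x $ k) = 0" for i
      using *(2) by (simp add: vec_eq_iff matrix_vector_mult_def)
    have "(\<Sum>k\<in>ones P Q. A $ i $ w k * x $ k) = 0" if "i \<in> ones P Q" for i
      using M[of i] sum_minor_row[OF that, of A x] by simp
    then have "\<forall>k\<in>ones P Q. x $ k = 0"
      using spec[OF *(1), of "\<lambda>k. x $ k"] by blast
    moreover have "x $ k = 0" if "k \<notin> ones P Q" for k using M[of k] that by (simp add: sum_minor_other)
    ultimately show "x = 0" unfolding vec_eq_iff zero_index by blast
  qed
  finally show ?thesis .
qed

lemma det_minor_nonzero_left:
  assumes "det (minor P Q A) \<noteq> 0" "\<forall>k\<in>ones P Q. (\<Sum>i\<in>ones P Q. c i * A $ i $ w k) = 0"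
  shows "\<forall>i\<in>ones P Q. c i = 0"
proof -
  define y where "y = (\<chi> k. if k \<in> ones P Q then c k else 0)"
  have "det (transpose (minor P Q A)) \<noteq> 0" using assms(1) by (simp add: det_transpose)
  then have ker: "transpose (minor P Q A) *v y = 0 \<Longrightarrow> y = 0"
    using invertible_det_nz[of "transpose (minor P Q A)"] matrix_left_invertible_ker[of "transpose (minor P Q A)"]
    by (metis invertible_left_inverse)
  have "(\<Sum>i\<in>UNIV. minor P Q A $ i $ k * y $ i) = 0" for k
  proof -
    have "(\<Sum>i\<in>UNIV. minor P Q A $ i $ k * y $ i) = (\<Sum>i\<in>ones P Q. minor P Q A $ i $ k * c i)"
      unfolding y_def by (rule sum.mono_neutral_cong_right) auto
    also have "\<dots> = 0"
    proof (cases "k \<in> ones P Q")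
      case True
      then show ?thesis using assms(2) by (simp add: minor_def mult.commute)
    qed (auto intro!: sum.neutral simp: minor_def)
    finally show ?thesis .
  qed
  then have "y = 0" by (intro ker) (simp add: vec_eq_iff matrix_vector_mult_def transpose_def)
  then have "y $ k = 0" for k by simp
  then show ?thesis unfolding y_def vec_lambda_beta by metis
qed

text \<open>A relation between these rows restricts, in the columns \<open>w k\<close>, to a
  relation between the rows of the nonsingular minor.\<close>

lemma rows_independent:
  assumes "det (minor P Q A) \<noteq> 0" "Q \<le> Q'"
  shows "dim (rowr (below Q') A ` ones P Q) = card (ones P Q)"
proof (rule dim_of_independent_family(3))
  fix c assume "(\<Sum>i\<in>ones P Q. c i *\<^sub>R rowr (below Q') A i) = 0"
  then have *: "(\<Sum>i\<in>ones P Q. c i *\<^sub>R rowr (below Q') A i) $ j = 0" for j by simp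
  have h: "(\<Sum>i\<in>ones P Q. c i * A $ i $ w k) = 0" if "k \<in> ones P Q" for k
    using *[of "w k"] onesD[OF that] assms(2) by (simp add: sum_component below_def)
  show "\<forall>i\<in>ones P Q. c i = 0"
    by (rule det_minor_nonzero_left[OF assms(1)], rule ballI, rule h)
qed simp

text \<open>The lower half of the rank equations, obtained from a condition that is open in
  \<open>A\<close>.\<close>

lemma card_ones_le_rk:
  assumes "det (minor P Q A) \<noteq> 0"
  shows "card (ones P Q) \<le> rk A P Q"
proof -
  have "card (ones P Q) = dim (rowr (below Q) A ` ones P Q)" using rows_independent[OF assms order_refl] by simp
  also have "\<dots> \<le> dim (rowr (below Q) A ` below P)"
    by (intro dim_subset image_mono) (auto simp: ones_def)
  finally show ?thesis by (simp add: rank_restr_eq_dim_rows)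
qed

text \<open>The rows in \<open>ones P Q\<close> are independent and already as many as the rank
  bound allows, so they span the row space.\<close>

lemma rows_span:
  assumes "det (minor P Q A) \<noteq> 0" "Q \<le> Q'" "ones P Q \<subseteq> I" "rank (restr I (below Q') A) \<le> card (ones P Q)" "i \<in> I"
  shows "rowr (below Q') A i \<in> span (rowr (below Q') A ` ones P Q)"
proof -
  let ?f = "rowr (below Q') A"
  have "dim (?f ` I) \<le> dim (?f ` ones P Q)"
    using assms(4) rows_independent[OF assms(1,2)] by (simp add: rank_restr_eq_dim_rows)
  moreover have "span (?f ` ones P Q) \<subseteq> span (?f ` I)" using assms(3) by (intro span_mono) auto
  ultimately have "span (?f ` ones P Q) = span (?f ` I)"
    by (metis dim_span subspace_dim_equal subspace_span)
  then show ?thesis using assms(5) by (simp add: span_base)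
qed

lemma ones_Suc_row:
  "ones (Suc (idx p)) Q = (if \<exists>j\<in>below Q. \<mu> $ p $ j = 1 then insert p (ones (idx p) Q) else ones (idx p) Q)"
  by (auto simp: ones_def below_Suc)

lemma not_in_ones: "p \<notin> ones (idx p) Q"
  by (simp add: ones_def below_def)

text \<open>At a cell of \<open>D\<close> the corner gains no 1 with its last row or its last
  column. So the prescribed rank stays the same there, and this is what makes the entry dependent on
  the others.\<close>

lemma ones_D:
  assumes "(p, q) \<in> D"
  shows "ones (Suc (idx p)) (Suc (idx q)) = ones (idx p) (idx q)"
    "ones (Suc (idx p)) (idx q) = ones (idx p) (idx q)" "ones (idx p) (Suc (idx q)) = ones (idx p) (idx q)"
proof -
  have "\<forall>j\<in>insert q (below (idx q)). \<mu> $ p $ j \<noteq> 1" "\<forall>i\<in>insert p (below (idx p)). \<mu> $ i $ q \<noteq> 1"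
    using assms by (auto simp: D_def below_def)
  then show "ones (Suc (idx p)) (Suc (idx q)) = ones (idx p) (idx q)"
    "ones (Suc (idx p)) (idx q) = ones (idx p) (idx q)" "ones (idx p) (Suc (idx q)) = ones (idx p) (idx q)"
    by (auto simp: ones_def below_Suc)
qed

text \<open>The value that \<open>A $ p $ q\<close> must have for the bordered minor to vanish, written by Cramer's rule.\<close>

definition \<phi> :: "'m \<Rightarrow> 'n \<Rightarrow> real^'n::{finite,linorder}^'m::{finite,linorder} \<Rightarrow> real" where
  "\<phi> p q A = (\<Sum>k\<in>ones (idx p) (idx q). A $ p $ w k *
     (det (\<chi> i j. if j = k then (if i \<in> ones (idx p) (idx q) then A $ i $ q else 0) else minor (idx p) (idx q) A $ i $ j)
       / det (minor (idx p) (idx q) A)))"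

text \<open>Let \<open>y\<close> solve the system with matrix \<open>minor\<close> and right-hand
  side column \<open>q\<close>. If row \<open>p\<close> is the combination \<open>c\<close> of the
  rows of the 1s in the columns \<open>w k\<close>, pairing row \<open>p\<close> with
  \<open>y\<close> gives the same combination of the entries in column \<open>q\<close>.\<close>

lemma \<phi>_eq:
  assumes "det (minor (idx p) (idx q) A) \<noteq> 0"
    and c: "\<And>k. k \<in> ones (idx p) (idx q) \<Longrightarrow> A $ p $ w k = (\<Sum>i\<in>ones (idx p) (idx q). c i * A $ i $ w k)"
  shows "\<phi> p q A = (\<Sum>i\<in>ones (idx p) (idx q). c i * A $ i $ q)"
proof -
  let ?I = "ones (idx p) (idx q)" and ?M = "minor (idx p) (idx q) A"
  define b :: "real^'m::{finite,linorder}" where "b = (\<chi> i. if i \<in> ?I then A $ i $ q else 0)"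
  define y where "y = (\<chi> k. det (\<chi> i j. if j = k then b $ i else ?M $ i $ j) / det ?M)"
  have "?M *v y = b" using cramer[OF assms(1), of y b] unfolding y_def by blast
  then have "(\<Sum>k\<in>UNIV. ?M $ i $ k * y $ k) = b $ i" for i
    unfolding matrix_vector_mult_def by (metis (no_types, lifting) vec_lambda_beta)
  then have y: "(\<Sum>k\<in>?I. A $ i $ w k * y $ k) = A $ i $ q" if "i \<in> ?I" for i
    using sum_minor_row[OF that, of A y] that by (simp add: b_def)
  have "\<phi> p q A = (\<Sum>k\<in>?I. A $ p $ w k * y $ k)"
    unfolding \<phi>_def y_def b_def by (simp cong: if_cong)
  also have "\<dots> = (\<Sum>k\<in>?I. (\<Sum>i\<in>?I. c i * A $ i $ w k) * y $ k)"
    by (rule sum.cong) (simp_all add: c)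
  also have "\<dots> = (\<Sum>i\<in>?I. c i * (\<Sum>k\<in>?I. A $ i $ w k * y $ k))"
    by (simp add: sum_distrib_left sum_distrib_right mult.assoc) (rule sum.swap)
  finally show ?thesis using y by simp
qed

text \<open>The rank bound makes row \<open>p\<close>, up to column \<open>q\<close> inclusive, a
  combination of the rows of the 1s. By \<open>\<phi>_eq\<close> the entry in column
  \<open>q\<close> is then the Cramer value.\<close>

lemma entry_eq_\<phi>:
  assumes D: "(p, q) \<in> D" and det: "det (minor (idx p) (idx q) A) \<noteq> 0"
    and rk: "rk A (Suc (idx p)) (Suc (idx q)) \<le> card (ones (idx p) (idx q))"
  shows "A $ p $ q = \<phi> p q A"
proof -
  let ?I = "ones (idx p) (idx q)" and ?f = "rowr (below (Suc (idx q))) A"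
  have "?f p \<in> span (?f ` ?I)"
    by (rule rows_span[OF det _ _ rk]) (auto simp: ones_def below_def)
  \<comment> \<open>Injectivity, by comparing dimensions, allows coefficients indexed by rows
    instead of by row vectors.\<close>
  moreover have "inj_on ?f ?I"
    using rows_independent[OF det, of "Suc (idx q)"] dim_le_card'[of "?f ` ?I"] card_image_le[of ?I ?f]
    by (intro eq_card_imp_inj_on) auto
  ultimately obtain c where c: "?f p = (\<Sum>i\<in>?I. c i *\<^sub>R ?f i)"
    by (auto simp: span_finite sum.reindex o_def)
  then have row: "A $ p $ j = (\<Sum>i\<in>?I. c i * A $ i $ j)" if "j \<in> below (Suc (idx q))" for j
  proof -
    have "?f p $ j = (\<Sum>i\<in>?I. c i *\<^sub>R ?f i) $ j" using c by simp
    then show ?thesis using that by (simp add: sum_component)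
  qed
  have "w k \<in> below (Suc (idx q))" if "k \<in> ?I" for k
    using onesD[OF that] by (auto simp: below_def)
  then have "\<phi> p q A = (\<Sum>i\<in>?I. c i * A $ i $ q)"
    by (intro \<phi>_eq det row)
  then show ?thesis using row[of q] by (simp add: below_def)
qed

text \<open>Converse direction: the bound left of column \<open>q\<close> gives coefficients for row
  \<open>p\<close>, and the equation for the entry says that they remain correct in column
  \<open>q\<close>. So row \<open>p\<close> adds nothing to the rows above it.\<close>

lemma rk_eq_of_entry_eq_\<phi>:
  assumes D: "(p, q) \<in> D" and det: "det (minor (idx p) (idx q) A) \<noteq> 0"
    and rk: "rk A (Suc (idx p)) (idx q) \<le> card (ones (idx p) (idx q))"
    and eq: "A $ p $ q = \<phi> p q A"
  shows "rk A (Suc (idx p)) (Suc (idx q)) = rk A (idx p) (Suc (idx q))"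
proof -
  let ?I = "ones (idx p) (idx q)" and ?f = "rowr (below (idx q)) A" and ?g = "rowr (below (Suc (idx q))) A"
  have "?f p \<in> span (?f ` ?I)"
    by (rule rows_span[OF det _ _ rk]) (auto simp: ones_def below_def)
  moreover have "inj_on ?f ?I"
    using rows_independent[OF det, of "idx q"] dim_le_card'[of "?f ` ?I"] card_image_le[of ?I ?f]
    by (intro eq_card_imp_inj_on) auto
  ultimately obtain c where c: "?f p = (\<Sum>i\<in>?I. c i *\<^sub>R ?f i)"
    by (auto simp: span_finite sum.reindex o_def)
  then have row: "A $ p $ j = (\<Sum>i\<in>?I. c i * A $ i $ j)" if "j \<in> below (idx q)" for j
  proof -
    have "?f p $ j = (\<Sum>i\<in>?I. c i *\<^sub>R ?f i) $ j" using c by simp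
    then show ?thesis using that by (simp add: sum_component)
  qed
  have "A $ p $ q = (\<Sum>i\<in>?I. c i * A $ i $ q)"
    unfolding eq using onesD by (intro \<phi>_eq det row) blast
  then have "?g p = (\<Sum>i\<in>?I. c i *\<^sub>R ?g i)"
    using row by (auto simp: vec_eq_iff sum_component below_Suc)
  also have "\<dots> \<in> span (?g ` below (idx p))"
    by (intro span_sum span_scale span_base) (auto simp: ones_def)
  finally show ?thesis
    by (simp add: below_Suc[of p] rank_restr_eq_dim_rows dim_insert)
qed

text \<open>An open neighbourhood of \<open>X\<close> on which all lower rank bounds hold and all
  denominators of \<open>\<phi>\<close> are nonzero.\<close>

definition generic :: "(real^'n::{finite,linorder}^'m::{finite,linorder}) set" where
  "generic = {A. \<forall>P\<le>CARD('m). \<forall>Q\<le>CARD('n). det (minor P Q A) \<noteq> 0}"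

lemma genericD: "A \<in> generic \<Longrightarrow> P \<le> CARD('m) \<Longrightarrow> Q \<le> CARD('n) \<Longrightarrow> det (minor P Q A) \<noteq> 0"
  by (simp add: generic_def)

lemma generic_det: "A \<in> generic \<Longrightarrow> det (minor (idx (p::'m)) (idx (q::'n)) A) \<noteq> 0"
  by (simp add: generic_def less_imp_le)

lemma finite_ones [simp]: "finite (ones P Q)" by simp

text \<open>Induction on the corner with last cell \<open>(p, q)\<close>. In \<open>D\<close>, the
  equation keeps the rank from growing with row \<open>p\<close>. Outside \<open>D\<close> there is
  a 1 in row \<open>p\<close> up to column \<open>q\<close>, or in column \<open>q\<close> up to row
  \<open>p\<close>: that row or column adds one element to \<open>ones\<close> and at most one to
  the rank.\<close>

lemma rk_le_card_ones:
  assumes A: "A \<in> generic" and eq: "\<And>p q. (p, q) \<in> D \<Longrightarrow> A $ p $ q = \<phi> p q A"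
  shows "P \<le> CARD('m) \<Longrightarrow> Q \<le> CARD('n) \<Longrightarrow> rk A P Q \<le> card (ones P Q)"
proof (induction "P + Q" arbitrary: P Q rule: less_induct)
  case less
  show ?case
  proof (cases "P = 0 \<or> Q = 0")
    case True
    then have "restr (below P) (below Q) A = 0" by (auto simp: vec_eq_iff)
    then show ?thesis by simp
  next
    case False
    define p :: 'm and q :: 'n where "p = nth_index (P - 1)" and "q = nth_index (Q - 1)"
    have P: "P = Suc (idx p)" and Q: "Q = Suc (idx q)"
      using False less.prems by (auto simp: p_def q_def)
    have IH1: "rk A (idx p) Q \<le> card (ones (idx p) Q)" and IH2: "rk A P (idx q) \<le> card (ones P (idx q))"
      using less by (auto simp: P Q less_imp_le)
    show ?thesis
    proof (cases "(p, q) \<in> D")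
      case True
      have "rk A P Q = rk A (idx p) Q"
        unfolding P Q using IH2 ones_D[OF True] generic_det[OF A] eq[OF True] True
        by (intro rk_eq_of_entry_eq_\<phi>) (simp_all add: P)
      then show ?thesis using IH1 ones_D[OF True] by (simp add: P Q)
    next
      case False
      then consider j where "j \<in> below Q" "\<mu> $ p $ j = 1" | i where "i \<in> below P" "\<mu> $ i $ q = 1"
        by (auto simp: D_def P Q below_def less_Suc_eq_le)
      then show ?thesis
      proof cases
        case 1
        then have "ones P Q = insert p (ones (idx p) Q)" unfolding P ones_Suc_row by auto
        then have "card (ones P Q) = card (ones (idx p) Q) + 1" using not_in_ones by simp
        moreover have "rk A P Q \<le> rk A (idx p) Q + 1"
          unfolding P below_Suc by (rule rank_restr_insert_row)
        ultimately show ?thesis using IH1 by simp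
      next
        case 2
        have "i \<notin> ones P (idx q)"
          using 2(2) row_unique by (auto simp: ones_def below_def)
        moreover have "ones P Q = insert i (ones P (idx q))"
          using 2 col_unique by (auto simp: ones_def Q below_Suc)
        ultimately have "card (ones P Q) = card (ones P (idx q)) + 1" by simp
        moreover have "rk A P Q \<le> rk A P (idx q) + 1"
          unfolding Q below_Suc by (rule rank_restr_insert_col)
        ultimately show ?thesis using IH2 by simp
      qed
    qed
  qed
qed

definition X :: "(real^'n::{finite,linorder}^'m::{finite,linorder}) set" where
  "X = {A. \<forall>P\<le>CARD('m). \<forall>Q\<le>CARD('n). rk A P Q = card (ones P Q)}"

lemma generic_eq_imp_X:
  assumes "A \<in> generic" "\<And>p q. (p, q) \<in> D \<Longrightarrow> A $ p $ q = \<phi> p q A"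
  shows "A \<in> X"
  using rk_le_card_ones[OF assms] card_ones_le_rk genericD[OF assms(1)]
  by (auto simp: X_def intro: order.antisym)

lemma X_imp_entry_eq:
  assumes "A \<in> X" "A \<in> generic" "(p, q) \<in> D"
  shows "A $ p $ q = \<phi> p q A"
proof (rule entry_eq_\<phi>[OF assms(3) generic_det[OF assms(2)]])
  have "Suc (idx p) \<le> CARD('m)" "Suc (idx q) \<le> CARD('n)" by (simp_all add: Suc_leI)
  then show "rk A (Suc (idx p)) (Suc (idx q)) \<le> card (ones (idx p) (idx q))"
    using assms(1) ones_D[OF assms(3)] by (simp add: X_def)
qed

text \<open>The form in which lines are tested: inside \<open>generic\<close>, upper bounds at the
  cells of \<open>D\<close> imply all rank equations.\<close>

lemma generic_rk_imp_X:
  assumes "A \<in> generic" "\<And>p q. (p, q) \<in> D \<Longrightarrow> rk A (Suc (idx p)) (Suc (idx q)) \<le> card (ones (idx p) (idx q))"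
  shows "A \<in> X"
  using assms by (intro generic_eq_imp_X entry_eq_\<phi> generic_det)

end

section \<open>The slice chart of \<open>X\<close> as a graph over the entries outside
  \<open>D\<close>\<close>

lemma smooth_on_entry: "open S \<Longrightarrow> smooth_on (\<lambda>A :: real^'n^'m. A $ i $ j) S"
  by (rule smooth_on_bounded_linear)
    (auto intro: bounded_linear_compose[OF bounded_linear_vec_nth bounded_linear_vec_nth])

context partial_perm
begin

text \<open>Going down the rows or along the columns of a corner, the rank jumps only at those that
  contain one of its 1s. So the rows in \<open>ones P Q\<close> span all its rows, and the columns
  \<open>w k\<close> span all its columns. A kernel vector of the minor is therefore a relation
  between the full columns \<open>w k\<close>, and these are independent by dimension.\<close>

lemma X_subset_generic: "X \<subseteq> generic"
proof
  fix A assume A: "A \<in> X"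
  have rk: "rk A P Q = card (ones P Q)" if "P \<le> CARD('m)" "Q \<le> CARD('n)" for P Q
    using A that by (simp add: X_def)
  have "det (minor P Q A) \<noteq> 0" if PQ: "P \<le> CARD('m)" "Q \<le> CARD('n)" for P Q
    unfolding det_minor_nonzero_iff
  proof (intro allI impI)
    fix x assume x: "\<forall>i\<in>ones P Q. (\<Sum>k\<in>ones P Q. A $ i $ w k * x k) = 0"
    \<comment> \<open>\<open>l\<close> pairs a row with the kernel vector; it vanishes on the rows
      of the 1s and hence on all rows of the corner.\<close>
    define l where "l v = (\<Sum>k\<in>ones P Q. v $ w k * x k)" for v :: "real^'n::{finite,linorder}"
    have "linear l"
      unfolding l_def by (auto simp: linear_iff sum.distrib algebra_simps sum_distrib_left)
    have l: "l (rowr (below Q) A i) = (\<Sum>k\<in>ones P Q. A $ i $ w k * x k)" for i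
      unfolding l_def by (rule sum.cong) (use onesD in auto)
    have span: "rowr (below Q) A i \<in> span (rowr (below Q) A ` ones P Q)" if "idx i < P" for i
    proof (rule rowr_in_span_chain[OF _ that])
      fix p :: 'm assume p: "idx p < P" "p \<notin> ones P Q"
      then have "ones (Suc (idx p)) Q = ones (idx p) Q"
        unfolding ones_Suc_row by (auto simp: ones_def below_def)
      then show "rk A (Suc (idx p)) Q \<le> rk A (idx p) Q"
        using rk[of "Suc (idx p)" Q] rk[of "idx p" Q] p PQ by simp
    qed
    have "l v = 0" if "v \<in> span (rowr (below Q) A ` ones P Q)" for v
    proof (rule linear_eq_0_on_span[OF \<open>linear l\<close> _ that])
      show "l y = 0" if "y \<in> rowr (below Q) A ` ones P Q" for y using that x l by auto
    qed
    then have z: "(\<Sum>k\<in>ones P Q. A $ i $ w k * x k) = 0" if "idx i < P" for i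
      using span[OF that] l by metis
    let ?g = "rowr (below P) (transpose A)"
    have gspan: "?g j \<in> span (?g ` w ` ones P Q)" if "idx j < Q" for j
    proof (rule rowr_in_span_chain[OF _ that])
      fix q :: 'n assume q: "idx q < Q" "q \<notin> w ` ones P Q"
      have "\<mu> $ i $ q \<noteq> 1" if "i \<in> below P" for i
        using q that w_eq by (force simp: ones_def below_def)
      then have "ones P (Suc (idx q)) = ones P (idx q)"
        by (auto simp: ones_def below_Suc)
      then have "rk A P (Suc (idx q)) \<le> rk A P (idx q)"
        using rk[of P "Suc (idx q)"] rk[of P "idx q"] q PQ by simp
      then show "rank (restr (below (Suc (idx q))) (below P) (transpose A)) \<le> rank (restr (below (idx q)) (below P) (transpose A))"
        by (metis transpose_restr rank_transpose)
    qed
    have "card (ones P Q) = rank (restr (below Q) (below P) (transpose A))"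
      using rk[OF PQ] by (metis transpose_restr rank_transpose)
    also have "\<dots> = dim (?g ` below Q)" by (rule rank_restr_eq_dim_rows)
    also have "\<dots> \<le> dim (span (?g ` w ` ones P Q))"
      by (intro dim_subset) (use gspan in \<open>auto simp: below_def\<close>)
    finally have dim: "card (ones P Q) \<le> dim ((\<lambda>k. ?g (w k)) ` ones P Q)" by (simp add: image_image)
    have "(\<Sum>k\<in>ones P Q. x k *\<^sub>R ?g (w k)) $ i = 0" for i
      using z[of i] by (cases "idx i < P") (simp_all add: sum_component transpose_def below_def mult.commute)
    then have "(\<Sum>k\<in>ones P Q. x k *\<^sub>R ?g (w k)) = 0"
      by (simp add: vec_eq_iff)
    from independent_family_of_dim[OF finite_ones dim this]
    show "\<forall>k\<in>ones P Q. x k = 0" by (rule ballI)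
  qed
  then show "A \<in> generic" by (simp add: generic_def)
qed

lemma smooth_on_minor: "open S \<Longrightarrow> smooth_on (\<lambda>A. minor P Q A $ i $ j) S"
  by (cases "i \<in> ones P Q \<and> j \<in> ones P Q")
    (auto simp: minor_def intro: smooth_on_entry smooth_on_const)

lemma open_det_minor: "open {A. det (minor P Q A) \<noteq> 0}"
proof -
  have "smooth_on (\<lambda>A. det (minor P Q A)) UNIV"
    by (intro smooth_on_det smooth_on_minor open_UNIV)
  then have "continuous_on UNIV (\<lambda>A. det (minor P Q A))" by (rule smooth_on_imp_continuous_on)
  then show ?thesis by (intro open_Collect_neq continuous_on_const)
qed

lemma open_generic: "open generic"
proof -
  have "generic = (\<Inter>P\<in>{..CARD('m)}. \<Inter>Q\<in>{..CARD('n)}. {A. det (minor P Q A) \<noteq> 0})"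
    by (auto simp: generic_def)
  then show ?thesis by (simp only:) (intro open_INT finite_atMost ballI open_det_minor)
qed

text \<open>Only the minors occurring as denominators. The charts change the entries in
  \<open>D\<close> and may leave \<open>generic\<close>, but under \<open>D_closed\<close> they keep
  these minors, so \<open>generic_D\<close> is preserved.\<close>

definition generic_D :: "(real^'n::{finite,linorder}^'m::{finite,linorder}) set" where
  "generic_D = (\<Inter>(p, q)\<in>D. {A. det (minor (idx p) (idx q) A) \<noteq> 0})"

lemma open_generic_D: "open generic_D"
  unfolding generic_D_def by (intro open_INT) (auto simp: open_det_minor)

lemma generic_subset: "generic \<subseteq> generic_D"
  using generic_det by (auto simp: generic_D_def)

lemma smooth_on_\<phi>: "(p, q) \<in> D \<Longrightarrow> smooth_on (\<phi> p q) generic_D"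
proof -
  assume D: "(p, q) \<in> D"
  note o = open_generic_D
  have "smooth_on (\<lambda>A. \<phi> p q A) generic_D"
    unfolding \<phi>_def
  proof (intro smooth_on_sum smooth_on_mult smooth_on_divide smooth_on_det smooth_on_minor smooth_on_entry o)
    fix k i j
    show "smooth_on (\<lambda>A. (\<chi> i j. if j = k then if i \<in> ones (idx p) (idx q) then A $ i $ q else 0 else minor (idx p) (idx q) A $ i $ j) $ i $ j) generic_D"
      by (cases "j = k"; cases "i \<in> ones (idx p) (idx q)")
        (auto intro!: smooth_on_const smooth_on_entry smooth_on_minor o)
  qed (use D in \<open>auto simp: generic_D_def\<close>)
  then show ?thesis by simp
qed

text \<open>A shear that flattens the graph: on \<open>X\<close> the coordinates in \<open>D\<close>
  become 0.\<close>

definition chart :: "real^'n::{finite,linorder}^'m::{finite,linorder} \<Rightarrow> real^'n::{finite,linorder}^'m::{finite,linorder}" where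
  "chart A = (\<chi> p q. A $ p $ q - (if (p, q) \<in> D then \<phi> p q A else 0))"

definition unchart :: "real^'n::{finite,linorder}^'m::{finite,linorder} \<Rightarrow> real^'n::{finite,linorder}^'m::{finite,linorder}" where
  "unchart A = (\<chi> p q. A $ p $ q + (if (p, q) \<in> D then \<phi> p q A else 0))"

lemma smooth_on_charts: "smooth_on chart generic_D" "smooth_on unchart generic_D"
proof -
  note o = open_generic_D
  have s: "smooth_on (\<lambda>A. if (p, q) \<in> D then \<phi> p q A else 0) generic_D" for p q
    by (cases "(p, q) \<in> D") (auto intro: smooth_on_\<phi> smooth_on_const o)
  show "smooth_on chart generic_D" "smooth_on unchart generic_D"
    by (intro smooth_on_matrixI o;
      simp add: chart_def unchart_def smooth_on_diff smooth_on_add smooth_on_entry s o)+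
qed

lemma subspace_zero_on_D: "subspace {A :: real^'n::{finite,linorder}^'m::{finite,linorder}. \<forall>p q. (p, q) \<in> D \<longrightarrow> A $ p $ q = 0}"
  by (rule subspaceI) auto

lemma dim_zero_on_D: "dim {A :: real^'n::{finite,linorder}^'m::{finite,linorder}. \<forall>p q. (p, q) \<in> D \<longrightarrow> A $ p $ q = 0} = CARD('m) * CARD('n) - card D"
proof -
  define e :: "'m \<times> 'n \<Rightarrow> real^'n::{finite,linorder}^'m::{finite,linorder}" where "e = (\<lambda>(i, j). axis i (axis j 1))"
  have inj: "inj e" by (auto simp: inj_on_def e_def axis_eq_axis)
  have Basis: "Basis = range e"
    by (auto simp: Basis_vec_def e_def)
  have e: "A \<bullet> e (i, j) = A $ i $ j" for A i j by (simp add: e_def inner_axis)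
  have "{A. \<forall>p q. (p, q) \<in> D \<longrightarrow> A $ p $ q = 0} = {A. \<forall>b\<in>Basis. b \<notin> e ` (- D) \<longrightarrow> A \<bullet> b = 0}"
    unfolding Basis using inj by (auto simp: e inj_image_mem_iff)
  moreover have "e ` (- D) \<subseteq> Basis" unfolding Basis by auto
  ultimately have "dim {A :: real^'n::{finite,linorder}^'m::{finite,linorder}. \<forall>p q. (p, q) \<in> D \<longrightarrow> A $ p $ q = 0} = card (e ` (- D))"
    by (simp only: dim_substandard)
  also have "\<dots> = CARD('m \<times> 'n) - card D"
    using card_image[OF inj_on_subset[OF inj subset_UNIV], of "- D"] by (simp add: Compl_eq_Diff_UNIV card_Diff_subset)
  finally show ?thesis by simp
qed

text \<open>
  The condition \<open>D_closed\<close> excludes the pattern 2143 from the extension. It makes \<open>\<phi> p q\<close> a function of the entries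
  outside \<open>D\<close> only, so that \<open>X\<close> is a graph over these entries.
\<close>

context
  assumes D_closed: "\<And>p q i j. (p, q) \<in> D \<Longrightarrow> idx i < idx p \<Longrightarrow> (i, q) \<notin> D \<Longrightarrow> idx j < idx q \<Longrightarrow> (p, j) \<notin> D \<Longrightarrow> (i, j) \<notin> D"
begin

text \<open>These are the three kinds of entries in the formula for \<open>\<phi> p q\<close>. Row
  \<open>i\<close> has its 1 left of column \<open>q\<close>, and column \<open>w k\<close> has its
  1 above row \<open>p\<close>; the entries inside the minor need \<open>D_closed\<close>.\<close>

lemma ones_not_D:
  assumes "(p, q) \<in> D" "i \<in> ones (idx p) (idx q)" "k \<in> ones (idx p) (idx q)"
  shows "(i, q) \<notin> D" "(p, w k) \<notin> D" "(i, w k) \<notin> D"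
proof -
  have i: "idx i < idx p" "idx (w i) < idx q" "\<mu> $ i $ w i = 1" and k: "idx k < idx p" "idx (w k) < idx q" "\<mu> $ k $ w k = 1"
    using onesD[OF assms(2)] onesD[OF assms(3)] by (auto simp: below_def)
  show 1: "(i, q) \<notin> D" using i(2,3) by (auto simp: D_def intro!: exI[of _ "w i"])
  show 2: "(p, w k) \<notin> D" using k(1,3) by (auto simp: D_def intro!: exI[of _ k])
  show "(i, w k) \<notin> D" by (rule D_closed[OF assms(1) i(1) 1 k(2) 2])
qed

lemma \<phi>_cong:
  assumes D: "(p, q) \<in> D" and AB: "\<And>i j. (i, j) \<notin> D \<Longrightarrow> A $ i $ j = B $ i $ j"
  shows "minor (idx p) (idx q) A = minor (idx p) (idx q) B" "\<phi> p q A = \<phi> p q B"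
proof -
  show m: "minor (idx p) (idx q) A = minor (idx p) (idx q) B"
    using ones_not_D(3)[OF D] AB by (simp add: minor_def vec_eq_iff)
  have 1: "A $ p $ w k = B $ p $ w k" if "k \<in> ones (idx p) (idx q)" for k
    using ones_not_D(2)[OF D that that] AB by blast
  have 2: "(if i \<in> ones (idx p) (idx q) then A $ i $ q else 0) = (if i \<in> ones (idx p) (idx q) then B $ i $ q else 0)" for i
    using ones_not_D(1)[OF D, of i i] AB by auto
  show "\<phi> p q A = \<phi> p q B"
    unfolding \<phi>_def m 2 by (rule sum.cong) (simp_all add: 1)
qed

lemma chart_cong:
  "(p, q) \<in> D \<Longrightarrow> minor (idx p) (idx q) (chart A) = minor (idx p) (idx q) A"
  "(p, q) \<in> D \<Longrightarrow> \<phi> p q (chart A) = \<phi> p q A"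
  "(p, q) \<in> D \<Longrightarrow> minor (idx p) (idx q) (unchart A) = minor (idx p) (idx q) A"
  "(p, q) \<in> D \<Longrightarrow> \<phi> p q (unchart A) = \<phi> p q A"
  by (rule \<phi>_cong; simp add: chart_def unchart_def)+

lemma unchart_chart: "unchart (chart A) = A"
proof -
  have "unchart (chart A) $ p $ q = A $ p $ q" for p q
    unfolding unchart_def[of "chart A"] by (simp add: chart_cong(2)) (simp add: chart_def)
  then show ?thesis by (simp add: vec_eq_iff)
qed

lemma chart_unchart: "chart (unchart A) = A"
proof -
  have "chart (unchart A) $ p $ q = A $ p $ q" for p q
    unfolding chart_def[of "unchart A"] by (simp add: chart_cong(4)) (simp add: unchart_def)
  then show ?thesis by (simp add: vec_eq_iff)
qed

theorem smooth_submanifold_X: "smooth_submanifold (CARD('m) * CARD('n) - card D) X"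
proof -
  \<comment> \<open>The image of \<open>generic\<close> under \<open>chart\<close>, written so that
    it is visibly open.\<close>
  let ?V = "generic_D \<inter> unchart -` generic" and ?E = "{A. \<forall>p q. (p, q) \<in> D \<longrightarrow> A $ p $ q = 0}"
  have V: "open ?V"
    by (intro continuous_open_preimage smooth_on_imp_continuous_on smooth_on_charts open_generic_D open_generic)
  have chart_V: "chart A \<in> ?V" if "A \<in> generic" for A
  proof -
    have "A \<in> generic_D" using that generic_subset by blast
    then show ?thesis using that by (auto simp: generic_D_def chart_cong(1) unchart_chart)
  qed
  have F: "smooth_on chart generic" using smooth_on_charts(1) generic_subset by (rule smooth_on_subset)
  have G: "smooth_on unchart ?V" using smooth_on_charts(2) by (rule smooth_on_subset) auto
  have hom: "homeomorphism generic ?V chart unchart"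
    using chart_V smooth_on_imp_continuous_on[OF F] smooth_on_imp_continuous_on[OF G]
    by (intro homeomorphismI) (auto simp: unchart_chart chart_unchart)
  have img: "chart ` (X \<inter> generic) = ?E \<inter> ?V"
  proof (intro subset_antisym subsetI)
    fix B assume "B \<in> chart ` (X \<inter> generic)"
    then obtain A where A: "A \<in> X" "A \<in> generic" "B = chart A" by auto
    then show "B \<in> ?E \<inter> ?V"
      using chart_V[OF A(2)] X_imp_entry_eq[OF A(1,2)] by (auto simp: chart_def)
  next
    fix B assume B: "B \<in> ?E \<inter> ?V"
    have "unchart B \<in> X"
    proof (rule generic_eq_imp_X)
      show "unchart B $ p $ q = \<phi> p q (unchart B)" if "(p, q) \<in> D" for p q
        using B that unfolding chart_cong(4)[OF that] by (auto simp: unchart_def)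
    qed (use B in auto)
    then show "B \<in> chart ` (X \<inter> generic)"
      using B by (intro image_eqI[of _ _ "unchart B"]) (auto simp: chart_unchart)
  qed
  show ?thesis
    unfolding smooth_submanifold_def
    using X_subset_generic open_generic V hom F G img subspace_zero_on_D dim_zero_on_D
    by (intro ballI exI[of _ generic] exI[of _ ?V] exI[of _ chart] exI[of _ unchart] exI[of _ ?E] conjI) auto
qed

end

end

section \<open>Lines through matrices of given rank\<close>

definition cut :: "'n set \<Rightarrow> real^'n \<Rightarrow> real^'n" where
  "cut J v = (\<chi> j. if j \<in> J then v $ j else 0)"

definition tensor :: "real^'m \<Rightarrow> real^'n \<Rightarrow> real^'n^'m" where
  "tensor u v = (\<chi> i j. u $ i * v $ j)"

lemma cut_nth [simp]: "cut J v $ j = (if j \<in> J then v $ j else 0)"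
  by (simp add: cut_def)

lemma tensor_nth [simp]: "tensor u v $ i $ j = u $ i * v $ j"
  by (simp add: tensor_def)

lemma linear_cut: "linear (cut J)"
  by (auto simp: linear_iff vec_eq_iff)

lemma inner_tensor: "tensor u v \<bullet> tensor u' v' = (u \<bullet> u') * (v \<bullet> v')"
  unfolding inner_vec_def sum_product by (intro sum.cong refl) (simp add: mult_ac)

text \<open>Each row changes by a multiple of \<open>cut J v\<close>, which already lies in the row
  space, so the row space cannot grow.\<close>

lemma rank_line:
  fixes A :: "real^'n^'m"
  assumes "cut J v \<in> span (rowr J A ` I)"
  shows "rank (restr I J (A + t *\<^sub>R tensor u v)) \<le> rank (restr I J A)"
proof -
  have "rowr J (A + t *\<^sub>R tensor u v) i = rowr J A i + (t * u $ i) *\<^sub>R cut J v" for i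
    by (simp add: vec_eq_iff)
  then have "rowr J (A + t *\<^sub>R tensor u v) ` I \<subseteq> span (rowr J A ` I)"
    using assms by (simp add: image_subset_iff span_add span_scale span_base)
  then have "dim (rowr J (A + t *\<^sub>R tensor u v) ` I) \<le> dim (rowr J A ` I)"
    by (metis dim_span dim_subset)
  then show ?thesis by (simp add: rank_restr_eq_dim_rows)
qed

lemma rank_line_col:
  fixes A :: "real^'n^'m"
  assumes "cut I u \<in> span (rowr I (transpose A) ` J)"
  shows "rank (restr I J (A + t *\<^sub>R tensor u v)) \<le> rank (restr I J A)"
proof -
  have "transpose (A + t *\<^sub>R tensor u v) = transpose A + t *\<^sub>R tensor v u"
    by (simp add: vec_eq_iff transpose_def mult.commute)
  then show ?thesis
    using rank_line[OF assms, of t v] by (metis rank_transpose transpose_restr)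
qed

text \<open>Adjoin an orthonormal basis of the orthogonal complement of \<open>T\<close> in
  \<open>S\<close>.\<close>

lemma orthonormal_extend:
  fixes S T :: "'a::euclidean_space set"
  assumes S: "subspace S" and T: "subspace T" "T \<subseteq> S"
    and U: "U \<subseteq> T" "pairwise orthogonal U" "\<And>u. u \<in> U \<Longrightarrow> norm u = 1" "card U = dim T" "finite U"
  shows "\<exists>U'. U \<subseteq> U' \<and> U' \<subseteq> S \<and> pairwise orthogonal U' \<and> (\<forall>u\<in>U'. norm u = 1) \<and> card U' = dim S \<and> finite U' \<and>
    (\<forall>u\<in>U' - U. \<forall>x\<in>T. orthogonal u x)"
proof -
  let ?C = "{y \<in> S. \<forall>x\<in>T. orthogonal x y}"
  have "subspace ?C"
    by (rule subspaceI) (use S in \<open>auto simp: subspace_0 subspace_add subspace_scale orthogonal_clauses\<close>)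
  then obtain B where B: "B \<subseteq> ?C" "pairwise orthogonal B" "\<And>x. x \<in> B \<Longrightarrow> norm x = 1"
    "independent B" "card B = dim ?C"
    by (rule orthonormal_basis_subspace) blast
  have fin: "finite B" using B(4) independent_bound by blast
  have orth: "orthogonal u x" if "u \<in> B" "x \<in> T" for u x
    using that B(1) by (auto simp: orthogonal_commute)
  have "U \<inter> B = {}"
  proof (rule ccontr)
    assume "U \<inter> B \<noteq> {}"
    then obtain u where "u \<in> U" "u \<in> B" by blast
    then have "orthogonal u u" using orth U(1) by blast
    then show False using U(3)[OF \<open>u \<in> U\<close>] by (simp add: orthogonal_self)
  qed
  then have "card (U \<union> B) = dim T + dim ?C" using U fin B by (simp add: card_Un_disjoint)
  also have "\<dots> = dim S"
    using dim_subspace_orthogonal_to_vectors[OF T(1) S T(2)] by simp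
  finally have "card (U \<union> B) = dim S" .
  moreover have "pairwise orthogonal (U \<union> B)"
    using U(1,2) B(2) orth unfolding pairwise_def by (metis Un_iff orthogonal_commute subsetD)
  ultimately show ?thesis
    using U T(2) B(1,3) fin orth by (intro exI[of _ "U \<union> B"]) auto
qed

text \<open>Every vector added after the stage of \<open>Ti\<close> is orthogonal to
  \<open>Ti\<close>. A unit vector is not orthogonal to itself, so exactly the basis vectors of the
  earlier stages lie in \<open>Ti\<close>, and they can be counted.\<close>

lemma adapted_orthonormal_basis:
  fixes T1 T2 T3 :: "'a::euclidean_space set"
  assumes sub: "subspace T1" "subspace T2" "subspace T3" and le: "T1 \<subseteq> T2" "T2 \<subseteq> T3"
  obtains U where "finite U" "pairwise orthogonal U" "\<And>u. u \<in> U \<Longrightarrow> norm u = 1" "card U = DIM('a)"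
    "card (U \<inter> T1) = dim T1" "card (U \<inter> T2) = dim T2" "card (U \<inter> T3) = dim T3"
    "\<And>u x. u \<in> U - T3 \<Longrightarrow> x \<in> T3 \<Longrightarrow> orthogonal u x"
proof -
  obtain U1 where 1: "U1 \<subseteq> T1" "pairwise orthogonal U1" "\<And>x. x \<in> U1 \<Longrightarrow> norm x = 1" "card U1 = dim T1" "finite U1"
    using orthonormal_basis_subspace[OF sub(1)] independent_bound by metis
  obtain U2 where 2: "U1 \<subseteq> U2" "U2 \<subseteq> T2" "pairwise orthogonal U2" "\<And>x. x \<in> U2 \<Longrightarrow> norm x = 1" "card U2 = dim T2"
    "finite U2" "\<And>u x. u \<in> U2 - U1 \<Longrightarrow> x \<in> T1 \<Longrightarrow> orthogonal u x"
    using orthonormal_extend[OF sub(2,1) le(1) 1] by metis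
  obtain U3 where 3: "U2 \<subseteq> U3" "U3 \<subseteq> T3" "pairwise orthogonal U3" "\<And>x. x \<in> U3 \<Longrightarrow> norm x = 1" "card U3 = dim T3"
    "finite U3" "\<And>u x. u \<in> U3 - U2 \<Longrightarrow> x \<in> T2 \<Longrightarrow> orthogonal u x"
    using orthonormal_extend[OF sub(3,2) le(2) 2(2-6)] by metis
  obtain U4 where 4: "U3 \<subseteq> U4" "pairwise orthogonal U4" "\<And>x. x \<in> U4 \<Longrightarrow> norm x = 1" "card U4 = dim (UNIV :: 'a set)"
    "finite U4" "\<And>u x. u \<in> U4 - U3 \<Longrightarrow> x \<in> T3 \<Longrightarrow> orthogonal u x"
    using orthonormal_extend[OF subspace_UNIV sub(3) subset_UNIV 3(2-6)] by metis
  have o1: "orthogonal u x" if "u \<in> U4 - U1" "x \<in> T1" for u x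
    using that le 2(7) 3(7) 4(6) by blast
  have o2: "orthogonal u x" if "u \<in> U4 - U2" "x \<in> T2" for u x
    using that le 3(7) 4(6) by blast
  have no: "\<not> orthogonal u u" if "u \<in> U4" for u using 4(3)[OF that] by (auto simp: orthogonal_self)
  have i: "U4 \<inter> T1 = U1" "U4 \<inter> T2 = U2" "U4 \<inter> T3 = U3"
    using 1(1) 2(1,2) 3(1,2) 4(1) o1 o2 4(6) no by blast+
  have "card U4 = DIM('a)" using 4(4) by simp
  then show ?thesis
    using i 1(4) 2(5) 3(5) 4(6) by (intro that[OF 4(5,2,3)]) auto
qed

lemma subspace_supported: "subspace {v :: real^'n. \<forall>j. j \<notin> J \<longrightarrow> v $ j = 0}"
  by (rule subspaceI) auto

lemma dim_supported: "dim {v :: real^'n. \<forall>j. j \<notin> J \<longrightarrow> v $ j = 0} = card J"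
proof -
  have inj: "inj (\<lambda>j::'n. axis j (1::real))" by (auto simp: inj_on_def axis_eq_axis)
  have Basis: "(Basis :: (real^'n) set) = range (\<lambda>j. axis j 1)" by (auto simp: Basis_vec_def)
  have "{v :: real^'n. \<forall>j. j \<notin> J \<longrightarrow> v $ j = 0} = {v. \<forall>b\<in>Basis. b \<notin> (\<lambda>j. axis j 1) ` J \<longrightarrow> v \<bullet> b = 0}"
    unfolding Basis by (auto simp: inner_axis inj_image_mem_iff[OF inj])
  moreover have "(\<lambda>j. axis j 1) ` J \<subseteq> (Basis :: (real^'n) set)" unfolding Basis by auto
  ultimately have "dim {v :: real^'n. \<forall>j. j \<notin> J \<longrightarrow> v $ j = 0} = card ((\<lambda>j. axis j (1::real)) ` J)"
    by (simp only: dim_substandard)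
  then show ?thesis using card_image[OF inj_on_subset[OF inj subset_UNIV], of J] by simp
qed

text \<open>The space is the direct sum of \<open>S1\<close> and the vectors supported on
  \<open>J2 - J1\<close>.\<close>

lemma dim_cut_in:
  fixes S1 :: "(real^'n) set"
  assumes S1: "subspace S1" "\<And>v j. v \<in> S1 \<Longrightarrow> j \<notin> J1 \<Longrightarrow> v $ j = 0" and J: "J1 \<subseteq> J2"
  shows "dim {v. (\<forall>j. j \<notin> J2 \<longrightarrow> v $ j = 0) \<and> cut J1 v \<in> S1} = dim S1 + (card J2 - card J1)"
proof -
  let ?T = "{v :: real^'n. \<forall>j. j \<notin> J2 - J1 \<longrightarrow> v $ j = 0}"
  have cut1: "cut J1 v = v" if "v \<in> S1" for v using S1(2)[OF that] by (auto simp: vec_eq_iff)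
  have cut0: "cut J1 v = 0" if "v \<in> ?T" for v using that by (auto simp: vec_eq_iff)
  have "{v. (\<forall>j. j \<notin> J2 \<longrightarrow> v $ j = 0) \<and> cut J1 v \<in> S1} = {x + y | x y. x \<in> S1 \<and> y \<in> ?T}"
  proof (intro subset_antisym subsetI)
    fix v assume v: "v \<in> {v. (\<forall>j. j \<notin> J2 \<longrightarrow> v $ j = 0) \<and> cut J1 v \<in> S1}"
    have "v = cut J1 v + (v - cut J1 v)" by simp
    moreover have "v - cut J1 v \<in> ?T" using v by auto
    ultimately show "v \<in> {x + y | x y. x \<in> S1 \<and> y \<in> ?T}" using v by blast
  next
    fix v assume "v \<in> {x + y | x y. x \<in> S1 \<and> y \<in> ?T}"
    then obtain x y where v: "v = x + y" "x \<in> S1" "y \<in> ?T" by blast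
    have "cut J1 v = cut J1 x + cut J1 y" unfolding v(1) by (rule linear_add[OF linear_cut])
    then have "cut J1 v = x" using cut1[OF v(2)] cut0[OF v(3)] by simp
    then show "v \<in> {v. (\<forall>j. j \<notin> J2 \<longrightarrow> v $ j = 0) \<and> cut J1 v \<in> S1}"
      using v S1(2) J by auto
  qed
  moreover have "S1 \<inter> ?T = {0}"
    using cut1 cut0 subspace_0[OF S1(1)] by fastforce
  moreover have "dim ?T = card J2 - card J1"
    unfolding dim_supported using J by (simp add: card_Diff_subset finite_subset[OF J])
  ultimately show ?thesis
    using dim_sums_Int[OF S1(1) subspace_supported[of "J2 - J1"]] by simp
qed

text \<open>
  With \<open>W1 \<subseteq> W2 \<subseteq> W3\<close> the column spaces of the two blocks and the vectors supported on \<open>I\<close>, and \<open>S \<subseteq> S2 \<subseteq> S3\<close>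
  the row space of the larger block, the vectors whose restriction to \<open>J1\<close> is in the row space of the
  smaller block, and the vectors supported on \<open>J2\<close>, a line in the direction \<open>tensor u v\<close> preserves
  both rank bounds if \<open>u \<in> W1\<close>, or \<open>v \<in> S\<close>, or \<open>u \<in> W2\<close> and \<open>v \<in> S2\<close>. Orthonormal bases adapted to the two
  filtrations give as many such directions as \<open>X\<^sub>\<omega>\<close> has dimensions.
\<close>

theorem orthonormal_lines:
  fixes A :: "real^'n^'m"
  assumes J: "J1 \<subseteq> J2" and k1: "rank (restr I J1 A) = k1" and k2: "rank (restr I J2 A) = k2"
  shows "\<exists>B. pairwise orthogonal B \<and> (\<forall>b\<in>B. norm b = 1) \<and> finite B \<and>
    card B = CARD('m) * CARD('n) - ((k2 - k1) * (card J1 - k1) + (card I - k2) * (card J2 - k2)) \<and>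
    (\<forall>b\<in>B. \<forall>t. rank (restr I J1 (A + t *\<^sub>R b)) \<le> k1 \<and> rank (restr I J2 (A + t *\<^sub>R b)) \<le> k2)"
proof -
  define W1 W2 W3 where "W1 = span (rowr I (transpose A) ` J1)" and "W2 = span (rowr I (transpose A) ` J2)"
    and "W3 = {u :: real^'m. \<forall>i. i \<notin> I \<longrightarrow> u $ i = 0}"
  define S S1 S3 S2 where "S = span (rowr J2 A ` I)" and "S1 = span (rowr J1 A ` I)"
    and "S3 = {v :: real^'n. \<forall>j. j \<notin> J2 \<longrightarrow> v $ j = 0}"
    and "S2 = {v. (\<forall>j. j \<notin> J2 \<longrightarrow> v $ j = 0) \<and> cut J1 v \<in> S1}"
  have W12: "W1 \<subseteq> W2" unfolding W1_def W2_def using J by (intro span_mono image_mono)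
  have W23: "W2 \<subseteq> W3"
    unfolding W2_def W3_def by (rule span_minimal[OF _ subspace_supported]) auto
  have S_S3: "S \<subseteq> S3"
    unfolding S_def S3_def by (rule span_minimal[OF _ subspace_supported]) auto
  have S1_supp: "v $ j = 0" if "v \<in> S1" "j \<notin> J1" for v j
  proof -
    have "S1 \<subseteq> {v. \<forall>j. j \<notin> J1 \<longrightarrow> v $ j = 0}"
      unfolding S1_def by (rule span_minimal[OF _ subspace_supported]) auto
    then show ?thesis using that by blast
  qed
  have "cut J1 v \<in> S1" if "v \<in> S" for v
  proof -
    have "cut J1 ` S = span (cut J1 ` rowr J2 A ` I)"
      unfolding S_def by (simp add: linear_span_image[OF linear_cut])
    moreover have "cut J1 (rowr J2 A i) = rowr J1 A i" for i using J by (auto simp: vec_eq_iff)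
    ultimately have "cut J1 ` S = S1" by (simp add: image_image S1_def)
    then show ?thesis using that by blast
  qed
  then have S_S2: "S \<subseteq> S2" using S_S3 by (auto simp: S2_def S3_def)
  have S2_S3: "S2 \<subseteq> S3" by (auto simp: S2_def S3_def)
  have subS1: "subspace S1" by (simp add: S1_def)
  have sub: "subspace W1" "subspace W2" "subspace W3" "subspace S" "subspace S2" "subspace S3"
  proof -
    have "subspace {v. cut J1 v \<in> S1}"
      using linear_subspace_vimage[OF linear_cut subS1, of J1] by (simp add: vimage_def)
    moreover have "S2 = S3 \<inter> {v. cut J1 v \<in> S1}" by (auto simp: S2_def S3_def)
    ultimately show "subspace S2" by (simp add: S3_def subspace_inter subspace_supported)
  qed (simp_all add: W1_def W2_def W3_def S_def S3_def subspace_supported)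
  have dimW: "dim W1 = k1" "dim W2 = k2" "dim W3 = card I"
    using k1 k2 unfolding W1_def W2_def W3_def dim_span
    by (simp_all add: dim_supported flip: rank_restr_eq_dim_rows) (metis rank_transpose transpose_restr)+
  have k1S: "dim S1 = k1" using k1 unfolding S1_def dim_span by (simp add: rank_restr_eq_dim_rows)
  have dimS: "dim S = k2" "dim S2 = k1 + (card J2 - card J1)" "dim S3 = card J2"
    using k2 dim_cut_in[OF subS1 S1_supp J] k1S
    unfolding S_def S2_def S3_def dim_span by (simp_all add: dim_supported rank_restr_eq_dim_rows)
  obtain U where U0: "finite U" "pairwise orthogonal U" "\<And>u. u \<in> U \<Longrightarrow> norm u = 1" "card U = DIM(real^'m)"
    "card (U \<inter> W1) = dim W1" "card (U \<inter> W2) = dim W2" "card (U \<inter> W3) = dim W3"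
    "\<And>u x. u \<in> U - W3 \<Longrightarrow> x \<in> W3 \<Longrightarrow> orthogonal u x"
    by (rule adapted_orthonormal_basis[OF sub(1-3) W12 W23]) (rule that; simp)
  note U = U0[unfolded dimW]
  obtain R where R0: "finite R" "pairwise orthogonal R" "\<And>v. v \<in> R \<Longrightarrow> norm v = 1" "card R = DIM(real^'n)"
    "card (R \<inter> S) = dim S" "card (R \<inter> S2) = dim S2" "card (R \<inter> S3) = dim S3"
    "\<And>v x. v \<in> R - S3 \<Longrightarrow> x \<in> S3 \<Longrightarrow> orthogonal v x"
    by (rule adapted_orthonormal_basis[OF sub(4-6) S_S2 S2_S3]) (rule that; simp)
  note R = R0[unfolded dimS]
  have inner_U: "u \<bullet> u' = (if u = u' then 1 else 0)" if "u \<in> U" "u' \<in> U" for u u'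
    using U(2) U(3)[OF that(1)] that by (auto simp: pairwise_def orthogonal_def norm_eq_1)
  have inner_R: "v \<bullet> v' = (if v = v' then 1 else 0)" if "v \<in> R" "v' \<in> R" for v v'
    using R(2) R(3)[OF that(1)] that by (auto simp: pairwise_def orthogonal_def norm_eq_1)
  \<comment> \<open>The first two alternatives leave both blocks untouched: basis vectors outside
    \<open>W3\<close> are orthogonal to it and vanish on \<open>I\<close>, those outside
    \<open>S3\<close> vanish on \<open>J2\<close>.\<close>
  define good where "good u v \<longleftrightarrow> u \<notin> W3 \<or> v \<notin> S3 \<or> v \<in> S \<or> u \<in> W1 \<or> u \<in> W2 \<and> v \<in> S2" for u v
  define L where "L = {(u, v) \<in> U \<times> R. good u v}"
  define B where "B = (\<lambda>(u, v). tensor u v) ` L"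
  have inner_L: "tensor (fst x) (snd x) \<bullet> tensor (fst y) (snd y) = (if x = y then 1 else 0)" if "x \<in> L" "y \<in> L" for x y
    using that inner_U inner_R by (auto simp: L_def inner_tensor split: if_splits)
  have inj: "inj_on (\<lambda>(u, v). tensor u v) L"
  proof (rule inj_onI)
    fix x y assume "x \<in> L" "y \<in> L" "(\<lambda>(u, v). tensor u v) x = (\<lambda>(u, v). tensor u v) y"
    then show "x = y" using inner_L[of x y] inner_L[of x x] by (auto simp: case_prod_unfold split: if_splits)
  qed
  have finL: "finite L" using U(1) R(1) finite_subset[of L "U \<times> R"] by (auto simp: L_def)
  \<comment> \<open>The remaining pairs are counted, not the good ones. If \<open>u\<close> is in
    \<open>W2\<close>, then \<open>v\<close> must miss \<open>S2\<close>, whose codimension in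
    \<open>S3\<close> is \<open>card J1 - k1\<close>; otherwise \<open>v\<close> need only miss
    \<open>S\<close>, of codimension \<open>card J2 - k2\<close>.\<close>
  have bad: "U \<times> R - L = (U \<inter> W2 - U \<inter> W1) \<times> (R \<inter> S3 - R \<inter> S2) \<union> (U \<inter> W3 - U \<inter> W2) \<times> (R \<inter> S3 - R \<inter> S)"
    using W12 W23 S_S2 by (auto simp: L_def good_def)
  have k1_le: "k1 \<le> card J1"
  proof -
    have "dim S1 \<le> dim {v :: real^'n. \<forall>j. j \<notin> J1 \<longrightarrow> v $ j = 0}" by (rule dim_subset) (use S1_supp in blast)
    then show ?thesis by (simp add: k1S dim_supported)
  qed
  have "card J1 \<le> card J2" using J by (simp add: card_mono)
  then have e: "card J2 - (k1 + (card J2 - card J1)) = card J1 - k1" using k1_le by simp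
  have "card (U \<times> R - L) = card ((U \<inter> W2 - U \<inter> W1) \<times> (R \<inter> S3 - R \<inter> S2)) + card ((U \<inter> W3 - U \<inter> W2) \<times> (R \<inter> S3 - R \<inter> S))"
    unfolding bad using U(1) R(1) by (intro card_Un_disjoint) auto
  also have "\<dots> = (k2 - k1) * (card J1 - k1) + (card I - k2) * (card J2 - k2)"
  proof -
    have "card (U \<inter> W2 - U \<inter> W1) = k2 - k1" "card (U \<inter> W3 - U \<inter> W2) = card I - k2"
      using U(1,5-7) W12 W23 by (subst card_Diff_subset; auto)+
    moreover have "card (R \<inter> S3 - R \<inter> S2) = card J1 - k1" "card (R \<inter> S3 - R \<inter> S) = card J2 - k2"
      using R(1,5-7) S2_S3 S_S3 e by (subst card_Diff_subset; auto)+
    ultimately show ?thesis by (simp add: card_cartesian_product)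
  qed
  finally have cbad: "card (U \<times> R - L) = (k2 - k1) * (card J1 - k1) + (card I - k2) * (card J2 - k2)" .
  have "L \<subseteq> U \<times> R" by (auto simp: L_def)
  then have "card (U \<times> R - L) = card (U \<times> R) - card L" "card L \<le> card (U \<times> R)"
    using card_Diff_subset[OF finL] card_mono[of "U \<times> R" L] U(1) R(1) by simp_all
  then have "card L = card (U \<times> R) - ((k2 - k1) * (card J1 - k1) + (card I - k2) * (card J2 - k2))"
    using cbad by simp
  then have cardB: "card B = CARD('m) * CARD('n) - ((k2 - k1) * (card J1 - k1) + (card I - k2) * (card J2 - k2))"
    unfolding B_def card_image[OF inj] using U(4) R(4) by (simp add: card_cartesian_product)
  have "rank (restr I J1 (A + t *\<^sub>R tensor u v)) \<le> k1 \<and> rank (restr I J2 (A + t *\<^sub>R tensor u v)) \<le> k2"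
    if uv: "u \<in> U" "v \<in> R" "good u v" for u v t
  proof -
    have cutW: "cut I x = x" if "x \<in> W3" for x using that by (auto simp: W3_def vec_eq_iff)
    have cutS: "cut J2 x = x" if "x \<in> S3" for x using that by (auto simp: S3_def vec_eq_iff)
    consider "u \<notin> W3" | "v \<notin> S3" | "v \<in> S" | "u \<in> W1" | "u \<in> W2" "v \<in> S2"
      using uv(3) by (auto simp: good_def)
    then show ?thesis
    proof cases
      case 1
      have "u $ i = 0" if "i \<in> I" for i
      proof -
        have "axis i 1 \<in> W3" using that by (auto simp: W3_def axis_def)
        then have "orthogonal u (axis i 1)" using U(8) uv(1) 1 by blast
        then show ?thesis by (simp add: orthogonal_def inner_axis)
      qed
      then have "cut I u = 0" by (simp add: vec_eq_iff)
      then show ?thesis using rank_line_col[of I u A] k1 k2 by (metis span_zero)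
    next
      case 2
      have "v $ j = 0" if "j \<in> J2" for j
      proof -
        have "axis j 1 \<in> S3" using that by (auto simp: S3_def axis_def)
        then have "orthogonal v (axis j 1)" using R(8) uv(2) 2 by blast
        then show ?thesis by (simp add: orthogonal_def inner_axis)
      qed
      then have "cut J1 v = 0" "cut J2 v = 0" using J by (auto simp: vec_eq_iff)
      then show ?thesis using rank_line[of _ v A] k1 k2 by (metis span_zero)
    next
      case 3
      then have "cut J1 v \<in> S1" "cut J2 v \<in> S" using S_S2 S_S3 cutS by (auto simp: S2_def)
      then show ?thesis unfolding S1_def S_def using rank_line k1 k2 by blast
    next
      case 4
      then have "cut I u = u" "u \<in> W2" using W12 W23 by (blast intro: cutW)+
      then have "cut I u \<in> W1" "cut I u \<in> W2" using 4 by simp_all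
      then show ?thesis unfolding W1_def W2_def using rank_line_col k1 k2 by blast
    next
      \<comment> \<open>The two blocks are treated differently: \<open>v\<close> is harmless for the
        rows of the smaller block, \<open>u\<close> for the columns of the larger one.\<close>
      case 5
      then have "cut I u = u" using W23 by (blast intro: cutW)
      then have "cut J1 v \<in> S1" "cut I u \<in> W2" using 5 by (simp_all add: S2_def)
      then show ?thesis unfolding W2_def S1_def using rank_line rank_line_col k1 k2 by blast
    qed
  qed
  then have lines: "\<forall>b\<in>B. \<forall>t. rank (restr I J1 (A + t *\<^sub>R b)) \<le> k1 \<and> rank (restr I J2 (A + t *\<^sub>R b)) \<le> k2"
    by (auto simp: B_def L_def)
  have "pairwise orthogonal B"
  proof (rule pairwiseI)
    fix b b' assume "b \<in> B" "b' \<in> B" "b \<noteq> b'"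
    then obtain x y where "x \<in> L" "y \<in> L" "b = tensor (fst x) (snd x)" "b' = tensor (fst y) (snd y)" "x \<noteq> y"
      by (auto simp: B_def case_prod_unfold)
    then show "orthogonal b b'" using inner_L[of x y] by (simp add: orthogonal_def)
  qed
  moreover have "\<forall>b\<in>B. norm b = 1"
    using inner_L by (auto simp: B_def norm_eq_1 case_prod_unfold)
  moreover have "finite B" using finL by (simp add: B_def)
  ultimately show ?thesis using cardB lines by blast
qed

section \<open>Minimality\<close>

text \<open>The size of this set is the rank prescribed at the cell, by
  \<open>card_ones_D_row\<close>.\<close>

lemma stair_column:
  assumes "stair_params k1 k2 P J1 J2" "(p, q) \<in> stair k1 k2 P J1 J2"
  shows "{i. i < p \<and> (i, q) \<notin> stair k1 k2 P J1 J2} = {..<(if q < J1 then k1 else k2)}"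
  using assms by (auto simp: stair_def stair_params_def)

lemma stair_corners:
  assumes "stair_params k1 k2 P J1 J2" "P \<noteq> 0"
  shows "(P - 1, J1 - 1) \<in> stair k1 k2 P J1 J2" "(P - 1, J2 - 1) \<in> stair k1 k2 P J1 J2"
    "J1 \<noteq> 0" "J2 \<noteq> 0"
    "{i. i < P - 1 \<and> (i, J1 - 1) \<notin> stair k1 k2 P J1 J2} = {..<k1}"
    "{i. i < P - 1 \<and> (i, J2 - 1) \<notin> stair k1 k2 P J1 J2} = {..<k2}"
  using assms by (auto simp: stair_def stair_params_def)

text \<open>Cut the first rectangle at row \<open>k2\<close>. Its upper part has
  \<open>(k2 - k1) * (J1 - k1)\<close> cells; its lower part has the same height
  \<open>P - k2\<close> as the second rectangle, and their widths add up to
  \<open>J2 - k2\<close>.\<close>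

lemma card_stair:
  assumes "stair_params k1 k2 P J1 J2"
  shows "card (stair k1 k2 P J1 J2) = (k2 - k1) * (J1 - k1) + (P - k2) * (J2 - k2)"
proof (cases "P = 0")
  case True
  then show ?thesis using assms by (auto simp: stair_def stair_params_def)
next
  case False
  then have le: "k1 \<le> k2" "k2 < P" "k1 < J1" "J1 \<le> J2" "J1 + (k2 - k1) \<le> J2"
    using assms by (auto simp: stair_params_def)
  have "stair k1 k2 P J1 J2 = {k1..<P} \<times> {k1..<J1} \<union> {k2..<P} \<times> {J1 + (k2 - k1)..<J2}"
    by (auto simp: stair_def)
  also have "card \<dots> = (P - k1) * (J1 - k1) + (P - k2) * (J2 - (J1 + (k2 - k1)))"
    by (subst card_Un_disjoint) auto
  also have "\<dots> = (k2 - k1) * (J1 - k1) + (P - k2) * (J2 - k2)"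
  proof -
    have "P - k1 = (k2 - k1) + (P - k2)" "J2 - k2 = (J1 - k1) + (J2 - (J1 + (k2 - k1)))" using le by auto
    then show ?thesis by (simp only: add_mult_distrib add_mult_distrib2 add.assoc)
  qed
  finally show ?thesis .
qed

lemma stair_D_closed:
  assumes "(p, q) \<in> stair k1 k2 P J1 J2" "i < p" "(i, q) \<notin> stair k1 k2 P J1 J2" "j < q" "(p, j) \<notin> stair k1 k2 P J1 J2"
  shows "(i, j) \<notin> stair k1 k2 P J1 J2"
  using assms by (auto simp: stair_def)

lemma card_idx_vimage:
  assumes "S \<subseteq> {..<CARD('m)} \<times> {..<CARD('n)}"
  shows "card {(p :: 'm::{finite,linorder}, q :: 'n::{finite,linorder}). (idx p, idx q) \<in> S} = card S"
proof -
  let ?T = "{(p :: 'm, q :: 'n). (idx p, idx q) \<in> S}"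
  have "map_prod idx idx ` ?T = S"
  proof (intro subset_antisym subsetI)
    fix x assume "x \<in> S"
    then show "x \<in> map_prod idx idx ` ?T"
      using assms by (cases x) (auto intro!: image_eqI[of _ _ "(nth_index (fst x), nth_index (snd x))"])
  qed auto
  moreover have "inj_on (map_prod idx idx) ?T" by (auto intro!: inj_onI)
  ultimately show ?thesis using card_image by metis
qed

text \<open>The corner of any cell of the diagram lies in the block with \<open>J1\<close> columns
  or in the one with \<open>J2\<close> columns, so two rank bounds control all cells.\<close>

lemma stair_lines:
  fixes A :: "real^'n::{finite,linorder}^'m::{finite,linorder}"
  assumes S: "stair_params k1 k2 P J1 J2" and sub: "stair k1 k2 P J1 J2 \<subseteq> {..<CARD('m)} \<times> {..<CARD('n)}"
    and k1: "rank (restr (below P) (below J1) A) = k1" and k2: "rank (restr (below P) (below J2) A) = k2"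
  shows "\<exists>B. pairwise orthogonal B \<and> (\<forall>b\<in>B. norm b = 1) \<and> finite B \<and>
    card B = CARD('m) * CARD('n) - card (stair k1 k2 P J1 J2) \<and>
    (\<forall>b\<in>B. \<forall>t (p::'m) (q::'n). (idx p, idx q) \<in> stair k1 k2 P J1 J2 \<longrightarrow>
      rank (restr (below (Suc (idx p))) (below (Suc (idx q))) (A + t *\<^sub>R b)) \<le> (if idx q < J1 then k1 else k2))"
proof -
  have J: "J1 \<le> J2" using S by (auto simp: stair_params_def)
  \<comment> \<open>Otherwise \<open>below\<close> would be truncated by the types and its size
    would not be \<open>P\<close> or \<open>J2\<close>.\<close>
  have "P \<le> CARD('m) \<and> J2 \<le> CARD('n)"
  proof (cases "P = 0")
    case True then show ?thesis using S by (auto simp: stair_params_def)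
  next
    case False
    from stair_corners(2)[OF S this] sub show ?thesis by auto
  qed
  then have c: "card (below P :: 'm set) = P" "card (below J1 :: 'n set) = J1" "card (below J2 :: 'n set) = J2"
    using J by (auto simp: card_below)
  have "(below J1 :: 'n set) \<subseteq> below J2" using J by (auto simp: below_def)
  from orthonormal_lines[OF this k1 k2] obtain B where B: "pairwise orthogonal B" "\<forall>b\<in>B. norm b = 1" "finite B"
    "card B = CARD('m) * CARD('n) - card (stair k1 k2 P J1 J2)"
    and r: "\<forall>b\<in>B. \<forall>t. rank (restr (below P) (below J1) (A + t *\<^sub>R b)) \<le> k1 \<and> rank (restr (below P) (below J2) (A + t *\<^sub>R b)) \<le> k2"
    unfolding c card_stair[OF S] by blast
  have "rank (restr (below (Suc (idx p))) (below (Suc (idx q))) (A + t *\<^sub>R b)) \<le> (if idx q < J1 then k1 else k2)"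
    if b: "b \<in> B" and pq: "(idx p, idx q) \<in> stair k1 k2 P J1 J2" for b t and p :: 'm and q :: 'n
  proof -
    have "(below (Suc (idx p)) :: 'm set) \<subseteq> below P" using pq by (auto simp: stair_def below_def)
    moreover have "(below (Suc (idx q)) :: 'n set) \<subseteq> below (if idx q < J1 then J1 else J2)"
      using pq J by (auto simp: stair_def below_def)
    ultimately have "rank (restr (below (Suc (idx p))) (below (Suc (idx q))) (A + t *\<^sub>R b)) \<le>
        rank (restr (below P) (below (if idx q < J1 then J1 else J2)) (A + t *\<^sub>R b))"
      by (rule rank_restr_mono)
    also have "\<dots> \<le> (if idx q < J1 then k1 else k2)" using r b by simp
    finally show ?thesis .
  qed
  then show ?thesis using B by blast
qed

lemma card_idx:
  fixes I :: "'i::{finite,linorder} set"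
  assumes I: "\<And>i. i \<in> I \<longleftrightarrow> idx i < n \<and> R i" and n: "n \<le> CARD('i)"
  shows "card I = card {k. k < n \<and> R (nth_index k)}"
proof -
  have "idx ` I = {k. k < n \<and> R (nth_index k)}"
  proof (intro subset_antisym subsetI)
    fix k assume k: "k \<in> {k. k < n \<and> R (nth_index k)}"
    then have "idx (nth_index k :: 'i) = k" using n by simp
    moreover have "nth_index k \<in> I" using k calculation by (simp add: I)
    ultimately show "k \<in> idx ` I" by (metis imageI)
  qed (auto simp: I)
  moreover have "inj_on idx I" by (auto intro: inj_onI)
  ultimately show ?thesis using card_image by metis
qed

context partial_perm
begin

text \<open>Column \<open>q\<close> has no 1 down to row \<open>p\<close>. Hence a cell
  \<open>(i, q)\<close> above is outside \<open>D\<close> exactly if row \<open>i\<close> has its 1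
  to the left, and the 1s north-west of a cell of \<open>D\<close> are counted by \<open>D\<close>
  alone.\<close>

lemma card_ones_D_row:
  assumes "(p, q) \<in> D"
  shows "card (ones (idx p) (idx q)) = card {i. i < idx p \<and> (nth_index i, q) \<notin> D}"
proof -
  have "\<mu> $ i $ q \<noteq> 1" if "idx i \<le> idx p" for i using assms that by (auto simp: D_def)
  then have "i \<in> ones (idx p) (idx q) \<longleftrightarrow> idx i < idx p \<and> (i, q) \<notin> D" for i
    unfolding ones_def D_def below_def by (auto simp: le_less)
  then show ?thesis by (rule card_idx) (simp add: less_imp_le)
qed

lemma card_ones_D_col:
  assumes "(p, q) \<in> D"
  shows "card (ones (idx p) (idx q)) = card {j. j < idx q \<and> (p, nth_index j) \<notin> D}"
proof -
  have "\<mu> $ p $ j \<noteq> 1" if "idx j \<le> idx q" for j using assms that by (auto simp: D_def)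
  then have "(\<exists>i. idx i < idx p \<and> \<mu> $ i $ j = 1) \<longleftrightarrow> (p, j) \<notin> D" if "idx j < idx q" for j
    using that unfolding D_def by (auto simp: le_less)
  moreover have "j \<in> w ` ones (idx p) (idx q) \<longleftrightarrow> idx j < idx q \<and> (\<exists>i. idx i < idx p \<and> \<mu> $ i $ j = 1)" for j
    using w_eq by (force simp: ones_def below_def)
  ultimately have "j \<in> w ` ones (idx p) (idx q) \<longleftrightarrow> idx j < idx q \<and> (p, j) \<notin> D" for j by blast
  then have "card (w ` ones (idx p) (idx q)) = card {j. j < idx q \<and> (p, nth_index j) \<notin> D}"
    by (rule card_idx) (simp add: less_imp_le)
  then show ?thesis by (simp add: card_image[OF inj_on_w])
qed

lemma rk_X_D:
  assumes "A \<in> X" "(p, q) \<in> D"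
  shows "rk A (Suc (idx p)) (Suc (idx q)) = card (ones (idx p) (idx q))"
  using assms ones_D[OF assms(2)] by (simp add: X_def Suc_leI)

text \<open>The bounds hold on the whole lines, membership in \<open>X\<close> only as long as they
  stay in the open set \<open>generic\<close>; short segments are all that minimality needs.\<close>

lemma minimal_submanifold_X_of_lines:
  assumes D_closed: "\<And>p q i j. (p, q) \<in> D \<Longrightarrow> idx i < idx p \<Longrightarrow> (i, q) \<notin> D \<Longrightarrow> idx j < idx q \<Longrightarrow> (p, j) \<notin> D \<Longrightarrow> (i, j) \<notin> D"
    and lines: "\<And>A. A \<in> X \<Longrightarrow> \<exists>B. pairwise orthogonal B \<and> (\<forall>b\<in>B. norm b = 1) \<and> finite B \<and>
      card B = CARD('m) * CARD('n) - card D \<and>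
      (\<forall>b\<in>B. \<forall>t p q. (p, q) \<in> D \<longrightarrow> rk (A + t *\<^sub>R b) (Suc (idx p)) (Suc (idx q)) \<le> card (ones (idx p) (idx q)))"
  shows "minimal_submanifold X"
proof (rule minimal_submanifoldI[OF smooth_submanifold_X[OF D_closed]])
  fix A assume A: "A \<in> X"
  obtain B where B: "pairwise orthogonal B" "\<forall>b\<in>B. norm b = 1" "finite B" "card B = CARD('m) * CARD('n) - card D"
    and r: "\<And>b t p q. b \<in> B \<Longrightarrow> (p, q) \<in> D \<Longrightarrow> rk (A + t *\<^sub>R b) (Suc (idx p)) (Suc (idx q)) \<le> card (ones (idx p) (idx q))"
    using lines[OF A] by blast
  obtain e where e: "e > 0" "ball A e \<subseteq> generic"
    using open_generic X_subset_generic A by (meson openE subsetD)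
  have "\<exists>e>0. \<forall>t. \<bar>t\<bar> < e \<longrightarrow> A + t *\<^sub>R b \<in> X" if b: "b \<in> B" for b
  proof (intro exI[of _ e] conjI allI impI)
    fix t :: real assume "\<bar>t\<bar> < e"
    then have "A + t *\<^sub>R b \<in> generic" using e(2) B(2) b by (auto simp: subset_iff dist_norm)
    then show "A + t *\<^sub>R b \<in> X" by (rule generic_rk_imp_X) (rule r[OF b])
  qed (use e in auto)
  then show "\<exists>B. pairwise orthogonal B \<and> (\<forall>b\<in>B. norm b = 1) \<and> card B = CARD('m) * CARD('n) - card D \<and> finite B \<and>
      (\<forall>b\<in>B. \<exists>e>0. \<forall>t. \<bar>t\<bar> < e \<longrightarrow> A + t *\<^sub>R b \<in> X)"
    using B by blast
qed

lemma minimal_submanifold_X_stair: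
  assumes S: "stair_params k1 k2 P J1 J2" "stair k1 k2 P J1 J2 \<subseteq> {..<CARD('m)} \<times> {..<CARD('n)}"
    and D: "\<And>p q. (p, q) \<in> D \<longleftrightarrow> (idx p, idx q) \<in> stair k1 k2 P J1 J2"
  shows "minimal_submanifold X"
proof (rule minimal_submanifold_X_of_lines)
  let ?S = "stair k1 k2 P J1 J2"
  show "(i, j) \<notin> D" if "(p, q) \<in> D" "idx i < idx p" "(i, q) \<notin> D" "idx j < idx q" "(p, j) \<notin> D" for p q i j
    using that unfolding D by (rule stair_D_closed)
  have cD: "card D = card ?S"
    using card_idx_vimage[OF S(2)] D by (metis (mono_tags, lifting) Collect_cong case_prod_conv mem_Collect_eq split_cong subset_antisym subrelI)
  have col: "card (ones (idx p) (idx q)) = card {i. i < idx p \<and> (i, idx q) \<notin> ?S}" if "(p, q) \<in> D" for p q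
  proof -
    have "{i. i < idx p \<and> (nth_index i, q) \<notin> D} = {i. i < idx p \<and> (i, idx q) \<notin> ?S}"
    proof -
      have "idx (nth_index i :: 'm) = i" if "i < idx p" for i using less_trans[OF that idx_less] by simp
      then show ?thesis by (auto simp: D)
    qed
    then show ?thesis using card_ones_D_row[OF that] by simp
  qed
  fix A assume A: "A \<in> X"
  \<comment> \<open>The two blocks are the corners that belong to the cells
    \<open>(P - 1, J1 - 1)\<close> and \<open>(P - 1, J2 - 1)\<close> of the diagram.\<close>
  have "rank (restr (below P) (below J1) A) = k1 \<and> rank (restr (below P) (below J2) A) = k2"
    proof (cases "P = 0")
      case True
      have "restr {} J A = 0" for J by (simp add: vec_eq_iff)
      then show ?thesis
        using True S(1) by (auto simp: stair_params_def)
    next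
      case False
      note c = stair_corners[OF S(1) False]
      define p :: 'm and q1 q2 :: 'n where "p = nth_index (P - 1)" and "q1 = nth_index (J1 - 1)" and "q2 = nth_index (J2 - 1)"
      have i: "idx p = P - 1" "idx q1 = J1 - 1" "idx q2 = J2 - 1"
        using c(1,2) S(2) by (auto simp: p_def q1_def q2_def)
      have D1: "(p, q1) \<in> D" and D2: "(p, q2) \<in> D" using c(1,2) by (simp_all only: D i)
      have k: "card (ones (idx p) (idx q1)) = k1" "card (ones (idx p) (idx q2)) = k2"
        using col[OF D1] col[OF D2] c(5,6) by (simp_all only: i card_lessThan)
      have Suc: "Suc (idx p) = P" "Suc (idx q1) = J1" "Suc (idx q2) = J2" using False c(3,4) i by simp_all
      have "rk A P J1 = k1" "rk A P J2 = k2"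
        using rk_X_D[OF A D1] rk_X_D[OF A D2] by (simp_all only: k Suc)
      then show ?thesis by simp
    qed
  then have rank: "rank (restr (below P) (below J1) A) = k1" "rank (restr (below P) (below J2) A) = k2" by simp_all
  have "card (ones (idx p) (idx q)) = (if idx q < J1 then k1 else k2)" if "(p, q) \<in> D" for p q
    using col[OF that] stair_column[OF S(1)] that by (simp add: D)
  then show "\<exists>B. pairwise orthogonal B \<and> (\<forall>b\<in>B. norm b = 1) \<and> finite B \<and>
      card B = CARD('m) * CARD('n) - card D \<and>
      (\<forall>b\<in>B. \<forall>t p q. (p, q) \<in> D \<longrightarrow> rk (A + t *\<^sub>R b) (Suc (idx p)) (Suc (idx q)) \<le> card (ones (idx p) (idx q)))"
    using stair_lines[OF S rank] unfolding cD by (simp add: D)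
qed

text \<open>Transposition is an isometry that preserves ranks and lines, so the lines are
  constructed through \<open>transpose A\<close> and carried back. The submanifold itself is not
  transposed; the ranks are read off with \<open>card_ones_D_col\<close>.\<close>

lemma minimal_submanifold_X_stair_transpose:
  assumes S: "stair_params k1 k2 P J1 J2" "stair k1 k2 P J1 J2 \<subseteq> {..<CARD('n)} \<times> {..<CARD('m)}"
    and D: "\<And>p q. (p, q) \<in> D \<longleftrightarrow> (idx q, idx p) \<in> stair k1 k2 P J1 J2"
  shows "minimal_submanifold X"
proof (rule minimal_submanifold_X_of_lines)
  let ?S = "stair k1 k2 P J1 J2"
  show "(i, j) \<notin> D" if "(p, q) \<in> D" "idx i < idx p" "(i, q) \<notin> D" "idx j < idx q" "(p, j) \<notin> D" for p q i j
    using that unfolding D by (metis stair_D_closed)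
  have "card {(q :: 'n, p :: 'm). (idx q, idx p) \<in> ?S} = card ?S" by (rule card_idx_vimage[OF S(2)])
  moreover have "{(q :: 'n, p :: 'm). (idx q, idx p) \<in> ?S} = D\<inverse>" using D by auto
  ultimately have cD: "card D = card ?S" by simp
  have col: "card (ones (idx p) (idx q)) = card {j. j < idx q \<and> (j, idx p) \<notin> ?S}" if "(p, q) \<in> D" for p q
  proof -
    have "{j. j < idx q \<and> (p, nth_index j) \<notin> D} = {j. j < idx q \<and> (j, idx p) \<notin> ?S}"
    proof -
      have "idx (nth_index j :: 'n) = j" if "j < idx q" for j using less_trans[OF that idx_less] by simp
      then show ?thesis by (auto simp: D)
    qed
    then show ?thesis using card_ones_D_col[OF that] by simp
  qed
  fix A assume A: "A \<in> X"
  have tr: "rank (restr I J (transpose B)) = rank (restr J I B)" for I J and B :: "real^'n::{finite,linorder}^'m::{finite,linorder}"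
    by (metis rank_transpose transpose_restr)
  have "rank (restr (below P) (below J1) (transpose A)) = k1 \<and> rank (restr (below P) (below J2) (transpose A)) = k2"
    proof (cases "P = 0")
      case True
      have "restr {} J (transpose A) = 0" for J by (simp add: vec_eq_iff)
      then show ?thesis
        using True S(1) by (auto simp: stair_params_def)
    next
      case False
      note c = stair_corners[OF S(1) False]
      define p :: 'n and q1 q2 :: 'm where "p = nth_index (P - 1)" and "q1 = nth_index (J1 - 1)" and "q2 = nth_index (J2 - 1)"
      have i: "idx p = P - 1" "idx q1 = J1 - 1" "idx q2 = J2 - 1"
        using c(1,2) S(2) by (auto simp: p_def q1_def q2_def)
      have D1: "(q1, p) \<in> D" and D2: "(q2, p) \<in> D" using c(1,2) by (simp_all only: D i)
      have k: "card (ones (idx q1) (idx p)) = k1" "card (ones (idx q2) (idx p)) = k2"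
        using col[OF D1] col[OF D2] c(5,6) by (simp_all only: i card_lessThan)
      have Suc: "Suc (idx p) = P" "Suc (idx q1) = J1" "Suc (idx q2) = J2" using False c(3,4) i by simp_all
      have "rk A J1 P = k1" "rk A J2 P = k2"
        using rk_X_D[OF A D1] rk_X_D[OF A D2] by (simp_all only: k Suc)
      then show ?thesis unfolding tr by simp
    qed
  then have rank: "rank (restr (below P) (below J1) (transpose A)) = k1" "rank (restr (below P) (below J2) (transpose A)) = k2"
    by simp_all
  have k: "card (ones (idx p) (idx q)) = (if idx p < J1 then k1 else k2)" if "(p, q) \<in> D" for p q
    using col[OF that] stair_column[OF S(1)] that by (simp add: D)
  from stair_lines[OF S rank] obtain B where B: "pairwise orthogonal B" "\<forall>b\<in>B. norm b = 1" "finite B"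
    "card B = CARD('n) * CARD('m) - card ?S"
    and r: "\<And>b t (q::'n) (p::'m). b \<in> B \<Longrightarrow> (idx q, idx p) \<in> ?S \<Longrightarrow>
      rank (restr (below (Suc (idx q))) (below (Suc (idx p))) (transpose A + t *\<^sub>R b)) \<le> (if idx p < J1 then k1 else k2)"
    by blast
  have inner: "transpose a \<bullet> transpose b = a \<bullet> b" for a b :: "real^'m::{finite,linorder}^'n::{finite,linorder}"
    unfolding inner_vec_def transpose_def by (simp, rule sum.swap)
  have tt: "transpose (A + t *\<^sub>R transpose b) = transpose A + t *\<^sub>R b" for b :: "real^'m::{finite,linorder}^'n::{finite,linorder}" and t
    by (simp add: vec_eq_iff transpose_def)
  show "\<exists>B. pairwise orthogonal B \<and> (\<forall>b\<in>B. norm b = 1) \<and> finite B \<and>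
      card B = CARD('m) * CARD('n) - card D \<and>
      (\<forall>b\<in>B. \<forall>t p q. (p, q) \<in> D \<longrightarrow> rk (A + t *\<^sub>R b) (Suc (idx p)) (Suc (idx q)) \<le> card (ones (idx p) (idx q)))"
  proof (intro exI[of _ "transpose ` B"] conjI ballI allI impI)
    show "pairwise orthogonal (transpose ` B)"
      using B(1) by (auto simp: pairwise_def orthogonal_def inner)
    show "norm b = 1" if "b \<in> transpose ` B" for b using that B(2) by (auto simp: norm_eq_1 inner)
    show "card (transpose ` B) = CARD('m) * CARD('n) - card D"
      using B(4) cD by (subst card_image) (auto intro: inj_onI simp: mult.commute)
    fix b t p q assume "b \<in> transpose ` B" "(p, q) \<in> D"
    then obtain b' where b': "b' \<in> B" "b = transpose b'" by auto
    have "rk (A + t *\<^sub>R b) (Suc (idx p)) (Suc (idx q)) = rank (restr (below (Suc (idx q))) (below (Suc (idx p))) (transpose A + t *\<^sub>R b'))"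
      unfolding b'(2) tt[symmetric] tr ..
    then show "rk (A + t *\<^sub>R b) (Suc (idx p)) (Suc (idx q)) \<le> card (ones (idx p) (idx q))"
      using r[OF b'(1), of q p t] k[OF \<open>(p, q) \<in> D\<close>] \<open>(p, q) \<in> D\<close> by (simp add: D)
  qed (use B(3) in simp)
qed

end

section \<open>Translation between \<open>X\<close> and \<open>X_set\<close>, and the
  conclusion\<close>

lemma one_at_to_mat:
  fixes \<omega> :: "real^'n::{finite,linorder}^'m::{finite,linorder}"
  shows "one_at (to_mat \<omega>) (idx i) (idx j) \<longleftrightarrow> \<omega> $ i $ j = 1"
  by (simp add: one_at_def to_mat_def)

lemma partial_perm_of_to_mat:
  fixes \<omega> :: "real^'n::{finite,linorder}^'m::{finite,linorder}"
  assumes pp: "partial_permutation (to_mat \<omega>)"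
  shows "partial_perm \<omega>"
proof
  fix i i' :: 'm and j j' :: 'n
  show "j = j'" if "\<omega> $ i $ j = 1" "\<omega> $ i $ j' = 1"
    using one_at_row_unique[OF pp, of "idx i" "idx j" "idx j'"] that by (simp add: one_at_to_mat)
  show "i = i'" if "\<omega> $ i $ j = 1" "\<omega> $ i' $ j = 1"
    using one_at_col_unique[OF pp, of "idx i" "idx j" "idx i'"] that by (simp add: one_at_to_mat)
  have "\<forall>i<CARD('m). \<forall>j<CARD('n). to_mat \<omega> $$ (i, j) = 0 \<or> to_mat \<omega> $$ (i, j) = 1"
    using pp by (simp add: partial_permutation_def to_mat_def)
  then have "to_mat \<omega> $$ (idx i, idx j) = 0 \<or> to_mat \<omega> $$ (idx i, idx j) = 1" by simp
  then show "\<omega> $ i $ j = 0 \<or> \<omega> $ i $ j = 1" by (simp add: to_mat_def)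
qed

context partial_perm
begin

text \<open>Both sides are 0: row \<open>p\<close> of \<mu> has no 1 up to column
  \<open>q\<close>.\<close>

lemma \<phi>_self: "(p, q) \<in> D \<Longrightarrow> \<mu> $ p $ q = \<phi> p q \<mu>"
proof -
  assume D: "(p, q) \<in> D"
  have "\<mu> $ p $ q = 0" using D zero_or_one[of p q] by (auto simp: D_def)
  moreover have "\<mu> $ p $ w k = 0" if "k \<in> ones (idx p) (idx q)" for k
  proof -
    have "idx (w k) \<le> idx q" using onesD[OF that] by (simp add: below_def)
    then show ?thesis using D zero_or_one[of p "w k"] by (auto simp: D_def)
  qed
  ultimately show ?thesis by (simp add: \<phi>_def)
qed

lemma minor_self: "minor P Q \<mu> = mat 1"
proof -
  have "minor P Q \<mu> $ i $ k = (if i = k then 1 else 0)" for i k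
  proof (cases "i \<in> ones P Q \<and> k \<in> ones P Q \<and> i \<noteq> k")
    case True
    then have "\<mu> $ i $ w k = 0" using zero_or_one[of i "w k"] onesD[of k] col_unique by blast
    then show ?thesis using True by (simp add: minor_def)
  next
    case False
    then show ?thesis using onesD[of i] by (auto simp: minor_def)
  qed
  then show ?thesis by (simp add: vec_eq_iff Finite_Cartesian_Product.mat_def)
qed

text \<open>Identifies the ranks of the corners of \<mu>, used in \<open>X_set\<close>, with the
  numbers of 1s used in \<open>X\<close>.\<close>

lemma mem_X: "\<mu> \<in> X"
  by (rule generic_eq_imp_X) (auto simp: generic_def minor_self \<phi>_self)

lemma X_set_eq: "X_set \<mu> = X"
proof -
  have \<mu>: "rk \<mu> P Q = card (ones P Q)" if "P \<le> CARD('m)" "Q \<le> CARD('n)" for P Q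
    using mem_X that by (simp add: X_def)
  \<comment> \<open>\<open>X\<close> also speaks of empty corners, which \<open>X_set\<close> leaves
    out; there both sides are 0.\<close>
  have zero: "rk A P Q = card (ones P Q)" if "P = 0 \<or> Q = 0" for A P Q
  proof -
    have "restr (below P) (below Q) A = 0" using that by (auto simp: vec_eq_iff)
    moreover have "ones P Q = {}" using that by (auto simp: ones_def)
    ultimately show ?thesis by simp
  qed
  have "A \<in> X_set \<mu> \<longleftrightarrow> A \<in> X" for A
  proof
    assume "A \<in> X_set \<mu>"
    then have "rk A P Q = card (ones P Q)" if "P \<in> {1..CARD('m)}" "Q \<in> {1..CARD('n)}" for P Q
      using that \<mu>[of P Q] by (auto simp: X_set_def corner_rank_eq_rank_restr)
    then show "A \<in> X" using zero unfolding X_def by (simp add: Suc_le_eq) (metis gr0I)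
  next
    assume "A \<in> X"
    then show "A \<in> X_set \<mu>" using \<mu> by (simp add: X_def X_set_def corner_rank_eq_rank_restr)
  qed
  then show ?thesis by blast
qed

lemma D_iff: "(p, q) \<in> D \<longleftrightarrow> (idx p, idx q) \<in> partial_perm_diagram (to_mat \<mu>)"
proof -
  have d: "dim_row (to_mat \<mu>) = CARD('m)" "dim_col (to_mat \<mu>) = CARD('n)" by (simp_all add: to_mat_def)
  have "(\<forall>j'\<le>idx q. \<not> one_at (to_mat \<mu>) (idx p) j') \<longleftrightarrow> (\<forall>j. idx j \<le> idx q \<longrightarrow> \<mu> $ p $ j \<noteq> 1)"
    using one_at_to_mat[of \<mu> p] d idx_nth_index unfolding one_at_def by metis
  moreover have "(\<forall>i'\<le>idx p. \<not> one_at (to_mat \<mu>) i' (idx q)) \<longleftrightarrow> (\<forall>i. idx i \<le> idx p \<longrightarrow> \<mu> $ i $ q \<noteq> 1)"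
    using one_at_to_mat[of \<mu> _ q] d idx_nth_index unfolding one_at_def by metis
  ultimately show ?thesis by (simp add: D_def partial_perm_diagram_def d)
qed

end

theorem theorem2:
  fixes \<omega> :: "real^'n::{finite,linorder}^'m::{finite,linorder}"
  assumes "partial_permutation (to_mat \<omega>)"
    and "to_mat \<omega> \<in> Gr2_tilde"
  shows "minimal_submanifold (X_set \<omega>)"
proof -
  interpret partial_perm \<omega> using assms(1) by (rule partial_perm_of_to_mat)
  let ?D = "partial_perm_diagram (to_mat \<omega>)"
  have sub: "?D \<subseteq> {..<CARD('m)} \<times> {..<CARD('n)}"
    by (auto simp: partial_perm_diagram_def to_mat_def)
  have "minimal_submanifold X"
    using Gr2_tilde_diagram[OF assms(2)]
  proof
    assume "is_stair ?D"
    then obtain k1 k2 P J1 J2 where "stair_params k1 k2 P J1 J2" "?D = stair k1 k2 P J1 J2"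
      by (auto simp: is_stair_def)
    then show ?thesis using sub D_iff by (intro minimal_submanifold_X_stair) auto
  next
    assume "is_stair (?D\<inverse>)"
    then obtain k1 k2 P J1 J2 where S: "stair_params k1 k2 P J1 J2" "?D\<inverse> = stair k1 k2 P J1 J2"
      by (auto simp: is_stair_def)
    show ?thesis
      by (rule minimal_submanifold_X_stair_transpose[OF S(1)]) (use sub D_iff in \<open>auto simp flip: S(2)\<close>)
  qed
  then show ?thesis by (simp add: X_set_eq)
qed

end
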